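(* Let $p\in(1,\infty)$, $d_{\mathrm f}\ge1$, $\beta>0$ and $K>1$. Assume that the graph $G=(V,E)$ is $d_{\mathrm f}$-Ahlfors regular, satisfies the $p$-combinatorial ball Loewner condition with exponent $\zeta=d_{\mathrm f}-\beta$ where $1-p\le d_{\mathrm f}-\beta<1$, and satisfies the $p$-capacity upper bound of order $\beta$ (see context). Then there exist constants $\theta_*,C_*>0$, depending only on the constants associated to the assumptions, such that for any $z\in V$ and $R\ge1$ with $B(z,KR)\ne V$ there exists a function $\varphi_{z,R}:V\to[0,1]$ satisfying $$\varphi_{z,R}|_{B(z,R)}\equiv1,\qquad\operatorname{supp}[\varphi_{z,R}]\subseteq B(z,KR),$$ $$\sum_{\{x,y\}\in E}|\varphi_{z,R}(x)-\varphi_{z,R}(y)|^p\le C_*R^{d_{\mathrm f}-\beta},$$ and $$|\varphi_{z,R}(x)-\varphi_{z,R}(y)|\le C_*\Big(\frac{d_G(x,y)}R\Big)^{\theta_*}\quad\text{for any }x,y\in V.$$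
   Context: $G=(V,E)$ is a locally finite connected simple undirected graph with countable vertex set and $\deg(G):=\sup_x\deg_G(x)<\infty$; $d_G$ is the graph distance, $B(x,R)=\{y\in V:d_G(x,y)<R\}$, and $\operatorname{dist}$, $\operatorname{diam}$ are with respect to $d_G$. $\operatorname{supp}[f]=\{x\in V: f(x)\ne0\}$. $d_{\mathrm f}$-Ahlfors regular: there is $C_{\mathrm{AR}}\ge1$ with $C_{\mathrm{AR}}^{-1}r^{d_{\mathrm f}}\le\#B(x,r)\le C_{\mathrm{AR}}r^{d_{\mathrm f}}$ for all $x\in V$, $r\in[1,\operatorname{diam}(V)+1)$. A path is a finite sequence $[x_0,\dots,x_n]$, $n\ge1$, of vertices with consecutive ones adjacent, identified with its vertex set; $\mathrm{Path}(F_1,F_2)$ is the set of paths with $x_0\in F_1$, $x_n\in F_2$; $\operatorname{Mod}_p^G(\Theta)=\inf\{\sum_{v\in V}\rho(v)^p:\rho:V\to[0,\infty),\ \sum_{v\in\theta}\rho(v)\ge1\ \forall\theta\in\Theta\}$. $p$-combinatorial ball Loewner condition with exponent $\zeta$: there exists $A\ge1$ such that for every $\kappa>0$ there exist $c_{\mathrm{BCL}}(\kappa)>0$, $L_{\mathrm{BCL}}(\kappa)>0$ with $\operatorname{Mod}_p^G(\{\theta\in\mathrm{Path}(B_1,B_2):\operatorname{diam}\theta\le L_{\mathrm{BCL}}(\kappa)R\})\ge c_{\mathrm{BCL}}(\kappa)R^\zeta$ whenever $R\in[1,\operatorname{diam}(G)/A)$ and $B_1,B_2$ are balls of radius $R$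 with $\operatorname{dist}(B_1,B_2)\le\kappa R$. $p$-capacity upper bound of order $\beta$: there are $C_{\mathrm{cap}}>0$, $A_{\mathrm{cap}}\ge1$ such that for all $x\in V$, $R\in[1,\operatorname{diam}(G)/A_{\mathrm{cap}})$, $\operatorname{cap}_p^G(B(x,R),B(x,2R)^c)\le C_{\mathrm{cap}}\frac{\#B(x,R)}{R^\beta}$, where $\operatorname{cap}_p^G(A_0,A_1)=\inf\{\sum_{\{u,v\}\in E}|f(u)-f(v)|^p: f:V\to\mathbb R,\ f=0\text{ on }A_0,\ f=1\text{ on }A_1\}$. The constants associated to the assumptions are $p,d_{\mathrm f},\beta,K,\deg(G),C_{\mathrm{AR}},A,c_{\mathrm{BCL}}(\cdot),L_{\mathrm{BCL}}(\cdot),C_{\mathrm{cap}},A_{\mathrm{cap}}$. *)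

theory Defs
  imports "HOL-Analysis.Analysis"
begin

text \<open>
  A graph is given by its vertex set \<open>V\<close> and its set \<open>E\<close> of edges, each edge being a two-element
  subset of \<open>V\<close>. Functions on vertices are total functions on the type \<open>'a\<close>; only their values
  on \<open>V\<close> matter. Diameters, set distances and \<open>p\<close>-energies may be infinite and
  are therefore valued in \<^typ>\<open>ennreal\<close>.
\<close>

definition adjacent :: "'a set set \<Rightarrow> 'a \<Rightarrow> 'a \<Rightarrow> bool" where
  "adjacent E u v \<longleftrightarrow> {u, v} \<in> E"

definition neighbours :: "'a set set \<Rightarrow> 'a \<Rightarrow> 'a set" where
  "neighbours E x = {y. adjacent E x y}"

text \<open>The walk \<open>[x]\<close> of length 0 is allowed here, but it is not a path in the sense of \<open>paths\<close> below.\<close>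

definition walk_betw :: "'a set set \<Rightarrow> 'a \<Rightarrow> 'a list \<Rightarrow> 'a \<Rightarrow> bool" where
  "walk_betw E x xs y \<longleftrightarrow> xs \<noteq> [] \<and> hd xs = x \<and> last xs = y \<and> successively (adjacent E) xs"

definition connected_simple_graph :: "'a set \<Rightarrow> 'a set set \<Rightarrow> bool" where
  "connected_simple_graph V E \<longleftrightarrow>
     V \<noteq> {} \<and> countable V \<and>
     (\<forall>e\<in>E. e \<subseteq> V \<and> card e = 2) \<and>
     (\<forall>x\<in>V. finite (neighbours E x)) \<and>
     (\<forall>x\<in>V. \<forall>y\<in>V. \<exists>xs. walk_betw E x xs y)"

definition graph_deg :: "'a set \<Rightarrow> 'a set set \<Rightarrow> enat" where
  "graph_deg V E = (SUP x\<in>V. enat (card (neighbours E x)))"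

definition gdist :: "'a set set \<Rightarrow> 'a \<Rightarrow> 'a \<Rightarrow> nat" where
  "gdist E x y = (LEAST n. \<exists>xs. walk_betw E x xs y \<and> length xs = Suc n)"

definition gball :: "'a set \<Rightarrow> 'a set set \<Rightarrow> 'a \<Rightarrow> real \<Rightarrow> 'a set" where
  "gball V E x R = {y \<in> V. real (gdist E x y) < R}"

definition gdiam :: "'a set set \<Rightarrow> 'a set \<Rightarrow> ennreal" where
  "gdiam E S = (SUP x\<in>S. SUP y\<in>S. of_nat (gdist E x y))"

definition gsetdist :: "'a set set \<Rightarrow> 'a set \<Rightarrow> 'a set \<Rightarrow> ennreal" where
  "gsetdist E S T = (INF x\<in>S. INF y\<in>T. of_nat (gdist E x y))"

text \<open>The value \<open>\<bar>f u - f v\<bar>\<close> at an unordered pair \<open>{u, v}\<close>.\<close>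

definition edge_diff :: "('a \<Rightarrow> real) \<Rightarrow> 'a set \<Rightarrow> real" where
  "edge_diff f e = (THE d. \<exists>u v. e = {u, v} \<and> d = \<bar>f u - f v\<bar>)"

lemma edge_diff_pair [simp]: "edge_diff f {u, v} = \<bar>f u - f v\<bar>"
  unfolding edge_diff_def
  by (rule the_equality) (auto simp: doubleton_eq_iff abs_minus_commute)

definition energy :: "'a set set \<Rightarrow> real \<Rightarrow> ('a \<Rightarrow> real) \<Rightarrow> ennreal" where
  "energy E p f = (\<Sum>\<^sub>\<infinity>e\<in>E. ennreal (edge_diff f e powr p))"

definition capacity :: "'a set set \<Rightarrow> real \<Rightarrow> 'a set \<Rightarrow> 'a set \<Rightarrow> ennreal" where
  "capacity E p A0 A1 = (INF f\<in>{f. (\<forall>x\<in>A0. f x = 0) \<and> (\<forall>x\<in>A1. f x = 1)}. energy E p f)"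

definition paths :: "'a set \<Rightarrow> 'a set set \<Rightarrow> 'a set \<Rightarrow> 'a set \<Rightarrow> 'a list set" where
  "paths V E F1 F2 =
     {xs. length xs \<ge> 2 \<and> set xs \<subseteq> V \<and> successively (adjacent E) xs \<and> hd xs \<in> F1 \<and> last xs \<in> F2}"

text \<open>
  Paths are identified with their vertex sets, so a vertex visited several times contributes once
  to the sum \<open>\<Sum>v\<in>set xs. \<rho> v\<close>.
\<close>

definition admissible :: "'a set \<Rightarrow> 'a list set \<Rightarrow> ('a \<Rightarrow> real) \<Rightarrow> bool" where
  "admissible V \<Theta> \<rho> \<longleftrightarrow> (\<forall>v\<in>V. 0 \<le> \<rho> v) \<and> (\<forall>xs\<in>\<Theta>. 1 \<le> (\<Sum>v\<in>set xs. \<rho> v))"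

definition modulus :: "'a set \<Rightarrow> real \<Rightarrow> 'a list set \<Rightarrow> ennreal" where
  "modulus V p \<Theta> = (INF \<rho>\<in>{\<rho>. admissible V \<Theta> \<rho>}. \<Sum>\<^sub>\<infinity>v\<in>V. ennreal (\<rho> v powr p))"

text \<open>
  The next three predicates carry their constants as explicit arguments, so that the dependence of other
  constants on them can be expressed by the order of quantifiers. The graph satisfies the
  respective condition iff such constants exist.
\<close>

definition ahlfors_regular :: "'a set \<Rightarrow> 'a set set \<Rightarrow> real \<Rightarrow> real \<Rightarrow> bool" where
  "ahlfors_regular V E df C \<longleftrightarrow> C \<ge> 1 \<and>
     (\<forall>x\<in>V. \<forall>r\<ge>1. ennreal r < gdiam E V + 1 \<longrightarrow>
        inverse C * r powr df \<le> real (card (gball V E x r)) \<and>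
        real (card (gball V E x r)) \<le> C * r powr df)"

definition ball_loewner ::
  "'a set \<Rightarrow> 'a set set \<Rightarrow> real \<Rightarrow> real \<Rightarrow> real \<Rightarrow> (real \<Rightarrow> real) \<Rightarrow> (real \<Rightarrow> real) \<Rightarrow> bool" where
  "ball_loewner V E p \<zeta> A c L \<longleftrightarrow> A \<ge> 1 \<and>
     (\<forall>\<kappa>>0. c \<kappa> > 0 \<and> L \<kappa> > 0 \<and>
        (\<forall>R\<ge>1. \<forall>x\<in>V. \<forall>y\<in>V.
           ennreal R < gdiam E V / ennreal A \<longrightarrow>
           gsetdist E (gball V E x R) (gball V E y R) \<le> ennreal (\<kappa> * R) \<longrightarrow>
           modulus V p {xs \<in> paths V E (gball V E x R) (gball V E y R).
                          gdiam E (set xs) \<le> ennreal (L \<kappa> * R)}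
             \<ge> ennreal (c \<kappa> * R powr \<zeta>)))"

definition capacity_upper_bound ::
  "'a set \<Rightarrow> 'a set set \<Rightarrow> real \<Rightarrow> real \<Rightarrow> real \<Rightarrow> real \<Rightarrow> bool" where
  "capacity_upper_bound V E p \<beta> C A \<longleftrightarrow> C > 0 \<and> A \<ge> 1 \<and>
     (\<forall>x\<in>V. \<forall>R\<ge>1. ennreal R < gdiam E V / ennreal A \<longrightarrow>
        capacity E p (gball V E x R) (V - gball V E x (2 * R))
          \<le> ennreal (C * real (card (gball V E x R)) / R powr \<beta>))"

end

theory Submission
  imports Defs
begin

text \<open>
  The cutoff function is the equilibrium potential \<open>u\<close> of a condenser: it minimises the \<open>p\<close>-energy
  among the functions that are 1 on the ball of radius \<open>R\<close> about \<open>z\<close> and 0 on a plate \<open>F\<close>. The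
  complement of the ball of radius \<open>K * R\<close> would be a bad choice of \<open>F\<close>: it may contain small
  isolated pieces, next to which \<open>u\<close> need not be regular. Instead, \<open>F\<close> consists of the vertices that
  can be joined to distance \<open>K * R\<close> from \<open>z\<close> without entering the ball of radius
  \<open>(1 + K) / 2 * R\<close> (\<open>far_part\<close>). Then both plates are unions of connected sets whose diameter is
  comparable to \<open>R\<close>. The energy of \<open>u\<close> is at most that of the maximum of boundedly many capacity
  cutoffs at a radius comparable to \<open>R\<close> (\<open>equilibrium_energy_bound\<close>).

  Hoelder continuity follows once the oscillation of \<open>u\<close> on a ball drops by a fixed factor whenever
  the radius does (\<open>oscillation_decay\<close>). Let \<open>\<mu>\<close> be the oscillation on a ball that misses the inner
  plate (the other case is symmetric), and let \<open>w\<close> be the supremum of \<open>u\<close> there minus \<open>u\<close>. If the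
  oscillation hardly drops, a much smaller concentric ball contains points \<open>a\<close> and \<open>b\<close> at which \<open>w\<close>
  is below \<open>\<mu> / Q ^ N\<close> and close to \<open>\<mu>\<close>, respectively. By the maximum principle
  (\<open>equilibrium_reach\<close>) these points are the ends of long walks along which \<open>w\<close> stays as small, or as
  large. So \<open>log w\<close> changes by a multiple of \<open>N\<close> between two long walks that start close to each other, and
  the Loewner inequality \<open>crossing_gap_energy\<close> bounds its energy at radius \<open>r\<close> from below by a
  multiple of \<open>N powr p * r powr (df - \<beta>)\<close>. On the other hand, the truncation of \<open>w\<close> at a height \<open>t\<close>
  has energy at most \<open>t powr p\<close> times a capacity (\<open>caccioppoli\<close>), and adjacent values of \<open>w\<close> are
  comparable (\<open>equilibrium_neighbour\<close>), so that every edge lives on essentially one of the \<open>N\<close> levels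
  \<open>\<mu> / Q ^ j\<close>. Each level thus contributes a multiple of \<open>r powr (df - \<beta>)\<close>, and the
  energy of \<open>log w\<close> is at most a multiple of \<open>N * r powr (df - \<beta>)\<close>. As \<open>p > 1\<close>, this is
  absurd for large \<open>N\<close>.

  It remains to pass from balls to walks in the Loewner condition, and this is where the exponent
  \<open>\<zeta> = df - \<beta>\<close> has to be less than 1. Suppose that \<open>f\<close> differs by \<open>h\<close> between two walks that cross
  an annulus of radius \<open>r\<close>. Pick a small ball, of radius \<open>r / \<Lambda>\<close>, centred on each walk. If the energy
  near the annulus is not already of the desired order, the ball Loewner condition supplies a walk
  between these small balls along which \<open>f\<close> varies by at most \<open>h / 4\<close>; near one of its ends this walk
  and one of the original walks form the same configuration at scale \<open>r / \<Lambda>\<close> with gap \<open>h / 4\<close>. A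
  multiple of \<open>\<Lambda>\<close> such configurations fit into the annulus, and together they ask for more energy
  than the original one, since \<open>\<Lambda> powr (1 - \<zeta>)\<close> beats \<open>4 powr p\<close>. The recursion ends at scale 1,
  where the inequality is trivial. As the Loewner walks may be much longer than the distance that
  they bridge, energies have to be measured in large, overlapping balls; the functional
  \<open>multiscale_energy\<close> makes the recursion additive nevertheless.
\<close>

section \<open>Walks, distances and balls\<close>

locale lf_graph =
  fixes V :: "'a set" and E :: "'a set set"
  assumes graph: "connected_simple_graph V E"
begin

lemma edge_subset: "e \<in> E \<Longrightarrow> e \<subseteq> V"
  using graph by (auto simp: connected_simple_graph_def)

lemma edge_pairE:
  assumes "e \<in> E" obtains u v where "e = {u, v}" "u \<noteq> v" "u \<in> V" "v \<in> V"
proof -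
  have "card e = 2" "e \<subseteq> V" using graph assms by (auto simp: connected_simple_graph_def)
  then show ?thesis using that by (auto simp: card_2_iff)
qed

lemma adjacent_sym: "adjacent E u v \<longleftrightarrow> adjacent E v u"
  by (simp add: adjacent_def insert_commute)

lemma adjacent_in_V: "adjacent E u v \<Longrightarrow> u \<in> V \<and> v \<in> V"
  using edge_subset by (auto simp: adjacent_def)

lemma finite_neighbours: "x \<in> V \<Longrightarrow> finite (neighbours E x)"
  using graph by (auto simp: connected_simple_graph_def)

definition star :: "'a \<Rightarrow> 'a set set" where
  "star x = {e \<in> E. x \<in> e}"

lemma star_eq: "star x = (\<lambda>y. {x, y}) ` neighbours E x"
proof -
  have "\<exists>y. {x, y} \<in> E \<and> e = {x, y}" if e: "e \<in> E" "x \<in> e" for e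
  proof -
    obtain u v where "e = {u, v}" using edge_pairE[OF e(1)] by metis
    then show ?thesis using e by (auto simp: insert_commute)
  qed
  then show ?thesis unfolding star_def neighbours_def adjacent_def by blast
qed

lemma finite_star: "x \<in> V \<Longrightarrow> finite (star x)"
  by (simp add: star_eq finite_neighbours)

lemma card_star: "x \<in> V \<Longrightarrow> card (star x) \<le> card (neighbours E x)"
  by (simp add: star_eq card_image_le finite_neighbours)

definition touching :: "'a set \<Rightarrow> 'a set set" where
  "touching S = {e \<in> E. e \<inter> S \<noteq> {}}"

lemma touching_eq: "touching S = (\<Union>x\<in>S. star x)"
  by (auto simp: touching_def star_def)

lemma touching_mono: "S \<subseteq> S' \<Longrightarrow> touching S \<subseteq> touching S'"
  by (auto simp: touching_def)

lemma finite_touching: "finite S \<Longrightarrow> S \<subseteq> V \<Longrightarrow> finite (touching S)"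
  by (auto simp: touching_eq intro!: finite_star)

lemma ex_walk: "x \<in> V \<Longrightarrow> y \<in> V \<Longrightarrow> \<exists>xs. walk_betw E x xs y"
  using graph by (auto simp: connected_simple_graph_def)

lemma walk_subset: "walk_betw E x xs y \<Longrightarrow> x \<in> V \<Longrightarrow> set xs \<subseteq> V"
proof (induction xs arbitrary: x)
  case Nil then show ?case by (simp add: walk_betw_def)
next
  case (Cons a xs)
  show ?case
  proof (cases "xs = []")
    case True with Cons.prems show ?thesis by (auto simp: walk_betw_def)
  next
    case False
    then have "adjacent E a (hd xs)" "walk_betw E (hd xs) xs y"
      using Cons.prems(1) by (auto simp: walk_betw_def successively_Cons)
    then show ?thesis using Cons.IH[of "hd xs"] adjacent_in_V[of a "hd xs"] by auto
  qed
qed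

lemma walk_append:
  assumes "walk_betw E x xs y" "walk_betw E y ys z"
  shows "walk_betw E x (xs @ tl ys) z"
proof -
  obtain ys' where ys: "ys = y # ys'"
    using assms(2) by (cases ys) (auto simp: walk_betw_def)
  show ?thesis using assms unfolding ys
    by (auto simp: walk_betw_def successively_append_iff successively_Cons)
qed

lemma set_walk_append:
  assumes "walk_betw E x xs y" "walk_betw E y ys z"
  shows "set (xs @ tl ys) = set xs \<union> set ys"
proof -
  have "xs \<noteq> []" "last xs = y" "ys = y # tl ys"
    using assms by (auto simp: walk_betw_def)
  then show ?thesis by (metis UnCI Un_insert_right insert_absorb last_in_set list.simps(15) set_append)
qed

lemma walk_rev: "walk_betw E x xs y \<Longrightarrow> walk_betw E y (rev xs) x"
proof -
  have "successively (\<lambda>x y. adjacent E y x) xs = successively (adjacent E) xs"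
    by (intro successively_cong) (auto simp: adjacent_def insert_commute)
  then show "walk_betw E x xs y \<Longrightarrow> walk_betw E y (rev xs) x"
    by (simp add: walk_betw_def hd_rev last_rev)
qed

lemma gdist_le: "walk_betw E x xs y \<Longrightarrow> gdist E x y \<le> length xs - 1"
proof -
  assume w: "walk_betw E x xs y"
  then have "length xs = Suc (length xs - 1)" by (cases xs) (auto simp: walk_betw_def)
  then show ?thesis unfolding gdist_def using w by (intro Least_le) auto
qed

lemma geodesic:
  assumes "x \<in> V" "y \<in> V"
  obtains xs where "walk_betw E x xs y" "length xs = Suc (gdist E x y)"
proof -
  obtain xs where w: "walk_betw E x xs y" using ex_walk assms by blast
  then have "length xs = Suc (length xs - 1)" by (cases xs) (auto simp: walk_betw_def)
  then have "\<exists>n xs. walk_betw E x xs y \<and> length xs = Suc n" using w by blast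
  then have "\<exists>xs. walk_betw E x xs y \<and> length xs = Suc (gdist E x y)"
    unfolding gdist_def by (rule LeastI_ex)
  then show ?thesis using that by blast
qed

lemma gdist_self [simp]: "gdist E x x = 0"
  using gdist_le[of x "[x]" x] by (simp add: walk_betw_def)

lemma gdist_eq_0: "x \<in> V \<Longrightarrow> y \<in> V \<Longrightarrow> gdist E x y = 0 \<Longrightarrow> x = y"
  using geodesic[of x y] by (metis length_0_conv length_Suc_conv walk_betw_def list.sel(1) last_ConsL)

lemma gdist_sym_le: "x \<in> V \<Longrightarrow> y \<in> V \<Longrightarrow> gdist E y x \<le> gdist E x y"
  by (metis geodesic walk_rev gdist_le length_rev diff_Suc_1)

lemma gdist_sym: "x \<in> V \<Longrightarrow> y \<in> V \<Longrightarrow> gdist E x y = gdist E y x"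
  by (simp add: gdist_sym_le le_antisym)

lemma gdist_triangle:
  assumes "x \<in> V" "y \<in> V" "z \<in> V"
  shows "gdist E x z \<le> gdist E x y + gdist E y z"
proof -
  obtain xs where xs: "walk_betw E x xs y" "length xs = Suc (gdist E x y)" using geodesic assms by metis
  obtain ys where ys: "walk_betw E y ys z" "length ys = Suc (gdist E y z)" using geodesic assms by metis
  show ?thesis using gdist_le[OF walk_append[OF xs(1) ys(1)]] xs ys by simp
qed

lemma gdist_adjacent: "adjacent E x y \<Longrightarrow> gdist E x y \<le> 1"
  using gdist_le[of x "[x, y]" y] by (simp add: walk_betw_def)

lemma gdist_adjacent_le: "q \<in> V \<Longrightarrow> adjacent E x y \<Longrightarrow> gdist E q y \<le> gdist E q x + 1"
  using gdist_triangle[of q x y] gdist_adjacent[of x y] adjacent_in_V[of x y] by linarith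

lemma gball_subset: "gball V E x r \<subseteq> V"
  by (auto simp: gball_def)

lemma finite_nat_ball: "x \<in> V \<Longrightarrow> finite {y \<in> V. gdist E x y \<le> n}"
proof (induction n)
  case 0
  have "{y \<in> V. gdist E x y \<le> 0} \<subseteq> {x}" using 0 gdist_eq_0 by auto
  then show ?case using finite_subset by blast
next
  case (Suc n)
  have "y \<in> {y \<in> V. gdist E x y \<le> n} \<union> (\<Union>u\<in>{y \<in> V. gdist E x y \<le> n}. neighbours E u)"
    if y: "y \<in> V" "gdist E x y \<le> Suc n" for y
  proof (cases "gdist E x y \<le> n")
    case False
    obtain xs where xs: "walk_betw E x xs y" "length xs = Suc (gdist E x y)"
      using geodesic Suc y by metis
    then obtain ys where ys: "xs = ys @ [y]"
      by (metis append_butlast_last_id walk_betw_def)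
    then have "ys \<noteq> []" using xs False y by auto
    then have w: "walk_betw E x ys (last ys)" and a: "adjacent E (last ys) y"
      using xs(1) by (auto simp: walk_betw_def ys successively_append_iff)
    have "gdist E x (last ys) \<le> n" using gdist_le[OF w] xs(2) y(2) ys by simp
    moreover have "last ys \<in> V" using a adjacent_in_V by blast
    ultimately show ?thesis using a by (auto simp: neighbours_def)
  qed (use y in auto)
  then have "{y \<in> V. gdist E x y \<le> Suc n} \<subseteq>
      {y \<in> V. gdist E x y \<le> n} \<union> (\<Union>u\<in>{y \<in> V. gdist E x y \<le> n}. neighbours E u)" by blast
  moreover have "finite \<dots>" using Suc finite_neighbours by auto
  ultimately show ?case using finite_subset by blast
qed

lemma finite_gball: "x \<in> V \<Longrightarrow> finite (gball V E x r)"
proof (rule finite_subset[OF _ finite_nat_ball[of x "nat \<lceil>r\<rceil>"]])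
  show "gball V E x r \<subseteq> {y \<in> V. gdist E x y \<le> nat \<lceil>r\<rceil>}"
    by (auto simp: gball_def) linarith
qed

lemma gball_mono: "r \<le> s \<Longrightarrow> gball V E x r \<subseteq> gball V E x s"
  by (auto simp: gball_def)

lemma gball_triangle:
  assumes "x \<in> V" "y \<in> V" "real (gdist E x y) + r \<le> s"
  shows "gball V E y r \<subseteq> gball V E x s"
proof
  fix u assume u: "u \<in> gball V E y r"
  then have "gdist E x u \<le> gdist E x y + gdist E y u" using assms gdist_triangle by (auto simp: gball_def)
  then have "real (gdist E x u) \<le> real (gdist E x y) + real (gdist E y u)" by linarith
  then show "u \<in> gball V E x s" using u assms by (auto simp: gball_def)
qed

lemma touching_gball_subset:
  assumes "x \<in> V" "e \<in> touching (gball V E x r)"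
  shows "e \<subseteq> gball V E x (r + 1)"
proof
  fix y assume y: "y \<in> e"
  obtain w where w: "w \<in> e" "w \<in> gball V E x r" "e \<in> E" using assms by (auto simp: touching_def)
  obtain u v where uv: "e = {u, v}" "u \<in> V" "v \<in> V" using edge_pairE[OF w(3)] by metis
  then have "y = w \<or> adjacent E w y" using w y by (auto simp: adjacent_def insert_commute)
  then have "gdist E x y \<le> gdist E x w + 1" using gdist_adjacent_le assms(1) by fastforce
  then show "y \<in> gball V E x (r + 1)" using w uv y by (auto simp: gball_def)
qed

lemma gdiam_ge: "x \<in> S \<Longrightarrow> y \<in> S \<Longrightarrow> of_nat (gdist E x y) \<le> gdiam E S"
  unfolding gdiam_def by (meson SUP_upper2 order_refl)

lemma gdiam_leD:
  assumes "gdiam E S \<le> ennreal r" "x \<in> S" "y \<in> S"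
  shows "real (gdist E x y) \<le> r \<or> gdist E x y = 0"
proof -
  have "ennreal (real (gdist E x y)) \<le> ennreal r"
    using order_trans[OF gdiam_ge[OF assms(2,3)] assms(1)] by (simp add: ennreal_of_nat_eq_real_of_nat)
  then show ?thesis by (cases "r \<ge> 0") (auto simp: ennreal_neg)
qed

text \<open>
  A quantity that grows by at most one along each edge takes every intermediate value on a walk. The
  list need not be traversed from \<open>u\<close> to \<open>v\<close>, so the induction has to treat both orders.
\<close>

lemma successively_ivt:
  fixes g :: "'a \<Rightarrow> nat"
  assumes "successively (adjacent E) xs"
    and "\<And>x y. adjacent E x y \<Longrightarrow> g y \<le> g x + 1"
    and "u \<in> set xs" "v \<in> set xs" "g u \<le> n" "n \<le> g v"
  shows "\<exists>w\<in>set xs. g w = n"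
  using assms(1,3-)
proof (induction xs arbitrary: u v)
  case (Cons x ys)
  show ?case
  proof (cases "ys = []")
    case False
    then have s: "successively (adjacent E) ys" "adjacent E x (hd ys)" "hd ys \<in> set ys"
      using Cons.prems(1) by (auto simp: successively_Cons)
    have b: "g (hd ys) \<le> g x + 1" "g x \<le> g (hd ys) + 1"
      using s(2) assms(2) adjacent_sym by blast+
    note IH = Cons.IH[OF s(1)]
    consider "u \<in> set ys" "v \<in> set ys" | "u = x" "v = x" | "u = x" "v \<in> set ys" | "v = x" "u \<in> set ys"
      using Cons.prems by auto
    then show ?thesis
    proof cases
      case 1 then show ?thesis using IH[of u v] Cons.prems by auto
    next
      case 2 then show ?thesis using Cons.prems by auto
    next
      case 3
      show ?thesis
      proof (cases "g (hd ys) \<le> n")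
        case True then show ?thesis using IH[of "hd ys" v] s 3 Cons.prems by auto
      next
        case False then have "g x = n" using b 3 Cons.prems by auto
        then show ?thesis by simp
      qed
    next
      case 4
      show ?thesis
      proof (cases "n \<le> g (hd ys)")
        case True then show ?thesis using IH[of u "hd ys"] s 4 Cons.prems by auto
      next
        case False then have "g x = n" using b 4 Cons.prems by auto
        then show ?thesis by simp
      qed
    qed
  qed (use Cons.prems in auto)
qed simp

lemma dist_ivt:
  assumes "successively (adjacent E) xs" "q \<in> V" "u \<in> set xs" "v \<in> set xs"
    "gdist E q u \<le> n" "n \<le> gdist E q v"
  shows "\<exists>w\<in>set xs. gdist E q w = n"
  using successively_ivt[of xs "gdist E q"] gdist_adjacent_le assms by blast

section \<open>Discrete energies\<close>

lemma edge_diff_nonneg: "e \<in> E \<Longrightarrow> 0 \<le> edge_diff f e"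
  by (erule edge_pairE) simp

text \<open>
  The modulus sums over vertices and the energy over edges. The densities below mediate: they are
  additive over vertices and exceed the energy of the edges by a factor of at most 2.
\<close>
definition vertex_energy :: "real \<Rightarrow> ('a \<Rightarrow> real) \<Rightarrow> 'a \<Rightarrow> real" where
  "vertex_energy p f v = (\<Sum>e\<in>star v. edge_diff f e powr p)"

definition region_energy :: "real \<Rightarrow> ('a \<Rightarrow> real) \<Rightarrow> 'a set \<Rightarrow> real" where
  "region_energy p f S = (\<Sum>v\<in>S. vertex_energy p f v)"

definition edge_energy :: "real \<Rightarrow> 'a set set \<Rightarrow> ('a \<Rightarrow> real) \<Rightarrow> real" where
  "edge_energy p T f = (\<Sum>e\<in>T. edge_diff f e powr p)"

lemma vertex_energy_nonneg: "0 \<le> vertex_energy p f v"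
  by (simp add: vertex_energy_def sum_nonneg)

lemma region_energy_nonneg: "0 \<le> region_energy p f S"
  by (simp add: region_energy_def sum_nonneg vertex_energy_nonneg)

lemma edge_energy_nonneg: "0 \<le> edge_energy p T f"
  by (simp add: edge_energy_def sum_nonneg)

lemma region_energy_mono: "S \<subseteq> T \<Longrightarrow> finite T \<Longrightarrow> region_energy p f S \<le> region_energy p f T"
  unfolding region_energy_def by (rule sum_mono2) (auto simp: vertex_energy_nonneg)

lemma edge_energy_mono: "S \<subseteq> T \<Longrightarrow> finite T \<Longrightarrow> edge_energy p S f \<le> edge_energy p T f"
  unfolding edge_energy_def by (rule sum_mono2) auto

lemma region_energy_le_edge_energy:
  assumes "finite S" "S \<subseteq> V"
  shows "region_energy p f S \<le> 2 * edge_energy p (touching S) f"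
proof -
  have fin: "finite (touching S)" using finite_touching assms by blast
  have "region_energy p f S = (\<Sum>v\<in>S. \<Sum>e\<in>touching S. if v \<in> e then edge_diff f e powr p else 0)"
    unfolding region_energy_def vertex_energy_def
  proof (rule sum.cong[OF refl])
    fix v assume "v \<in> S"
    then have "touching S \<inter> {e. v \<in> e} = star v" by (auto simp: touching_def star_def)
    then show "(\<Sum>e\<in>star v. edge_diff f e powr p) = (\<Sum>e\<in>touching S. if v \<in> e then edge_diff f e powr p else 0)"
      using fin by (simp add: sum.If_cases)
  qed
  also have "\<dots> = (\<Sum>e\<in>touching S. \<Sum>v\<in>S. if v \<in> e then edge_diff f e powr p else 0)"
    by (rule sum.swap)
  also have "\<dots> \<le> (\<Sum>e\<in>touching S. 2 * edge_diff f e powr p)"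
  proof (rule sum_mono)
    fix e assume "e \<in> touching S"
    then have "e \<in> E" by (simp add: touching_def)
    then obtain a b where "e = {a, b}" "a \<noteq> b" using edge_pairE by metis
    then have "card e = 2" "finite e" by auto
    then have "card (S \<inter> e) \<le> 2" by (metis Int_lower2 card_mono)
    then have "real (card (S \<inter> e)) * edge_diff f e powr p \<le> 2 * edge_diff f e powr p"
      by (intro mult_right_mono) auto
    then show "(\<Sum>v\<in>S. if v \<in> e then edge_diff f e powr p else 0) \<le> 2 * edge_diff f e powr p"
      using assms(1) by (simp add: sum.If_cases Int_def)
  qed
  finally show ?thesis by (simp add: edge_energy_def sum_distrib_left)
qed

lemma diff_le_vertex_energy:
  assumes "adjacent E x y" "1 \<le> p"
  shows "\<bar>f x - f y\<bar> \<le> vertex_energy p f x powr (1/p)"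
proof -
  have x: "x \<in> V" using assms adjacent_in_V by blast
  have "edge_diff f {x, y} powr p \<le> vertex_energy p f x"
    unfolding vertex_energy_def using assms x
    by (intro member_le_sum) (auto simp: star_def adjacent_def finite_star[unfolded star_def])
  then have "(\<bar>f x - f y\<bar> powr p) powr (1/p) \<le> vertex_energy p f x powr (1/p)"
    using assms by (intro powr_mono2) auto
  then show ?thesis using assms by (simp add: powr_powr)
qed

text \<open>
  This makes \<open>(vertex_energy p f) powr (1/p)\<close> a test density for the modulus. Each step is charged to the
  vertex that it leaves. A vertex that occurs again later in the list is not charged at its first
  occurrence, since the remaining list has the same vertex set.
\<close>

lemma osc_walk:
  assumes "successively (adjacent E) xs" "1 \<le> p" "u \<in> set xs" "v \<in> set xs"
  shows "\<bar>f u - f v\<bar> \<le> (\<Sum>y\<in>set xs. vertex_energy p f y powr (1/p))"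
  using assms(1,3,4)
proof (induction xs arbitrary: u v)
  case (Cons x ys)
  let ?s = "\<lambda>S. \<Sum>y\<in>S. vertex_energy p f y powr (1/p)"
  have nn: "0 \<le> ?s S" for S by (intro sum_nonneg) auto
  show ?case
  proof (cases "ys = []")
    case True then show ?thesis using Cons.prems by simp
  next
    case False
    then have s: "successively (adjacent E) ys" "adjacent E x (hd ys)" "hd ys \<in> set ys"
      using Cons.prems(1) by (auto simp: successively_Cons)
    note IH = Cons.IH[OF s(1)]
    show ?thesis
    proof (cases "x \<in> set ys")
      case True
      then have "set (x # ys) = set ys" by auto
      then show ?thesis using IH Cons.prems by metis
    next
      case False
      then have eq: "?s (set (x # ys)) = vertex_energy p f x powr (1/p) + ?s (set ys)" by simp
      have d: "\<bar>f x - f (hd ys)\<bar> \<le> vertex_energy p f x powr (1/p)" using diff_le_vertex_energy s assms by blast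
      consider "u \<in> set ys" "v \<in> set ys" | "u = x" "v = x" | "u = x" "v \<in> set ys" | "v = x" "u \<in> set ys"
        using Cons.prems by auto
      then show ?thesis
      proof cases
        case 1 then show ?thesis using IH[of u v] eq by (smt (verit) powr_ge_zero)
      next
        case 2 then show ?thesis using nn[of "set (x # ys)"] by simp
      next
        case 3
          have "\<bar>f (hd ys) - f v\<bar> \<le> ?s (set ys)" using IH 3 s(3) by blast
          moreover have "\<bar>f u - f v\<bar> \<le> \<bar>f x - f (hd ys)\<bar> + \<bar>f (hd ys) - f v\<bar>" unfolding 3(1) by linarith
          ultimately show ?thesis using d eq by linarith
      next
        case 4
          have "\<bar>f u - f (hd ys)\<bar> \<le> ?s (set ys)" using IH 4 s(3) by blast
          moreover have "\<bar>f u - f v\<bar> \<le> \<bar>f x - f (hd ys)\<bar> + \<bar>f u - f (hd ys)\<bar>" unfolding 4(1) by linarith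
          ultimately show ?thesis using d eq by linarith
      qed
    qed
  qed
qed simp

end

section \<open>A Loewner inequality for crossing walks\<close>

context lf_graph
begin

lemma modulus_le:
  assumes "finite B" "B \<subseteq> V" "admissible V \<Theta> \<rho>" "\<And>v. v \<in> V - B \<Longrightarrow> \<rho> v = 0"
  shows "modulus V p \<Theta> \<le> ennreal (\<Sum>v\<in>B. \<rho> v powr p)"
proof -
  have "modulus V p \<Theta> \<le> (\<Sum>\<^sub>\<infinity>v\<in>V. ennreal (\<rho> v powr p))"
    unfolding modulus_def using assms(3) by (intro INF_lower) auto
  also have "\<dots> = (\<Sum>\<^sub>\<infinity>v\<in>B. ennreal (\<rho> v powr p))"
    using assms by (intro infsum_cong_neutral) auto
  also have "\<dots> = (\<Sum>v\<in>B. ennreal (\<rho> v powr p))"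
    using assms by simp
  also have "\<dots> = ennreal (\<Sum>v\<in>B. \<rho> v powr p)"
    by (simp add: sum_ennreal)
  finally show ?thesis .
qed

text \<open>
  If \<open>f\<close> oscillated by more than \<open>h\<close> along every walk of the Loewner family, the density of
  \<open>osc_walk\<close> divided by \<open>h\<close> would be admissible, with a mass below the Loewner bound. The energy is only
  needed in the ball that contains the whole family.
\<close>

lemma loewner_path:
  assumes BCL: "ball_loewner V E p \<zeta> A c L" and p: "1 \<le> p"
    and xy: "x \<in> V" "y \<in> V" and R: "1 \<le> R" "ennreal R < gdiam E V / ennreal A"
    and \<kappa>: "0 < \<kappa>" "real (gdist E x y) \<le> \<kappa> * R" and h: "0 < h"
    and small: "region_energy p f (gball V E x ((1 + L \<kappa>) * R)) < c \<kappa> * R powr \<zeta> * h powr p"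
  shows "\<exists>xs. successively (adjacent E) xs \<and> set xs \<subseteq> V \<and> xs \<noteq> [] \<and>
      hd xs \<in> gball V E x R \<and> last xs \<in> gball V E y R \<and>
      (\<forall>u\<in>set xs. \<forall>v\<in>set xs. \<bar>f u - f v\<bar> \<le> h)"
proof (rule ccontr)
  assume no: "\<not> ?thesis"
  let ?B = "gball V E x ((1 + L \<kappa>) * R)"
  let ?\<Theta> = "{xs \<in> paths V E (gball V E x R) (gball V E y R). gdiam E (set xs) \<le> ennreal (L \<kappa> * R)}"
  define \<rho> where "\<rho> v = (if v \<in> ?B then vertex_energy p f v powr (1/p) / h else 0)" for v
  have pos: "c \<kappa> > 0" "L \<kappa> > 0" using BCL \<kappa> by (auto simp: ball_loewner_def)
  have fin: "finite ?B" using xy finite_gball by blast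
  have adm: "admissible V ?\<Theta> \<rho>"
    unfolding admissible_def
  proof (intro conjI ballI)
    fix v show "0 \<le> \<rho> v" using h by (simp add: \<rho>_def)
  next
    fix xs assume xs: "xs \<in> ?\<Theta>"
    then have w: "successively (adjacent E) xs" "set xs \<subseteq> V" "xs \<noteq> []"
      "hd xs \<in> gball V E x R" "last xs \<in> gball V E y R"
      by (auto simp: paths_def)
    then obtain u v where uv: "u \<in> set xs" "v \<in> set xs" "\<bar>f u - f v\<bar> > h"
      using no by (meson not_le)
    have sub: "set xs \<subseteq> ?B"
    proof
      fix v assume v: "v \<in> set xs"
      have hd: "hd xs \<in> set xs" "hd xs \<in> V" using w by auto
      have "real (gdist E (hd xs) v) \<le> L \<kappa> * R"
        using gdiam_leD[of "set xs" "L \<kappa> * R" "hd xs" v] xs v hd pos R by auto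
      moreover have "gdist E x v \<le> gdist E x (hd xs) + gdist E (hd xs) v"
        using gdist_triangle xy hd v w by blast
      moreover have "real (gdist E x (hd xs)) < R" using w by (simp add: gball_def)
      ultimately show "v \<in> ?B" using v w by (auto simp: gball_def algebra_simps)
    qed
    have "h < (\<Sum>y\<in>set xs. vertex_energy p f y powr (1/p))"
      using osc_walk[OF w(1) p uv(1,2), of f] uv(3) by linarith
    also have "\<dots> = h * (\<Sum>y\<in>set xs. \<rho> y)"
      unfolding sum_distrib_left using sub h by (intro sum.cong) (auto simp: \<rho>_def)
    finally show "1 \<le> (\<Sum>y\<in>set xs. \<rho> y)" using h by simp
  qed
  have "gsetdist E (gball V E x R) (gball V E y R) \<le> of_nat (gdist E x y)"
    unfolding gsetdist_def using xy R
    by (intro INF_lower2[of x] INF_lower2[of y]) (auto simp: gball_def)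
  also have "\<dots> \<le> ennreal (\<kappa> * R)"
    using \<kappa> by (metis ennreal_leI ennreal_of_nat_eq_real_of_nat)
  finally have "ennreal (c \<kappa> * R powr \<zeta>) \<le> modulus V p ?\<Theta>"
    using BCL \<kappa> R xy unfolding ball_loewner_def by blast
  also have "\<dots> \<le> ennreal (\<Sum>v\<in>?B. \<rho> v powr p)"
    by (rule modulus_le[OF fin gball_subset adm]) (auto simp: \<rho>_def)
  also have "(\<Sum>v\<in>?B. \<rho> v powr p) = region_energy p f ?B / h powr p"
    unfolding region_energy_def sum_divide_distrib using p h
    by (intro sum.cong) (auto simp: \<rho>_def powr_divide powr_powr vertex_energy_nonneg)
  finally have "c \<kappa> * R powr \<zeta> \<le> region_energy p f ?B / h powr p"
    using pos by (simp add: ennreal_le_iff2 region_energy_nonneg)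
      (smt (verit) zero_less_mult_iff powr_gt_zero R)
  then show False using small h by (simp add: field_simps)
qed

end

text \<open>
  The number \<open>m\<close> governs the refinement of scales: a configuration of two crossing walks splits into
  \<open>m\<close> configurations at a scale that is \<open>12 * m\<close> times smaller, with a quarter of the gap. The last
  assumption says that these require at least twice the energy of the original configuration.
\<close>
locale loewner_graph = lf_graph V E for V :: "'a set" and E :: "'a set set" +
  fixes p df \<zeta> C_AR A :: real and c L :: "real \<Rightarrow> real" and m :: nat
  assumes p: "1 < p"
    and AR: "ahlfors_regular V E df C_AR"
    and BCL: "ball_loewner V E p \<zeta> A c L"
    and m: "1 \<le> m" "2 * 4 powr p * (12 * real m) powr \<zeta> \<le> real m"
begin

definition "\<Lambda> = 12 * m"
text \<open>
  Loewner walks between balls of radius \<open>\<Lambda> ^ k\<close> whose centres have distance at most \<open>2 * \<Lambda> ^ (k + 1)\<close>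
  from \<open>q\<close> stay within distance \<open>T * \<Lambda> ^ (k + 1)\<close> of \<open>q\<close>.
\<close>
definition "T = 3 + L (4 * real \<Lambda>)"
text \<open>
  The energy threshold. The first term makes the Loewner condition applicable below the threshold, the
  second one is the energy forced at scale 1.
\<close>
definition "\<eta> = min (c (4 * real \<Lambda>) / (4 powr p * real \<Lambda> powr \<zeta>)) (1 / 2 powr p)"

lemma \<Lambda>_ge: "12 \<le> \<Lambda>" using m by (simp add: \<Lambda>_def)

lemma cL_pos: "c (4 * real \<Lambda>) > 0" "L (4 * real \<Lambda>) > 0"
proof -
  have "4 * real \<Lambda> > 0" using \<Lambda>_ge by simp
  then show "c (4 * real \<Lambda>) > 0" "L (4 * real \<Lambda>) > 0" using BCL by (auto simp: ball_loewner_def)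
qed

lemma T_ge: "3 \<le> T" using cL_pos by (simp add: T_def)

lemma \<eta>_pos: "0 < \<eta>" using cL_pos \<Lambda>_ge by (simp add: \<eta>_def)

lemma A_ge: "1 \<le> A" using BCL by (simp add: ball_loewner_def)

lemma C_AR_ge: "1 \<le> C_AR" using AR by (simp add: ahlfors_regular_def)

definition r :: "nat \<Rightarrow> nat" where "r k = \<Lambda> ^ k"

lemma r_Suc: "r (Suc k) = \<Lambda> * r k" and r_0 [simp]: "r 0 = 1" and r_ge: "1 \<le> r k"
  using \<Lambda>_ge by (auto simp: r_def)

lemma r_mono: "j \<le> k \<Longrightarrow> r j \<le> r k"
  using \<Lambda>_ge by (simp add: r_def power_increasing)

definition crosses :: "'a \<Rightarrow> nat \<Rightarrow> 'a list \<Rightarrow> bool" where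
  "crosses q n xs \<longleftrightarrow> successively (adjacent E) xs \<and> set xs \<subseteq> V \<and>
     (\<exists>u\<in>set xs. gdist E q u \<le> n) \<and> (\<exists>u\<in>set xs. 2 * n \<le> gdist E q u)"

text \<open>
  Averaging turns the energy on large balls into a measure: it is additive in \<open>B\<close>, it dominates the
  energy of the ball of radius \<open>T * r k\<close> about a point (\<open>averaged_energy_lower\<close>), and as a vertex lies
  in at most a multiple of \<open>r k powr df\<close> of the balls, it is dominated by the energy near \<open>B\<close>
  (\<open>averaged_energy_upper\<close>).
\<close>
definition averaged_energy :: "('a \<Rightarrow> real) \<Rightarrow> nat \<Rightarrow> 'a set \<Rightarrow> real" where
  "averaged_energy f k B = (\<Sum>x\<in>B. region_energy p f (gball V E x (2 * T * r k))) / real (r k) powr df"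

text \<open>
  The weight 1/2 of the next smaller scale matches the factor 2 in the assumption on \<open>m\<close>, and keeps the
  sum over all scales bounded.
\<close>
primrec multiscale_energy :: "('a \<Rightarrow> real) \<Rightarrow> nat \<Rightarrow> 'a set \<Rightarrow> real" where
  "multiscale_energy f 0 B = averaged_energy f 0 B"
| "multiscale_energy f (Suc k) B = averaged_energy f (Suc k) B + multiscale_energy f k B / 2"

lemma averaged_energy_nonneg: "0 \<le> averaged_energy f k B"
  by (simp add: averaged_energy_def sum_nonneg region_energy_nonneg)

lemma multiscale_energy_nonneg: "0 \<le> multiscale_energy f k B"
  by (induction k) (auto simp: averaged_energy_nonneg)

lemma multiscale_energy_sum: "finite I \<Longrightarrow> (\<And>i. i \<in> I \<Longrightarrow> finite (B i)) \<Longrightarrow>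
    (\<And>i j. i \<in> I \<Longrightarrow> j \<in> I \<Longrightarrow> i \<noteq> j \<Longrightarrow> B i \<inter> B j = {}) \<Longrightarrow>
    multiscale_energy f k (\<Union>i\<in>I. B i) = (\<Sum>i\<in>I. multiscale_energy f k (B i))"
proof (induction k)
  case 0
  then show ?case by (simp add: averaged_energy_def sum.UNION_disjoint sum_divide_distrib)
next
  case (Suc k)
  have "averaged_energy f (Suc k) (\<Union>i\<in>I. B i) = (\<Sum>i\<in>I. averaged_energy f (Suc k) (B i))"
    using Suc.prems by (simp add: averaged_energy_def sum.UNION_disjoint sum_divide_distrib)
  then show ?case using Suc by (simp add: sum.distrib sum_divide_distrib)
qed

lemma multiscale_energy_mono: "B \<subseteq> B' \<Longrightarrow> finite B' \<Longrightarrow> multiscale_energy f k B \<le> multiscale_energy f k B'"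
proof (induction k)
  case 0
  then show ?case unfolding multiscale_energy.simps averaged_energy_def
    by (intro divide_right_mono sum_mono2) (auto simp: region_energy_nonneg)
next
  case (Suc k)
  have "averaged_energy f (Suc k) B \<le> averaged_energy f (Suc k) B'" unfolding averaged_energy_def using Suc
    by (intro divide_right_mono sum_mono2) (auto simp: region_energy_nonneg)
  then show ?case using Suc by simp
qed

lemma ball_card_lower: "x \<in> V \<Longrightarrow> 1 \<le> s \<Longrightarrow> ennreal s < gdiam E V + 1 \<Longrightarrow>
    s powr df \<le> C_AR * real (card (gball V E x s))"
  using AR unfolding ahlfors_regular_def by (auto simp: field_simps)

lemma ball_card_upper: "x \<in> V \<Longrightarrow> 1 \<le> s \<Longrightarrow> ennreal s < gdiam E V + 1 \<Longrightarrow>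
    real (card (gball V E x s)) \<le> C_AR * s powr df"
  using AR unfolding ahlfors_regular_def by auto

lemma averaged_energy_lower:
  assumes "q \<in> V" "ennreal (real (r k)) < gdiam E V + 1"
  shows "region_energy p f (gball V E q (T * r k)) \<le> C_AR * averaged_energy f k (gball V E q (3 * real (r k)))"
proof -
  let ?e = "region_energy p f (gball V E q (T * r k))"
  have r1: "1 \<le> real (r k)" using r_ge[of k] by simp
  have "real (card (gball V E q (r k))) * ?e \<le> (\<Sum>x\<in>gball V E q (r k). region_energy p f (gball V E x (2 * T * r k)))"
  proof (rule sum_bounded_below)
    fix x assume x: "x \<in> gball V E q (r k)"
    have "gball V E q (T * r k) \<subseteq> gball V E x (2 * T * r k)"
    proof (rule gball_triangle)
      show "x \<in> V" "q \<in> V" using x assms by (auto simp: gball_def)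
      then have "real (gdist E x q) \<le> real (r k)" using x gdist_sym by (auto simp: gball_def)
      also have "\<dots> \<le> T * r k" using T_ge r1 by simp
      finally show "real (gdist E x q) + T * real (r k) \<le> 2 * T * real (r k)" by simp
    qed
    then show "?e \<le> region_energy p f (gball V E x (2 * T * r k))"
      using x by (intro region_energy_mono finite_gball) (auto simp: gball_def)
  qed
  also have "\<dots> \<le> (\<Sum>x\<in>gball V E q (3 * real (r k)). region_energy p f (gball V E x (2 * T * r k)))"
    using r1 by (intro sum_mono2 finite_gball gball_mono assms) (auto simp: region_energy_nonneg)
  finally have 1: "real (card (gball V E q (r k))) * ?e \<le> averaged_energy f k (gball V E q (3 * real (r k))) * real (r k) powr df"
    using r1 by (simp add: averaged_energy_def)
  have "real (r k) powr df * ?e \<le> C_AR * real (card (gball V E q (r k))) * ?e"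
    using ball_card_lower[OF assms(1) r1 assms(2)] region_energy_nonneg by (intro mult_right_mono) auto
  also have "\<dots> \<le> C_AR * (averaged_energy f k (gball V E q (3 * real (r k))) * real (r k) powr df)"
    using 1 C_AR_ge by (simp add: mult.assoc)
  finally show ?thesis using r1 by (simp add: mult.assoc mult.left_commute mult.commute)
qed

lemma averaged_energy_upper:
  assumes "finite B" "B \<subseteq> V" "finite B'" "B' \<subseteq> V" "\<And>x. x \<in> B \<Longrightarrow> gball V E x (2 * T * r k) \<subseteq> B'"
    "ennreal (2 * T * r k) < gdiam E V + 1"
  shows "averaged_energy f k B \<le> C_AR * (2 * T) powr df * region_energy p f B'"
proof -
  let ?s = "2 * T * r k"
  have r1: "1 \<le> real (r k)" using r_ge[of k] by simp
  have s1: "1 \<le> ?s" using mult_mono[of 1 "2 * T" 1 "real (r k)"] T_ge r1 by simp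
  have "(\<Sum>x\<in>B. region_energy p f (gball V E x ?s)) = (\<Sum>x\<in>B. \<Sum>v\<in>B'. if v \<in> gball V E x ?s then vertex_energy p f v else 0)"
    unfolding region_energy_def
  proof (rule sum.cong[OF refl])
    fix x assume "x \<in> B"
    then have "B' \<inter> gball V E x ?s = gball V E x ?s" using assms by auto
    then show "sum (vertex_energy p f) (gball V E x ?s) = (\<Sum>v\<in>B'. if v \<in> gball V E x ?s then vertex_energy p f v else 0)"
      using assms by (simp add: sum.If_cases Int_def)
  qed
  also have "\<dots> = (\<Sum>v\<in>B'. \<Sum>x\<in>B. if v \<in> gball V E x ?s then vertex_energy p f v else 0)"
    by (rule sum.swap)
  also have "\<dots> \<le> (\<Sum>v\<in>B'. C_AR * ?s powr df * vertex_energy p f v)"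
  proof (rule sum_mono)
    fix v assume v: "v \<in> B'"
    have "B \<inter> {x. v \<in> gball V E x ?s} \<subseteq> gball V E v ?s"
      using assms v by (auto simp: gball_def gdist_sym)
    then have "card (B \<inter> {x. v \<in> gball V E x ?s}) \<le> card (gball V E v ?s)"
      using assms v by (intro card_mono finite_gball) auto
    then have "real (card (B \<inter> {x. v \<in> gball V E x ?s})) \<le> C_AR * ?s powr df"
      using ball_card_upper[of v ?s] assms v s1 by fastforce
    then have "real (card (B \<inter> {x. v \<in> gball V E x ?s})) * vertex_energy p f v \<le> C_AR * ?s powr df * vertex_energy p f v"
      by (intro mult_right_mono) (auto simp: vertex_energy_nonneg)
    then show "(\<Sum>x\<in>B. if v \<in> gball V E x ?s then vertex_energy p f v else 0) \<le> C_AR * ?s powr df * vertex_energy p f v"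
      using assms by (simp add: sum.If_cases)
  qed
  finally have "(\<Sum>x\<in>B. region_energy p f (gball V E x ?s)) \<le> C_AR * ?s powr df * region_energy p f B'"
    by (simp add: region_energy_def sum_distrib_left)
  also have "?s powr df = (2 * T) powr df * real (r k) powr df"
    using T_ge by (simp add: powr_mult)
  finally show ?thesis using r1 by (simp add: averaged_energy_def field_simps)
qed

lemma multiscale_energy_upper:
  assumes "finite B" "B \<subseteq> V" "finite B'" "B' \<subseteq> V" "\<And>x. x \<in> B \<Longrightarrow> gball V E x (2 * T * r k) \<subseteq> B'"
    "ennreal (2 * T * r k) < gdiam E V + 1"
  shows "multiscale_energy f k B \<le> 2 * (C_AR * (2 * T) powr df * region_energy p f B')"
  using assms(5,6)
proof (induction k)
  case 0
  have "0 \<le> C_AR * (2 * T) powr df * region_energy p f B'" using C_AR_ge region_energy_nonneg by simp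
  then show ?case using averaged_energy_upper[of B B' 0 f] 0 assms(1-4) by simp
next
  case (Suc k)
  have le: "2 * T * real (r k) \<le> 2 * T * real (r (Suc k))"
    using T_ge r_mono[of k "Suc k"] by simp
  have "ennreal (2 * T * real (r k)) < gdiam E V + 1"
    using Suc.prems(2) le by (meson ennreal_leI le_less_trans)
  moreover have "gball V E x (2 * T * real (r k)) \<subseteq> B'" if "x \<in> B" for x
    using Suc.prems(1)[OF that] gball_mono[OF le] by blast
  ultimately have "multiscale_energy f k B \<le> 2 * (C_AR * (2 * T) powr df * region_energy p f B')"
    using Suc.IH by blast
  moreover have "averaged_energy f (Suc k) B \<le> C_AR * (2 * T) powr df * region_energy p f B'"
    using averaged_energy_upper[of B B' "Suc k" f] Suc.prems assms(1-4) by blast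
  ultimately show ?case by simp
qed

end

context loewner_graph
begin

abbreviation "small_radius s \<equiv> ennreal s < gdiam E V / ennreal A"

lemma small_radius_less: "small_radius s \<Longrightarrow> ennreal s < gdiam E V + 1"
proof -
  assume "small_radius s"
  also have "gdiam E V / ennreal A \<le> gdiam E V"
  proof (rule divide_le_posI_ennreal)
    show "0 < ennreal A" using A_ge by simp
    show "gdiam E V \<le> ennreal A * gdiam E V"
      using mult_right_mono[of 1 "ennreal A" "gdiam E V"] A_ge by simp
  qed
  also have "\<dots> \<le> gdiam E V + 1" by simp
  finally show ?thesis .
qed

text \<open>
  Both walks meet the closed ball of radius 1, so \<open>f\<close> jumps by at least \<open>h / 2\<close> on an edge at \<open>q\<close>.
\<close>

lemma crossing_gap_base:
  assumes q: "q \<in> V" and xs: "crosses q 1 xs" "\<And>x. x \<in> set xs \<Longrightarrow> f x \<le> s"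
    and ys: "crosses q 1 ys" "\<And>y. y \<in> set ys \<Longrightarrow> s + h \<le> f y" and h: "0 < h"
  shows "(h / 2) powr p \<le> region_energy p f (gball V E q 2)"
proof -
  obtain x where x: "x \<in> set xs" "gdist E q x \<le> 1" "x \<in> V" using xs(1) by (auto simp: crosses_def)
  obtain y where y: "y \<in> set ys" "gdist E q y \<le> 1" "y \<in> V" using ys(1) by (auto simp: crosses_def)
  have one: "u = q \<or> adjacent E q u" if u1: "u \<in> V" "gdist E q u \<le> 1" for u
  proof -
    obtain zs where zs: "walk_betw E q zs u" "length zs = Suc (gdist E q u)" using geodesic[OF q u1(1)] by metis
    show ?thesis
    proof (cases "gdist E q u = 0")
      case True then show ?thesis using gdist_eq_0 q u1 by metis
    next
      case False
      then have "length zs = 2" using zs u1 by simp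
      then obtain a b where "zs = [a, b]" by (metis (no_types, opaque_lifting) length_0_conv length_Suc_conv numeral_2_eq_2)
      then show ?thesis using zs by (auto simp: walk_betw_def)
    qed
  qed
  have "vertex_energy p f q \<ge> (h / 2) powr p"
  proof -
    have *: "(h / 2) powr p \<le> vertex_energy p f q" if u: "u \<in> V" "gdist E q u \<le> 1" "h / 2 \<le> \<bar>f q - f u\<bar>" for u
    proof -
      have "adjacent E q u" using one u h by fastforce
      then have "h / 2 \<le> vertex_energy p f q powr (1/p)" using diff_le_vertex_energy[of q u p f] p u by linarith
      then have "(h / 2) powr p \<le> (vertex_energy p f q powr (1/p)) powr p" using h p by (intro powr_mono2) auto
      then show ?thesis using p by (simp add: powr_powr vertex_energy_nonneg)
    qed
    have "f x \<le> s" "s + h \<le> f y" using xs ys x y by auto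
    then have "h / 2 \<le> \<bar>f q - f x\<bar> \<or> h / 2 \<le> \<bar>f q - f y\<bar>" by linarith
    then show ?thesis using * x y by blast
  qed
  also have "vertex_energy p f q \<le> region_energy p f (gball V E q 2)"
    unfolding region_energy_def using q by (intro member_le_sum) (auto simp: finite_gball vertex_energy_nonneg, auto simp: gball_def)
  finally show ?thesis .
qed

text \<open>
  The refinement step. The points \<open>a\<close> and \<open>b\<close> are taken on the two walks, at distances from \<open>q\<close>
  that depend on \<open>i\<close>; a walk along which \<open>f\<close> is nearly constant joins their neighbourhoods. At height
  below the middle of the gap, this walk is far below the upper walk near \<open>b\<close>, and otherwise it is far
  above the lower walk near \<open>a\<close>. In both cases half of the gap is lost by the choice of the side, and a
  quarter by the oscillation of the new walk.
\<close>

lemma crossing_gap_child: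
  assumes q: "q \<in> V" and xs: "crosses q (r (Suc k)) xs" "\<And>x. x \<in> set xs \<Longrightarrow> f x \<le> s"
    and ys: "crosses q (r (Suc k)) ys" "\<And>y. y \<in> set ys \<Longrightarrow> s + h \<le> f y" and h: "0 < h"
    and rad: "small_radius (r k)"
    and small: "region_energy p f (gball V E q (T * r (Suc k))) < \<eta> * h powr p * real (r (Suc k)) powr \<zeta>"
    and i: "i < m"
  shows "\<exists>q'\<in>V. gdist E q q' \<in> {r (Suc k) + 12 * i * r k, r (Suc k) + 12 * i * r k + 6 * r k} \<and>
     (\<exists>xs' ys' s'. crosses q' (r k) xs' \<and> crosses q' (r k) ys' \<and>
        (\<forall>x\<in>set xs'. f x \<le> s') \<and> (\<forall>y\<in>set ys'. s' + h / 4 \<le> f y))"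
proof -
  let ?n = "r k" and ?N = "r (Suc k)" and ?\<kappa> = "4 * real \<Lambda>"
  have N: "?N = 12 * m * ?n" by (simp add: r_Suc \<Lambda>_def)
  have n1: "1 \<le> ?n" by (rule r_ge)
  have im: "12 * i * ?n + 12 * ?n \<le> ?N" using i mult_le_mono1[of "Suc i" m "12 * ?n"] unfolding N by simp
  have sx: "successively (adjacent E) xs" "set xs \<subseteq> V" and sy: "successively (adjacent E) ys" "set ys \<subseteq> V"
    using xs ys by (auto simp: crosses_def)
  obtain x0 x1 where x01: "x0 \<in> set xs" "gdist E q x0 \<le> ?N" "x1 \<in> set xs" "2 * ?N \<le> gdist E q x1"
    using xs(1) by (auto simp: crosses_def)
  obtain y0 y1 where y01: "y0 \<in> set ys" "gdist E q y0 \<le> ?N" "y1 \<in> set ys" "2 * ?N \<le> gdist E q y1"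
    using ys(1) by (auto simp: crosses_def)
  (* The spheres used for a and b, for all values of i, are interleaved with spacing 6 r_k, so that
     the centres of different children are well separated whichever of the two points is kept. *)
  obtain a where a: "a \<in> set xs" "gdist E q a = ?N + 12 * i * ?n"
    using dist_ivt[OF sx(1) q x01(1,3), of "?N + 12 * i * ?n"] x01 im by auto
  obtain b where b: "b \<in> set ys" "gdist E q b = ?N + 12 * i * ?n + 6 * ?n"
    using dist_ivt[OF sy(1) q y01(1,3), of "?N + 12 * i * ?n + 6 * ?n"] y01 im by auto
  have V: "a \<in> V" "b \<in> V" "x1 \<in> V" "y0 \<in> V" using a b x01 y01 sx sy by auto
  have "gdist E a b \<le> gdist E q a + gdist E q b" using gdist_triangle[of a q b] gdist_sym V q by simp
  also have "\<dots> \<le> 4 * ?N" using a b im by simp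
  finally have "real (gdist E a b) \<le> real (4 * ?N)" by linarith
  then have dab: "real (gdist E a b) \<le> ?\<kappa> * real ?n" by (simp add: r_Suc)
  have dab6: "6 * ?n \<le> gdist E a b" using gdist_triangle[of q a b] V q a b by simp
  have cross_x: "crosses a ?n xs"
    using sx a(1) x01(3) gdist_triangle[of q a x1] V q a x01(4) im unfolding crosses_def
    by (intro conjI bexI[of _ a] bexI[of _ x1]) auto
  have cross_y: "crosses b ?n ys"
    using sy b(1) y01(1) gdist_triangle[of q y0 b] gdist_sym[of y0 b] V q b y01(2) im unfolding crosses_def
    by (intro conjI bexI[of _ b] bexI[of _ y0]) auto
  have sub: "gball V E a ((1 + L ?\<kappa>) * ?n) \<subseteq> gball V E q (T * ?N)"
  proof (rule gball_triangle[OF q V(1)])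
    have "real (gdist E q a) \<le> real (2 * ?N)" using a im by linarith
    moreover have "(1 + L ?\<kappa>) * real ?n \<le> (1 + L ?\<kappa>) * real ?N"
      using cL_pos r_mono[of k "Suc k"] by (intro mult_left_mono) auto
    ultimately show "real (gdist E q a) + (1 + L ?\<kappa>) * real ?n \<le> T * real ?N"
      by (simp add: T_def algebra_simps)
  qed
  have "region_energy p f (gball V E a ((1 + L ?\<kappa>) * ?n)) \<le> region_energy p f (gball V E q (T * ?N))"
    by (rule region_energy_mono[OF sub finite_gball[OF q]])
  also have "\<dots> < \<eta> * h powr p * real ?N powr \<zeta>" by (rule small)
  also have "\<dots> \<le> c ?\<kappa> / (4 powr p * real \<Lambda> powr \<zeta>) * h powr p * real ?N powr \<zeta>"
    unfolding \<eta>_def by (intro mult_right_mono) auto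
  also have "\<dots> = c ?\<kappa> * real ?n powr \<zeta> * (h / 4) powr p"
    using \<Lambda>_ge h by (simp add: r_Suc powr_mult powr_divide)
  finally have small': "region_energy p f (gball V E a ((1 + L ?\<kappa>) * ?n)) < c ?\<kappa> * real ?n powr \<zeta> * (h / 4) powr p" .
  have "\<exists>ts. successively (adjacent E) ts \<and> set ts \<subseteq> V \<and> ts \<noteq> [] \<and>
      hd ts \<in> gball V E a ?n \<and> last ts \<in> gball V E b ?n \<and>
      (\<forall>u\<in>set ts. \<forall>v\<in>set ts. \<bar>f u - f v\<bar> \<le> h / 4)"
    using p h n1 \<Lambda>_ge by (intro loewner_path[OF BCL _ V(1,2) _ rad _ dab _ small']) auto
  then obtain ts where ts: "successively (adjacent E) ts" "set ts \<subseteq> V" "ts \<noteq> []"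
      "hd ts \<in> gball V E a ?n" "last ts \<in> gball V E b ?n"
      and osc: "\<And>u v. u \<in> set ts \<Longrightarrow> v \<in> set ts \<Longrightarrow> \<bar>f u - f v\<bar> \<le> h / 4" by blast
  have hl: "hd ts \<in> set ts" "last ts \<in> set ts" "hd ts \<in> V" "last ts \<in> V" using ts by auto
  have dh: "gdist E a (hd ts) \<le> ?n" "gdist E b (last ts) \<le> ?n" using ts by (auto simp: gball_def)
  have cross_ta: "crosses a ?n ts"
    using ts(1,2) hl dh dab6 gdist_triangle[of a "last ts" b] gdist_sym[of b "last ts"] V unfolding crosses_def
    by (intro conjI bexI[of _ "hd ts"] bexI[of _ "last ts"]) auto
  have cross_tb: "crosses b ?n ts"
    using ts(1,2) hl dh dab6 gdist_triangle[of a "hd ts" b] gdist_sym[of b "hd ts"] V unfolding crosses_def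
    by (intro conjI bexI[of _ "hd ts"] bexI[of _ "last ts"]) auto
  show ?thesis
  proof (cases "s + h / 2 \<le> f (hd ts)")
    case True
    have "\<forall>y\<in>set ts. s + h / 4 \<le> f y"
    proof
      fix y assume "y \<in> set ts"
      then show "s + h / 4 \<le> f y" using osc[OF hl(1), of y] True by (auto simp: abs_if split: if_splits)
    qed
    then have "\<exists>xs' ys' s'. crosses a ?n xs' \<and> crosses a ?n ys' \<and>
        (\<forall>x\<in>set xs'. f x \<le> s') \<and> (\<forall>y\<in>set ys'. s' + h / 4 \<le> f y)"
      using cross_x cross_ta xs(2) by blast
    then show ?thesis using V(1) a(2) by (intro bexI[of _ a]) auto
  next
    case False
    have "\<forall>y\<in>set ts. f y \<le> s + 3 * h / 4"
    proof
      fix y assume "y \<in> set ts"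
      then show "f y \<le> s + 3 * h / 4" using osc[OF hl(1), of y] False by (auto simp: abs_if split: if_splits)
    qed
    moreover have "\<forall>y\<in>set ys. s + 3 * h / 4 + h / 4 \<le> f y"
    proof
      fix y assume "y \<in> set ys"
      then show "s + 3 * h / 4 + h / 4 \<le> f y" using ys(2)[of y] by simp
    qed
    ultimately have "\<exists>xs' ys' s'. crosses b ?n xs' \<and> crosses b ?n ys' \<and>
        (\<forall>x\<in>set xs'. f x \<le> s') \<and> (\<forall>y\<in>set ys'. s' + h / 4 \<le> f y)"
      using cross_y cross_tb by blast
    then show ?thesis using V(2) b(2) by (intro bexI[of _ b]) auto
  qed
qed

text \<open>
  Either the energy around \<open>q\<close> is large at the present scale, or the configuration has \<open>m\<close> children in
  disjoint balls, to which the induction hypothesis applies.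
\<close>

lemma crossing_gap_multiscale:
  assumes "q \<in> V" "crosses q (r k) xs" "\<And>x. x \<in> set xs \<Longrightarrow> f x \<le> s"
    "crosses q (r k) ys" "\<And>y. y \<in> set ys \<Longrightarrow> s + h \<le> f y" "0 < h" "small_radius (r k)"
  shows "\<eta> * h powr p * real (r k) powr \<zeta> \<le> C_AR * multiscale_energy f k (gball V E q (3 * real (r k)))"
  using assms
proof (induction k arbitrary: q xs ys s h)
  case 0
  have "\<eta> * h powr p \<le> 1 / 2 powr p * h powr p" unfolding \<eta>_def by (intro mult_right_mono) auto
  also have "\<dots> = (h / 2) powr p" using 0 by (simp add: powr_divide)
  also have "\<dots> \<le> region_energy p f (gball V E q 2)"
    using crossing_gap_base[of q xs f s ys h] 0 by simp
  also have "\<dots> \<le> region_energy p f (gball V E q (T * r 0))"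
    using T_ge 0 by (intro region_energy_mono gball_mono finite_gball) auto
  also have "\<dots> \<le> C_AR * averaged_energy f 0 (gball V E q (3 * real (r 0)))"
    using 0 by (intro averaged_energy_lower small_radius_less) auto
  finally show ?case by simp
next
  case (Suc k)
  let ?n = "r k" and ?N = "r (Suc k)"
  have N: "?N = 12 * m * ?n" by (simp add: r_Suc \<Lambda>_def)
  have n1: "1 \<le> ?n" by (rule r_ge)
  have le: "real ?n \<le> real ?N" using r_mono[of k "Suc k"] by simp
  have rad: "small_radius ?n" using Suc.prems(7) le by (meson ennreal_leI le_less_trans)
  show ?case
  proof (cases "\<eta> * h powr p * real ?N powr \<zeta> \<le> region_energy p f (gball V E q (T * ?N))")
    case True
    note True
    also have "region_energy p f (gball V E q (T * ?N)) \<le> C_AR * averaged_energy f (Suc k) (gball V E q (3 * real ?N))"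
      using Suc.prems by (intro averaged_energy_lower small_radius_less) auto
    also have "\<dots> \<le> C_AR * multiscale_energy f (Suc k) (gball V E q (3 * real ?N))"
      using C_AR_ge multiscale_energy_nonneg by (intro mult_left_mono) auto
    finally show ?thesis .
  next
    case False
    let ?P = "\<lambda>i q'. q' \<in> V \<and> gdist E q q' \<in> {?N + 12 * i * ?n, ?N + 12 * i * ?n + 6 * ?n} \<and>
     (\<exists>xs' ys' s'. crosses q' ?n xs' \<and> crosses q' ?n ys' \<and>
        (\<forall>x\<in>set xs'. f x \<le> s') \<and> (\<forall>y\<in>set ys'. s' + h / 4 \<le> f y))"
    have "\<forall>i\<in>{..<m}. \<exists>q'. ?P i q'"
      using crossing_gap_child[OF Suc.prems(1-6) rad] False by (simp add: Bex_def)
    then have "\<exists>Q. \<forall>i\<in>{..<m}. ?P i (Q i)" by (rule bchoice)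
    then obtain Q where QP: "\<And>i. i < m \<Longrightarrow> ?P i (Q i)" by blast
    have Q: "Q i \<in> V" "gdist E q (Q i) \<in> {?N + 12 * i * ?n, ?N + 12 * i * ?n + 6 * ?n}"
      "\<exists>xs' ys' s'. crosses (Q i) ?n xs' \<and> crosses (Q i) ?n ys' \<and>
        (\<forall>x\<in>set xs'. f x \<le> s') \<and> (\<forall>y\<in>set ys'. s' + h / 4 \<le> f y)" if "i < m" for i
      using QP[OF that] by blast+
    let ?B = "\<lambda>i. gball V E (Q i) (3 * real ?n)"
    have IH: "\<eta> * (h / 4) powr p * real ?n powr \<zeta> \<le> C_AR * multiscale_energy f k (?B i)" if i: "i < m" for i
    proof -
      obtain xs' ys' s' where c: "crosses (Q i) ?n xs'" "crosses (Q i) ?n ys'"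
        "\<forall>x\<in>set xs'. f x \<le> s'" "\<forall>y\<in>set ys'. s' + h / 4 \<le> f y" using Q(3)[OF i] by blast
      show ?thesis using c Suc.prems(6) rad Q(1)[OF i] by (intro Suc.IH[of "Q i" xs' s' ys' "h / 4"]) auto
    qed
    have disj: "?B i \<inter> ?B j = {}" if ij: "i < m" "j < m" "i < j" for i j
    proof -
      have "(12 * i + 12) * ?n \<le> 12 * j * ?n" using ij by (intro mult_le_mono) auto
      then have "12 * i * ?n + 12 * ?n \<le> 12 * j * ?n" by (simp only: add_mult_distrib)
      moreover have "gdist E q (Q i) \<le> ?N + 12 * i * ?n + 6 * ?n" using Q(2)[OF ij(1)] by auto
      moreover have "?N + 12 * j * ?n \<le> gdist E q (Q j)" using Q(2)[OF ij(2)] by auto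
      ultimately have "gdist E q (Q i) + 6 * ?n \<le> gdist E q (Q j)" by linarith
      then have far: "6 * ?n \<le> gdist E (Q i) (Q j)"
        using gdist_triangle[of q "Q i" "Q j"] Q(1) ij Suc.prems(1) by fastforce
      {
        fix w assume w: "w \<in> V" "real (gdist E (Q i) w) < 3 * ?n" "real (gdist E (Q j) w) < 3 * ?n"
        then have "gdist E (Q i) (Q j) \<le> gdist E (Q i) w + gdist E (Q j) w"
          using gdist_triangle[of "Q i" w "Q j"] gdist_sym[of w "Q j"] Q(1) ij by simp
        then have False using w far by linarith
      }
      then show ?thesis by (auto simp: gball_def)
    qed
    have disj': "?B i \<inter> ?B j = {}" if "i < m" "j < m" "i \<noteq> j" for i j
      using disj[of i j] disj[of j i] that by (cases "i < j") (auto simp: Int_commute)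
    have sub: "?B i \<subseteq> gball V E q (3 * real ?N)" if i: "i < m" for i
    proof (rule gball_triangle[OF Suc.prems(1) Q(1)[OF i]])
      have "(12 * i + 12) * ?n \<le> 12 * m * ?n" using i by (intro mult_le_mono) auto
      then have "12 * i * ?n + 12 * ?n \<le> ?N" by (simp only: add_mult_distrib N)
      moreover have "gdist E q (Q i) \<le> ?N + 12 * i * ?n + 6 * ?n" using Q(2)[OF i] by auto
      ultimately have "gdist E q (Q i) + 3 * ?n \<le> 3 * ?N" by linarith
      then show "real (gdist E q (Q i)) + 3 * real ?n \<le> 3 * real ?N" by linarith
    qed
    have pw: "h powr p = 4 powr p * (h / 4) powr p" using Suc.prems(6) by (simp add: powr_divide)
    have Np: "real ?N powr \<zeta> = (12 * real m) powr \<zeta> * real ?n powr \<zeta>" by (simp add: N powr_mult)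
    have "2 * (\<eta> * h powr p * real ?N powr \<zeta>) =
        (2 * 4 powr p * (12 * real m) powr \<zeta>) * (\<eta> * (h / 4) powr p * real ?n powr \<zeta>)"
      unfolding pw Np by simp
    also have "\<dots> \<le> real m * (\<eta> * (h / 4) powr p * real ?n powr \<zeta>)"
      using m \<eta>_pos by (intro mult_right_mono) auto
    also have "\<dots> = (\<Sum>i<m. \<eta> * (h / 4) powr p * real ?n powr \<zeta>)" by simp
    also have "\<dots> \<le> (\<Sum>i<m. C_AR * multiscale_energy f k (?B i))" using IH by (intro sum_mono) auto
    also have "\<dots> = C_AR * multiscale_energy f k (\<Union>i<m. ?B i)"
      unfolding sum_distrib_left[symmetric] using disj' finite_gball Q(1) by (subst multiscale_energy_sum) auto
    also have "\<dots> \<le> C_AR * multiscale_energy f k (gball V E q (3 * real ?N))"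
      using C_AR_ge sub finite_gball Suc.prems(1) by (intro mult_left_mono multiscale_energy_mono) auto
    also have "\<dots> \<le> 2 * (C_AR * multiscale_energy f (Suc k) (gball V E q (3 * real ?N)))"
      using C_AR_ge averaged_energy_nonneg by (simp add: algebra_simps)
    finally show ?thesis by simp
  qed
qed

text \<open>
  The energies that enter \<open>multiscale_energy f k\<close> of a ball of radius \<open>3 * r k\<close> live in the concentric
  ball of radius \<open>H * r k\<close>.
\<close>
definition "H = 3 + 2 * T"
definition "c_gap = \<eta> / (2 * C_AR\<^sup>2 * (2 * T) powr df)"

lemma c_gap_pos: "0 < c_gap"
  using \<eta>_pos C_AR_ge T_ge by (simp add: c_gap_def)

lemma crossing_gap_energy:
  assumes q: "q \<in> V" and "crosses q (r k) xs" "\<And>x. x \<in> set xs \<Longrightarrow> f x \<le> s"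
    "crosses q (r k) ys" "\<And>y. y \<in> set ys \<Longrightarrow> s + h \<le> f y" "0 < h" "small_radius (r k)"
    and rad: "ennreal (2 * T * r k) < gdiam E V + 1"
  shows "c_gap * h powr p * real (r k) powr \<zeta> \<le> region_energy p f (gball V E q (H * r k))"
proof -
  have sub: "gball V E x (2 * T * r k) \<subseteq> gball V E q (H * r k)" if "x \<in> gball V E q (3 * real (r k))" for x
    using that by (intro gball_triangle[OF q]) (auto simp: gball_def H_def algebra_simps)
  have "\<eta> * h powr p * real (r k) powr \<zeta> \<le> C_AR * multiscale_energy f k (gball V E q (3 * real (r k)))"
    by (rule crossing_gap_multiscale[OF assms(1-7)])
  also have "\<dots> \<le> C_AR * (2 * (C_AR * (2 * T) powr df * region_energy p f (gball V E q (H * r k))))"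
    using C_AR_ge by (intro mult_left_mono multiscale_energy_upper finite_gball q gball_subset sub rad) auto
  also have "\<dots> = 2 * C_AR\<^sup>2 * (2 * T) powr df * region_energy p f (gball V E q (H * r k))"
    by (simp add: power2_eq_square)
  finally show ?thesis using C_AR_ge T_ge by (simp add: c_gap_def field_simps)
qed

end

section \<open>Equilibrium potentials\<close>

lemma powr_convex_combination:
  fixes p x y u v :: real
  assumes "1 \<le> p" "0 \<le> x" "0 \<le> y" "0 \<le> u" "0 \<le> v" "u + v = 1"
  shows "(u * x + v * y) powr p \<le> u * x powr p + v * y powr p"
proof -
  have le: "(s * z) powr p \<le> s * z powr p" if "0 \<le> s" "s \<le> 1" "0 \<le> z" for s z :: real
  proof -
    have "s powr p \<le> s powr 1" if "s \<noteq> 0" using that \<open>0 \<le> s\<close> \<open>s \<le> 1\<close> assms(1) by (intro powr_mono') auto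
    then have "s powr p \<le> s" using that by (cases "s = 0") auto
    then show ?thesis using that by (simp add: powr_mult mult_right_mono)
  qed
  show ?thesis
  proof (cases "x = 0 \<or> y = 0")
    case True
    then show ?thesis using le[of u x] le[of v y] assms by (elim disjE) auto
  next
    case False
    have u: "u = 1 - v" using assms by simp
    show ?thesis
      unfolding u using convex_onD[OF powr_convex[OF assms(1)], of v x y] assms False by simp
  qed
qed

text \<open>
  By convexity: two numbers are moved towards each other by the same amount, and neither of them passes
  the original position of the other.
\<close>

lemma abs_powr_spread:
  fixes p x y t :: real
  assumes p: "1 \<le> p" and "y \<le> x" "0 \<le> t" "t \<le> x - y"
  shows "\<bar>x - t\<bar> powr p + \<bar>y + t\<bar> powr p \<le> \<bar>x\<bar> powr p + \<bar>y\<bar> powr p"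
proof (cases "x = y")
  case False
  define s where "s = t / (x - y)"
  have s: "0 \<le> s" "s \<le> 1" using assms False by (auto simp: s_def field_simps)
  have "t = s * (x - y)" using False assms by (simp add: s_def)
  then have e: "x - t = (1 - s) * x + s * y" "y + t = s * x + (1 - s) * y" by (auto simp: algebra_simps)
  have conv: "\<bar>a * x + b * y\<bar> powr p \<le> a * \<bar>x\<bar> powr p + b * \<bar>y\<bar> powr p"
    if "0 \<le> a" "0 \<le> b" "a + b = 1" for a b
  proof -
    have "\<bar>a * x + b * y\<bar> \<le> a * \<bar>x\<bar> + b * \<bar>y\<bar>" using that
      by (metis abs_mult abs_of_nonneg abs_triangle_ineq)
    then have "\<bar>a * x + b * y\<bar> powr p \<le> (a * \<bar>x\<bar> + b * \<bar>y\<bar>) powr p" using p by (intro powr_mono2) auto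
    also have "\<dots> \<le> a * \<bar>x\<bar> powr p + b * \<bar>y\<bar> powr p" using that p by (intro powr_convex_combination) auto
    finally show ?thesis .
  qed
  have "\<bar>x - t\<bar> powr p + \<bar>y + t\<bar> powr p \<le>
      ((1 - s) * \<bar>x\<bar> powr p + s * \<bar>y\<bar> powr p) + (s * \<bar>x\<bar> powr p + (1 - s) * \<bar>y\<bar> powr p)"
    unfolding e using conv[of "1 - s" s] conv[of s "1 - s"] s by (intro add_mono) auto
  also have "\<dots> = \<bar>x\<bar> powr p + \<bar>y\<bar> powr p" by (simp add: algebra_simps)
  finally show ?thesis .
qed (use assms in auto)

text \<open>
  Submodularity of the energy, edge by edge. If \<open>max\<close> selects the same function at both ends of an
  edge, both sides agree; otherwise the increments are moved towards each other.
\<close>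

lemma max_min_powr_le:
  fixes a b c d p :: real
  assumes p: "1 \<le> p"
  shows "\<bar>max a b - max c d\<bar> powr p + \<bar>min a b - min c d\<bar> powr p \<le> \<bar>a - c\<bar> powr p + \<bar>b - d\<bar> powr p"
proof -
  have *: "\<bar>a - d\<bar> powr p + \<bar>b - c\<bar> powr p \<le> \<bar>a - c\<bar> powr p + \<bar>b - d\<bar> powr p"
    if "b \<le> a" "c \<le> d" for a b c d :: real
    using abs_powr_spread[OF p, of "b - d" "a - c" "d - c"] that by (simp add: algebra_simps)
  show ?thesis
    using *[of b a c d] *[of a b d c] *[of b a d c] *[of a b c d]
    by (cases "a \<le> b"; cases "c \<le> d") (auto simp: max_def min_def add.commute abs_minus_commute)
qed

context lf_graph
begin

lemma edge_submodular:
  assumes "e \<in> E" "1 \<le> p"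
  shows "edge_diff (\<lambda>x. max (f x) (g x)) e powr p + edge_diff (\<lambda>x. min (f x) (g x)) e powr p
    \<le> edge_diff f e powr p + edge_diff g e powr p"
  using assms max_min_powr_le[OF assms(2)] by (elim edge_pairE) simp

lemma edge_energy_scale:
  assumes "T \<subseteq> E" "0 \<le> s"
  shows "edge_energy p T (\<lambda>x. s * f x) = s powr p * edge_energy p T f"
  unfolding edge_energy_def sum_distrib_left
proof (rule sum.cong[OF refl])
  fix e assume "e \<in> T"
  then obtain u v where "e = {u, v}" using edge_pairE assms by blast
  moreover have "\<bar>s * f u - s * f v\<bar> = s * \<bar>f u - f v\<bar>" for u v
    using assms by (simp add: abs_mult flip: right_diff_distrib)
  ultimately show "edge_diff (\<lambda>x. s * f x) e powr p = s powr p * edge_diff f e powr p"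
    using assms by (simp add: powr_mult)
qed

text \<open>
  The bounds 0 and 1 are required everywhere, also off the vertex set, so that the feasible functions form
  a compact set in the product topology.
\<close>
definition feasible :: "'a set \<Rightarrow> 'a set \<Rightarrow> ('a \<Rightarrow> real) \<Rightarrow> bool" where
  "feasible A F u \<longleftrightarrow> (\<forall>x. 0 \<le> u x \<and> u x \<le> 1) \<and> (\<forall>x\<in>A. u x = 1) \<and> (\<forall>x\<in>F. u x = 0)"

definition equilibrium :: "real \<Rightarrow> 'a set set \<Rightarrow> 'a set \<Rightarrow> 'a set \<Rightarrow> ('a \<Rightarrow> real) \<Rightarrow> bool" where
  "equilibrium p T A F u \<longleftrightarrow> feasible A F u \<and> (\<forall>v. feasible A F v \<longrightarrow> edge_energy p T u \<le> edge_energy p T v)"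

lemma continuous_edge_energy:
  assumes "T \<subseteq> E" "1 \<le> p"
  shows "continuous_on UNIV (\<lambda>u. edge_energy p T u)"
  unfolding edge_energy_def
proof (rule continuous_on_sum)
  fix e assume "e \<in> T"
  then obtain a b where "e = {a, b}" using assms edge_pairE by blast
  then have eq: "(\<lambda>u. edge_diff u e powr p) = (\<lambda>u. \<bar>u a - u b\<bar> powr p)" by (simp add: fun_eq_iff)
  show "continuous_on UNIV (\<lambda>u. edge_diff u e powr p)"
    unfolding eq using assms by (intro continuous_on_powr' continuous_intros) auto
qed

lemma ex_equilibrium:
  assumes "T \<subseteq> E" "1 \<le> p" "A \<inter> F = {}"
  shows "\<exists>u. equilibrium p T A F u"
proof -
  define I where "I x = (if x \<in> A then {1} else if x \<in> F then {0} else {0..1::real})" for x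
  have K: "{u. feasible A F u} = PiE UNIV I"
  proof -
    have "feasible A F u \<longleftrightarrow> (\<forall>x. (0 \<le> u x \<and> u x \<le> 1) \<and> (x \<in> A \<longrightarrow> u x = 1) \<and> (x \<in> F \<longrightarrow> u x = 0))" for u
      by (auto simp: feasible_def)
    moreover have "(0 \<le> t \<and> t \<le> 1) \<and> (x \<in> A \<longrightarrow> t = 1) \<and> (x \<in> F \<longrightarrow> t = 0) \<longleftrightarrow> t \<in> I x" for t :: real and x
      using assms(3) by (auto simp: I_def)
    ultimately show ?thesis by (auto simp: PiE_def Pi_def)
  qed
  have "compactin (product_topology (\<lambda>_. euclidean) UNIV) (PiE UNIV I)"
    by (subst compactin_PiE) (auto simp: I_def)
  then have comp: "compact {u. feasible A F u}"
    unfolding K euclidean_product_topology by simp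
  have "(\<lambda>x. if x \<in> A then 1 else 0) \<in> {u. feasible A F u}" using assms(3) by (auto simp: feasible_def)
  then have "{u. feasible A F u} \<noteq> {}" by blast
  then show ?thesis
    using continuous_attains_inf[OF comp _ continuous_on_subset[OF continuous_edge_energy[OF assms(1,2)] subset_UNIV]]
    by (auto simp: equilibrium_def)
qed

lemma edge_energy_complement: "T \<subseteq> E \<Longrightarrow> edge_energy p T (\<lambda>x. 1 - u x) = edge_energy p T u"
  unfolding edge_energy_def
proof (rule sum.cong[OF refl])
  fix e assume "T \<subseteq> E" "e \<in> T"
  then obtain a b where "e = {a, b}" using edge_pairE by blast
  then show "edge_diff (\<lambda>x. 1 - u x) e powr p = edge_diff u e powr p" by (simp add: abs_minus_commute)
qed

lemma equilibrium_complement: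
  assumes "equilibrium p T A F u" "T \<subseteq> E"
  shows "equilibrium p T F A (\<lambda>x. 1 - u x)"
  unfolding equilibrium_def
proof (intro conjI allI impI)
  show "feasible F A (\<lambda>x. 1 - u x)" using assms by (auto simp: equilibrium_def feasible_def)
next
  fix v assume "feasible F A v"
  then have "feasible A F (\<lambda>x. 1 - v x)" by (auto simp: feasible_def)
  then have "edge_energy p T u \<le> edge_energy p T (\<lambda>x. 1 - v x)" using assms by (simp add: equilibrium_def)
  then show "edge_energy p T (\<lambda>x. 1 - u x) \<le> edge_energy p T v" using assms by (simp add: edge_energy_complement)
qed

text \<open>
  In terms of \<open>w = M - u\<close> on \<open>B'\<close>, the competitor is the maximum of \<open>w\<close> and \<open>g\<close>. Minimality says that its
  energy is at least that of \<open>w\<close>, so by submodularity the minimum of \<open>w\<close> and \<open>g\<close> has at most the energy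
  of \<open>g\<close>. The competitor lies below \<open>u\<close> and is nonnegative, hence it still vanishes on \<open>F\<close>; it agrees with
  \<open>u\<close> on \<open>A\<close>, where \<open>g\<close> vanishes. Outside \<open>B'\<close> nothing is known about \<open>w\<close>, but edges that leave \<open>B'\<close>
  do not touch \<open>B\<close>, so neither \<open>g\<close> nor the change of \<open>u\<close> is seen by them.
\<close>

lemma caccioppoli:
  assumes u: "equilibrium p T A F u" and T: "T \<subseteq> E" and p: "1 \<le> p"
    and B: "B \<subseteq> B'" "\<And>e. e \<in> T \<Longrightarrow> e \<inter> B \<noteq> {} \<Longrightarrow> e \<subseteq> B'" "B \<inter> A = {}"
    and mM: "\<And>x. x \<in> B' \<Longrightarrow> m \<le> u x \<and> u x \<le> M" "0 \<le> m"
    and g: "\<And>x. 0 \<le> g x \<and> g x \<le> M - m" "\<And>x. x \<notin> B \<Longrightarrow> g x = 0"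
  shows "edge_energy p T (\<lambda>x. if x \<in> B' then min (M - u x) (g x) else 0) \<le> edge_energy p T g"
proof -
  define v where "v x = (if x \<in> B' then min (u x) (M - g x) else u x)" for x
  let ?w = "\<lambda>x. if x \<in> B' then min (M - u x) (g x) else 0"
  have fu: "feasible A F u" using u by (simp add: equilibrium_def)
  have "feasible A F v"
    unfolding feasible_def
  proof (intro conjI allI ballI)
    fix x
    have "0 \<le> M - g x" using g(1)[of x] mM(2) by linarith
    then show "0 \<le> v x" using fu by (auto simp: v_def feasible_def)
    have "v x \<le> u x" by (simp add: v_def)
    also have "u x \<le> 1" using fu by (simp add: feasible_def)
    finally show "v x \<le> 1" .
  next
    fix x assume "x \<in> A"
    then have "g x = 0" "u x = 1" using B(3) g(2) fu by (auto simp: feasible_def)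
    then show "v x = 1" using mM(1)[of x] by (auto simp: v_def)
  next
    fix x assume "x \<in> F"
    then have "u x = 0" using fu by (auto simp: feasible_def)
    moreover have "0 \<le> M - g x" using g(1)[of x] mM(2) by linarith
    ultimately show "v x = 0" by (simp add: v_def)
  qed
  then have 1: "edge_energy p T u \<le> edge_energy p T v" using u by (simp add: equilibrium_def)
  have "edge_diff v e powr p + edge_diff ?w e powr p \<le> edge_diff u e powr p + edge_diff g e powr p"
    if e: "e \<in> T" for e
  proof -
    obtain a b where ab: "e = {a, b}" using e T edge_pairE by blast
    show ?thesis
    proof (cases "a \<in> B' \<and> b \<in> B'")
      case True
      have "min (u x) (M - g x) = M - max (M - u x) (g x)" for x by (auto simp: min_def max_def)
      then show ?thesis
        using max_min_powr_le[OF p, of "M - u a" "g a" "M - u b" "g b"] True ab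
        by (simp add: v_def abs_minus_commute)
    next
      case False
      then have "a \<notin> B" "b \<notin> B" using B(2)[OF e] ab by auto
      then have "g a = 0" "g b = 0" using g by auto
      moreover have "v x = u x \<and> ?w x = 0" if "g x = 0" for x
        using that mM(1)[of x] by (auto simp: v_def)
      ultimately show ?thesis using ab by simp
    qed
  qed
  then have "edge_energy p T v + edge_energy p T ?w \<le> edge_energy p T u + edge_energy p T g"
    unfolding edge_energy_def sum.distrib[symmetric] by (intro sum_mono) auto
  then show ?thesis using 1 by linarith
qed

text \<open>
  A Harnack inequality on a single edge. If \<open>M - u a\<close> were much smaller than \<open>M - u b\<close>, lowering \<open>u\<close> at \<open>a\<close>
  by \<open>t = \<delta> * (u a - u b)\<close> would save at least \<open>\<delta> * (u a - u b) powr p\<close> on the edge to \<open>b\<close> and cost at most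
  \<open>(2 * t) powr p\<close> on each edge at \<open>a\<close>; the assumption on \<open>\<delta>\<close> says that the saving wins.
\<close>

lemma equilibrium_neighbour:
  assumes u: "equilibrium p T A F u" and T: "T \<subseteq> E" "finite T" and p: "1 \<le> p"
    and ab: "adjacent E a b" and star: "star a \<subseteq> T" "\<Union>(star a) \<subseteq> B" and a: "a \<notin> A"
    and mM: "\<And>x. x \<in> B \<Longrightarrow> m \<le> u x \<and> u x \<le> M" "0 \<le> m"
    and D: "card (star a) \<le> D"
    and \<delta>: "0 < \<delta>" "\<delta> \<le> 1" "real D * (2 * \<delta>) powr p < \<delta>"
  shows "M - u b \<le> (1 + 1 / \<delta>) * (M - u a)"
proof (rule ccontr)
  assume neg: "\<not> ?thesis"
  define G where "G = u a - u b"
  define t where "t = \<delta> * G"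
  have fu: "feasible A F u" using u by (simp add: equilibrium_def)
  have "{a, b} \<in> star a" using ab by (auto simp: star_def adjacent_def)
  then have inB: "a \<in> B" "b \<in> B" using star by auto
  have h: "M - u a < t"
  proof -
    have "\<delta> * ((1 + 1 / \<delta>) * (M - u a)) < \<delta> * (M - u b)" using neg \<delta> by (intro mult_strict_left_mono) auto
    then show ?thesis using \<delta> by (simp add: t_def G_def algebra_simps)
  qed
  have t0: "0 < t" using h mM(1)[OF inB(1)] by linarith
  then have G: "0 < G" using \<delta> by (simp add: t_def zero_less_mult_iff)
  have tG: "t \<le> G" using \<delta> G by (simp add: t_def)
  define v where "v = u(a := u a - t)"
  have "a \<notin> F" using fu G mM(1)[OF inB(2)] mM(2) by (auto simp: feasible_def G_def)
  moreover have "0 \<le> u a - t" "u a - t \<le> 1"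
    using tG t0 mM(1)[OF inB(2)] mM(2) fu by (auto simp: G_def feasible_def intro: order_trans[of "u a - t" "u a"])
  ultimately have "feasible A F v" using fu a by (auto simp: feasible_def v_def)
  then have "edge_energy p T u \<le> edge_energy p T v" using u by (simp add: equilibrium_def)
  moreover have split: "edge_energy p T f = edge_energy p (T - star a) f + edge_energy p (star a) f" for f
    unfolding edge_energy_def using T star by (intro sum.subset_diff) auto
  moreover have "edge_energy p (T - star a) v = edge_energy p (T - star a) u"
    unfolding edge_energy_def
  proof (rule sum.cong[OF refl])
    fix e assume e: "e \<in> T - star a"
    then obtain x y where "e = {x, y}" using T edge_pairE by blast
    then show "edge_diff v e powr p = edge_diff u e powr p" using e T by (auto simp: star_def v_def)
  qed
  ultimately have le: "edge_energy p (star a) u \<le> edge_energy p (star a) v" by simp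
  have "edge_diff v e powr p \<le> edge_diff u e powr p + (2 * t) powr p - (if e = {a, b} then \<delta> * G powr p else 0)"
    if e: "e \<in> star a" for e
  proof -
    have "e \<in> E" "a \<in> e" using e by (auto simp: star_def)
    then obtain y where y: "e = {a, y}" "y \<noteq> a" by (elim edge_pairE) auto
    then have d: "edge_diff v e = \<bar>u a - t - u y\<bar>" "edge_diff u e = \<bar>u a - u y\<bar>" by (auto simp: v_def)
    show ?thesis
    proof (cases "y = b")
      case True
      have "edge_diff v e = (1 - \<delta>) * G + \<delta> * 0" using d True tG by (simp add: G_def t_def algebra_simps)
      also have "\<dots> powr p \<le> (1 - \<delta>) * G powr p + \<delta> * 0 powr p"
        using powr_convex_combination[OF p, of G 0 "1 - \<delta>" \<delta>] \<delta> G by simp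
      finally have "edge_diff v e powr p \<le> (1 - \<delta>) * G powr p + \<delta> * 0 powr p" .
      moreover have "edge_diff u e = G" using d True G by (simp add: G_def)
      ultimately have "edge_diff v e powr p \<le> edge_diff u e powr p - \<delta> * G powr p"
        by (simp add: algebra_simps)
      then have "edge_diff v e powr p \<le> edge_diff u e powr p + (2 * t) powr p - \<delta> * G powr p"
        using powr_ge_zero[of "2 * t" p] by linarith
      then show ?thesis using y True by simp
    next
      case False
      then have ne: "e \<noteq> {a, b}" using y by (auto simp: doubleton_eq_iff)
      have "y \<in> B" using e y star by auto
      then have "u y \<le> M" using mM by blast
      then have "\<bar>u a - t - u y\<bar> \<le> max \<bar>u a - u y\<bar> (2 * t)" using h t0 by (auto simp: abs_if max_def)
      then have "edge_diff v e powr p \<le> max \<bar>u a - u y\<bar> (2 * t) powr p"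
        unfolding d using p by (intro powr_mono2) auto
      also have "\<dots> \<le> edge_diff u e powr p + (2 * t) powr p" unfolding d by (auto simp: max_def)
      finally show ?thesis using ne by simp
    qed
  qed
  then have "edge_energy p (star a) v \<le> (\<Sum>e\<in>star a. edge_diff u e powr p + (2 * t) powr p - (if e = {a, b} then \<delta> * G powr p else 0))"
    unfolding edge_energy_def by (intro sum_mono) auto
  also have "\<dots> = edge_energy p (star a) u + real (card (star a)) * (2 * t) powr p - \<delta> * G powr p"
    using \<open>{a, b} \<in> star a\<close> finite_subset[OF star(1) T(2)]
    by (simp add: edge_energy_def sum.distrib sum_subtractf)
  finally have "\<delta> * G powr p \<le> real (card (star a)) * (2 * t) powr p" using le by linarith
  also have "\<dots> \<le> real D * (2 * t) powr p" using D by (intro mult_right_mono) auto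
  also have "\<dots> = (real D * (2 * \<delta>) powr p) * G powr p" using \<delta> G by (simp add: t_def powr_mult)
  also have "\<dots> < \<delta> * G powr p" using \<delta>(3) G by (intro mult_strict_right_mono) auto
  finally show False by simp
qed

text \<open>
  The maximum principle. Let \<open>C\<close> be the set of vertices that can be reached from \<open>a\<close> inside the superlevel
  set of \<open>u a\<close>. If \<open>C\<close> misses \<open>A\<close>, it can be lowered as a whole until its least value meets the
  largest value on its outer boundary. This reduces the increments on all edges that leave \<open>C\<close>, and there is such an edge
  because the graph is connected.
\<close>

lemma equilibrium_reach:
  assumes u: "equilibrium p T A F u" and T: "T \<subseteq> E" "finite T" and p: "1 \<le> p"
    and fin: "finite (V - (A \<union> F))" and T': "touching (V - (A \<union> F)) \<subseteq> T"
    and A: "A \<noteq> {}" "A \<subseteq> V" and a: "a \<in> V"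
  shows "\<exists>xs b. walk_betw E a xs b \<and> b \<in> A \<and> (\<forall>y\<in>set xs. u a \<le> u y)"
proof (rule ccontr)
  assume no: "\<not> ?thesis"
  define C where "C = {y. \<exists>xs. walk_betw E a xs y \<and> (\<forall>x\<in>set xs. u a \<le> u x)}"
  have fu: "feasible A F u" using u by (simp add: equilibrium_def)
  have CV: "C \<subseteq> V"
  proof
    fix y assume "y \<in> C"
    then obtain xs where xs: "walk_betw E a xs y" by (auto simp: C_def)
    then have "y \<in> set xs" by (auto simp: walk_betw_def)
    then show "y \<in> V" using walk_subset[OF xs a] by blast
  qed
  have CA: "C \<inter> A = {}" using no by (auto simp: C_def)
  have aC: "a \<in> C" unfolding C_def by (auto intro!: exI[of _ "[a]"] simp: walk_betw_def)
  have Cge: "u a \<le> u y" if "y \<in> C" for y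
    using that unfolding C_def walk_betw_def by (auto dest: last_in_set)
  have step: "z \<in> C" if yz: "y \<in> C" "adjacent E y z" "u a \<le> u z" for y z
  proof -
    obtain xs where xs: "walk_betw E a xs y" "\<forall>x\<in>set xs. u a \<le> u x" using yz(1) by (auto simp: C_def)
    have "walk_betw E y [y, z] z" using yz by (simp add: walk_betw_def)
    from walk_append[OF xs(1) this] have "walk_betw E a (xs @ [z]) z" by simp
    then show ?thesis unfolding C_def mem_Collect_eq using xs(2) yz(3) by (intro exI[of _ "xs @ [z]"]) auto
  qed
  obtain b where b: "b \<in> A" "b \<in> V" using A by auto
  have exit: "\<exists>y z. y \<in> C \<and> z \<notin> C \<and> adjacent E y z"
  proof -
    have *: "\<exists>y z. y \<in> C \<and> z \<notin> C \<and> adjacent E y z" if "walk_betw E x xs b" "x \<in> C" for x xs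
      using that
    proof (induction xs arbitrary: x)
      case Nil then show ?case by (simp add: walk_betw_def)
    next
      case (Cons c xs)
      show ?case
      proof (cases "xs = []")
        case True then show ?thesis using Cons.prems CA b by (auto simp: walk_betw_def)
      next
        case False
        then have "adjacent E x (hd xs)" "walk_betw E (hd xs) xs b"
          using Cons.prems(1) by (auto simp: walk_betw_def successively_Cons)
        then show ?thesis using Cons.IH[of "hd xs"] Cons.prems(2) by blast
      qed
    qed
    show ?thesis using * ex_walk[OF a b(2)] aC by blast
  qed
  then obtain y0 z0 where yz: "y0 \<in> C" "z0 \<notin> C" "adjacent E y0 z0" by blast
  have pos: "0 < u a"
  proof -
    have "u z0 < u a" using step[OF yz(1,3)] yz(2) by linarith
    moreover have "0 \<le> u z0" using fu by (simp add: feasible_def)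
    ultimately show ?thesis by linarith
  qed
  have CU: "C \<subseteq> V - (A \<union> F)" using CV CA Cge pos fu by (fastforce simp: feasible_def)
  define Z where "Z = (\<Union>y\<in>C. neighbours E y) - C"
  have finZ: "finite Z" unfolding Z_def using CU fin CV by (auto intro!: finite_neighbours intro: finite_subset)
  have z0Z: "z0 \<in> Z" using yz by (auto simp: Z_def neighbours_def)
  have Zlt: "u z < u a" if "z \<in> Z" for z
    using that step by (force simp: Z_def neighbours_def)
  define s where "s = Max (u ` Z)"
  have s: "u z \<le> s" if "z \<in> Z" for z using that finZ by (simp add: s_def)
  have "s \<in> u ` Z" unfolding s_def using finZ z0Z by (intro Max_in) auto
  then have s_less: "s < u a" "0 \<le> s" using Zlt fu by (auto simp: feasible_def)
  define \<epsilon> where "\<epsilon> = u a - s"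
  define v where "v x = (if x \<in> C then u x - \<epsilon> else u x)" for x
  have "0 \<le> v x \<and> v x \<le> 1" for x
  proof (cases "x \<in> C")
    case True
    then have "0 \<le> u x - \<epsilon>" using Cge[of x] s_less by (simp add: \<epsilon>_def)
    moreover have "u x \<le> 1" using fu by (simp add: feasible_def)
    ultimately show ?thesis using s_less True by (simp add: v_def \<epsilon>_def)
  qed (use fu in \<open>simp add: v_def feasible_def\<close>)
  moreover have "x \<notin> C" if "x \<in> A \<or> x \<in> F" for x using CU that by blast
  ultimately have "feasible A F v" using fu unfolding feasible_def by (simp add: v_def)
  then have "edge_energy p T u \<le> edge_energy p T v" using u by (simp add: equilibrium_def)
  moreover have "edge_energy p T v < edge_energy p T u"
    unfolding edge_energy_def
  proof (rule sum_strict_mono_ex1[OF T(2)])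
    have bd: "edge_diff v {y, z} < edge_diff u {y, z}" if "y \<in> C" "z \<notin> C" "adjacent E y z" for y z
    proof -
      have "z \<in> Z" using that by (auto simp: Z_def neighbours_def)
      then have "u z \<le> s" by (rule s)
      then show ?thesis using that Cge[of y] s_less by (simp add: v_def \<epsilon>_def)
    qed
    have "edge_diff v e \<le> edge_diff u e" if "e \<in> T" for e
    proof -
      have eE: "e \<in> E" using that T by auto
      then obtain x y where xy: "e = {x, y}" using edge_pairE by blast
      then have adj: "adjacent E x y" "adjacent E y x" using eE by (auto simp: adjacent_def insert_commute)
      consider "x \<in> C" "y \<in> C" | "x \<notin> C" "y \<notin> C" | "x \<in> C" "y \<notin> C" | "x \<notin> C" "y \<in> C" by blast
      then show ?thesis
      proof cases
        case 3 then show ?thesis using bd adj xy by fastforce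
      next
        case 4 then show ?thesis using bd[of y x] adj xy by (simp add: insert_commute)
      qed (simp_all add: xy v_def)
    qed
    then show "\<forall>e\<in>T. edge_diff v e powr p \<le> edge_diff u e powr p"
      using p T edge_diff_nonneg by (auto intro!: powr_mono2)
    have eE: "{y0, z0} \<in> E" using yz by (simp add: adjacent_def)
    then have "{y0, z0} \<in> T" using T' CU yz by (auto simp: touching_def)
    moreover have "edge_diff v {y0, z0} powr p < edge_diff u {y0, z0} powr p"
      using bd[OF yz] edge_diff_nonneg[OF eE] p by (intro powr_less_mono2) auto
    ultimately show "\<exists>e\<in>T. edge_diff v e powr p < edge_diff u e powr p" by blast
  qed
  ultimately show False by simp
qed

end

section \<open>Oscillation decay\<close>

text \<open>
  The increment of a truncated logarithm on an edge with comparable end values is controlled by one of the levels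
  \<open>\<mu> / Q ^ j\<close>: take the smallest level that is above both values, so that truncating at this level
  leaves the edge unchanged while the level itself is comparable to the values.
\<close>

lemma log_level:
  fixes h H Q \<mu> :: real
  assumes Q: "1 < Q" and \<mu>: "0 < \<mu>" and h: "0 \<le> h" "h \<le> H" "H \<le> \<mu>" "H \<le> Q * h"
  shows "\<exists>j\<le>N. H \<le> \<mu> / Q ^ j \<and>
    ln (max H (\<mu> / Q ^ N)) - ln (max h (\<mu> / Q ^ N)) \<le> Q\<^sup>2 * (Q ^ j / \<mu>) * (H - h)"
proof -
  define \<epsilon> where "\<epsilon> = \<mu> / Q ^ N"
  define h' where "h' = max h \<epsilon>"
  define H' where "H' = max H \<epsilon>"
  have \<epsilon>: "0 < \<epsilon>" "\<epsilon> \<le> \<mu>" using Q \<mu> by (auto simp: \<epsilon>_def field_simps)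
  have h': "0 < h'" "h' \<le> H'" "H' - h' \<le> H - h" "H' \<le> \<mu>" "\<epsilon> \<le> h'" "H \<le> H'"
    using \<epsilon> h by (auto simp: h'_def H'_def)
  have HQ: "H' \<le> Q * h'"
  proof -
    have "\<epsilon> \<le> Q * \<epsilon>" "Q * h \<le> Q * h'" "Q * \<epsilon> \<le> Q * h'" using \<epsilon> Q by (auto simp: h'_def)
    then show ?thesis using h unfolding H'_def by linarith
  qed
  define J where "J = {j. j \<le> N \<and> H' \<le> \<mu> / Q ^ j}"
  define j where "j = Max J"
  have fin: "finite J" by (rule finite_subset[of _ "{..N}"]) (auto simp: J_def)
  have "0 \<in> J" using h' by (simp add: J_def)
  then have jJ: "j \<in> J" unfolding j_def using fin by (intro Max_in) auto
  have le: "\<mu> / Q ^ j \<le> Q\<^sup>2 * h'"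
  proof (cases "j = N")
    case True
    have "\<mu> / Q ^ j \<le> h'" using h' True by (simp add: \<epsilon>_def)
    also have "\<dots> \<le> Q\<^sup>2 * h'" using Q h' by (simp add: one_le_power)
    finally show ?thesis .
  next
    case False
    have "Suc j \<notin> J" using Max_ge[OF fin, of "Suc j"] by (auto simp: j_def)
    then have "\<mu> / Q ^ Suc j \<le> H'" using False jJ by (auto simp: J_def)
    then have "\<mu> / Q ^ Suc j \<le> Q * h'" using HQ by linarith
    then have "Q * (\<mu> / Q ^ Suc j) \<le> Q * (Q * h')" using Q by (intro mult_left_mono) auto
    then show ?thesis using Q by (simp add: power2_eq_square)
  qed
  have "ln H' - ln h' = ln (H' / h')" using h' by (simp add: ln_div)
  also have "\<dots> \<le> H' / h' - 1" using h' by (intro ln_le_minus_one) auto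
  also have "\<dots> = (H' - h') / h'" using h' by (simp add: field_simps)
  also have "\<dots> \<le> (H - h) / h'" using h' by (intro divide_right_mono) auto
  also have "\<dots> \<le> Q\<^sup>2 * (Q ^ j / \<mu>) * (H - h)"
  proof -
    have "1 / h' \<le> Q\<^sup>2 * (Q ^ j / \<mu>)" using le Q \<mu> h' by (simp add: field_simps)
    then have "1 / h' * (H - h) \<le> Q\<^sup>2 * (Q ^ j / \<mu>) * (H - h)" using h by (intro mult_right_mono) auto
    then show ?thesis by simp
  qed
  finally have "ln H' - ln h' \<le> Q\<^sup>2 * (Q ^ j / \<mu>) * (H - h)" .
  moreover have "j \<le> N" "H \<le> \<mu> / Q ^ j" using jJ h' by (auto simp: J_def)
  ultimately show ?thesis unfolding H'_def h'_def \<epsilon>_def by blast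
qed

context lf_graph
begin

lemma edge_energy_le_energy:
  assumes "finite T" "T \<subseteq> E"
  shows "ennreal (edge_energy p T f) \<le> energy E p f"
proof -
  have "ennreal (edge_energy p T f) = (\<Sum>e\<in>T. ennreal (edge_diff f e powr p))"
    unfolding edge_energy_def by (simp add: sum_ennreal)
  also have "\<dots> \<le> energy E p f"
    unfolding energy_def using assms by (subst nonneg_infsum_complete) (auto intro!: SUP_upper)
  finally show ?thesis .
qed

lemma energy_eq_edge_energy:
  assumes "finite T" "T \<subseteq> E" "\<And>e. e \<in> E - T \<Longrightarrow> edge_diff f e = 0"
  shows "energy E p f = ennreal (edge_energy p T f)"
proof -
  have "energy E p f = (\<Sum>\<^sub>\<infinity>e\<in>T. ennreal (edge_diff f e powr p))"
    unfolding energy_def using assms by (intro infsum_cong_neutral) auto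
  then show ?thesis using assms by (simp add: edge_energy_def sum_ennreal)
qed

lemma ex_maximum_of_family:
  assumes "finite I" "finite T" "T \<subseteq> E" "1 \<le> p"
    and "\<And>i x. i \<in> I \<Longrightarrow> 0 \<le> \<psi> i x \<and> \<psi> i x \<le> (1::real)" "\<And>i. i \<in> I \<Longrightarrow> edge_energy p T (\<psi> i) \<le> C"
  shows "\<exists>g. (\<forall>x. 0 \<le> g x \<and> g x \<le> 1) \<and> (\<forall>i\<in>I. \<forall>x. \<psi> i x \<le> g x) \<and>
    (\<forall>x. (\<forall>i\<in>I. \<psi> i x = 0) \<longrightarrow> g x = 0) \<and> edge_energy p T g \<le> real (card I) * C"
  using assms(1,5,6)
proof (induction I)
  case empty
  have "edge_energy p T (\<lambda>x. 0) = 0"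
    unfolding edge_energy_def
  proof (intro sum.neutral ballI)
    fix e assume "e \<in> T"
    then obtain u v where "e = {u, v}" using assms(3) edge_pairE by blast
    then show "edge_diff (\<lambda>x. 0) e powr p = 0" by simp
  qed
  then show ?case by (intro exI[of _ "\<lambda>x. 0"]) auto
next
  case (insert i I)
  then obtain g where g: "\<And>x. 0 \<le> g x \<and> g x \<le> 1" "\<And>j x. j \<in> I \<Longrightarrow> \<psi> j x \<le> g x"
    "\<And>x. (\<forall>i\<in>I. \<psi> i x = 0) \<Longrightarrow> g x = 0" "edge_energy p T g \<le> real (card I) * C" by (metis insertCI)
  let ?g = "\<lambda>x. max (\<psi> i x) (g x)"
  have "edge_energy p T ?g \<le> edge_energy p T ?g + edge_energy p T (\<lambda>x. min (\<psi> i x) (g x))" using edge_energy_nonneg by simp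
  also have "\<dots> \<le> edge_energy p T (\<psi> i) + edge_energy p T g"
    unfolding edge_energy_def sum.distrib[symmetric]
    using assms(3,4) by (intro sum_mono edge_submodular) auto
  also have "\<dots> \<le> C + real (card I) * C" using insert g by (intro add_mono) auto
  also have "\<dots> = real (card (insert i I)) * C" using insert by (simp add: algebra_simps)
  finally have e: "edge_energy p T ?g \<le> real (card (insert i I)) * C" .
  show ?case
  proof (intro exI[of _ ?g] conjI allI ballI impI)
    fix x show "0 \<le> ?g x" "?g x \<le> 1" using g(1)[of x] insert.prems(1)[of i x] by auto
  next
    fix j x assume "j \<in> insert i I" then show "\<psi> j x \<le> ?g x" using g(2)[of j x] by auto
  next
    fix x assume "\<forall>j\<in>insert i I. \<psi> j x = 0" then show "?g x = 0" using g(3)[of x] by auto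
  qed (rule e)
qed

text \<open>
  A separated subset of maximal cardinality covers.
\<close>

lemma ex_separated_cover:
  assumes "finite B" "B \<subseteq> V" "0 < s"
  shows "\<exists>I\<subseteq>B. (\<forall>i\<in>I. \<forall>j\<in>I. i \<noteq> j \<longrightarrow> s \<le> real (gdist E i j)) \<and> B \<subseteq> (\<Union>i\<in>I. gball V E i s)"
proof -
  let ?P = "\<lambda>I. I \<subseteq> B \<and> (\<forall>i\<in>I. \<forall>j\<in>I. i \<noteq> j \<longrightarrow> s \<le> real (gdist E i j))"
  have "\<exists>I. ?P I \<and> (\<forall>J. ?P J \<longrightarrow> card J \<le> card I)"
  proof (rule Lattices_Big.ex_has_greatest_nat)
    show "?P {}" by simp
    show "\<forall>J. ?P J \<longrightarrow> card J < Suc (card B)"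
    proof (intro allI impI)
      fix J assume "?P J"
      then have "J \<subseteq> B" by (rule conjunct1)
      then show "card J < Suc (card B)" using card_mono[OF assms(1)] by (simp add: less_Suc_eq_le)
    qed
  qed
  then obtain I where I0: "?P I \<and> (\<forall>J. ?P J \<longrightarrow> card J \<le> card I)" by (rule exE)
  note I = I0[THEN conjunct1] I0[THEN conjunct2, rule_format]
  have finI: "finite I" using I(1) assms(1) finite_subset by blast
  have "x \<in> (\<Union>i\<in>I. gball V E i s)" if x: "x \<in> B" for x
  proof (rule ccontr)
    assume "\<not> ?thesis"
    then have far: "s \<le> real (gdist E i x)" if "i \<in> I" for i using that x assms by (auto simp: gball_def not_less)
    then have "x \<notin> I" using assms by fastforce
    have "s \<le> real (gdist E x i)" if "i \<in> I" for i
    proof -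
      have "x \<in> V" "i \<in> V" using x I(1) that assms(2) by auto
      then show ?thesis using far[OF that] gdist_sym[of x i] by simp
    qed
    then have "?P (insert x I)" using I(1) x far by auto
    then have "card (insert x I) \<le> card I" by (rule I(2))
    then show False using \<open>x \<notin> I\<close> finI by simp
  qed
  then have "B \<subseteq> (\<Union>i\<in>I. gball V E i s)" by (rule subsetI)
  then show ?thesis using I(1) by (intro exI[of _ I] conjI) (rule conjunct1, assumption, rule conjunct2, assumption)
qed

end

text \<open>
  The parameter \<open>\<delta>\<close> is the one of \<open>equilibrium_neighbour\<close>, and \<open>Q = 1 + 1 / \<delta>\<close> is the resulting bound for
  the ratio of adjacent values. The number \<open>N\<close> of levels is so large that the lower bound for the energy of the
  logarithm, of order \<open>N powr p\<close>, exceeds the upper bound of order \<open>N\<close>.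
\<close>
locale loewner_capacity_graph =
  loewner_graph V E p df "df - \<beta>" C_AR A c L m
  for V :: "'a set" and E p df \<beta> C_AR A c L m +
  fixes C_cap A_cap :: real and D :: nat and \<delta> :: real and N :: nat
  assumes cap: "capacity_upper_bound V E p \<beta> C_cap A_cap"
    and deg: "\<And>x. x \<in> V \<Longrightarrow> card (neighbours E x) \<le> D"
    and \<delta>: "0 < \<delta>" "\<delta> \<le> 1" "real D * (2 * \<delta>) powr p < \<delta>"
    and N: "2 \<le> N"
      "2 * (real N + 1) * (1 + 1 / \<delta>) powr (2 * p) * (2 * C_cap * C_AR) * (H + 1) powr (df - \<beta>)
        < c_gap * ((real N - 1) * ln (1 + 1 / \<delta>)) powr p"
begin

definition "Q = 1 + 1 / \<delta>"
definition "C_cut = 2 * C_cap * C_AR"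

lemma Q_ge: "2 \<le> Q" using \<delta> by (simp add: Q_def field_simps)

lemma H_ge: "9 \<le> H" using T_ge by (simp add: H_def)

lemma C_cut_pos: "0 < C_cut" using cap C_AR_ge by (simp add: C_cut_def capacity_upper_bound_def)

abbreviation "cap_radius s \<equiv> ennreal s < gdiam E V / ennreal A_cap"

lemma ex_cutoff:
  assumes x: "x \<in> V" and R: "1 \<le> R" "cap_radius R" "ennreal R < gdiam E V + 1"
  shows "\<exists>\<psi>. (\<forall>y. 0 \<le> \<psi> y \<and> \<psi> y \<le> (1::real)) \<and> (\<forall>y\<in>gball V E x R. \<psi> y = 1) \<and>
    (\<forall>y. y \<notin> gball V E x (2 * R) \<longrightarrow> \<psi> y = 0) \<and>
    (\<forall>Es. finite Es \<and> Es \<subseteq> E \<longrightarrow> edge_energy p Es \<psi> \<le> C_cut * R powr (df - \<beta>))"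
proof -
  define X where "X = C_cap * real (card (gball V E x R)) / R powr \<beta>"
  have Cc: "0 < C_cap" using cap by (simp add: capacity_upper_bound_def)
  have "x \<in> gball V E x R" using x R by (simp add: gball_def)
  then have "0 < card (gball V E x R)" using finite_gball[OF x] by (auto simp: card_gt_0_iff)
  then have X: "0 < X" using Cc R by (simp add: X_def)
  have "capacity E p (gball V E x R) (V - gball V E x (2 * R)) \<le> ennreal X"
    using cap x R unfolding capacity_upper_bound_def X_def by blast
  also have "\<dots> < ennreal (2 * X)" using X by (intro ennreal_lessI) auto
  finally obtain f where f: "\<forall>y\<in>gball V E x R. f y = 0" "\<forall>y\<in>V - gball V E x (2 * R). f y = 1"
    "energy E p f < ennreal (2 * X)"
    unfolding capacity_def INF_less_iff by auto
  define \<psi> where "\<psi> y = (if y \<in> V then 1 - max 0 (min 1 (f y)) else 0)" for y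
  have "edge_energy p Es \<psi> \<le> C_cut * R powr (df - \<beta>)" if Es: "finite Es" "Es \<subseteq> E" for Es
  proof -
    have "edge_energy p Es \<psi> \<le> edge_energy p Es f"
      unfolding edge_energy_def
    proof (rule sum_mono)
      fix e assume "e \<in> Es"
      then have eE: "e \<in> E" using Es by auto
      then obtain u v where uv: "e = {u, v}" "u \<in> V" "v \<in> V" using edge_pairE by metis
      have "edge_diff \<psi> e \<le> edge_diff f e" using uv by (simp add: \<psi>_def)
      then show "edge_diff \<psi> e powr p \<le> edge_diff f e powr p"
        using edge_diff_nonneg[OF eE] p by (intro powr_mono2) auto
    qed
    also have "edge_energy p Es f \<le> 2 * X"
    proof -
      have "ennreal (edge_energy p Es f) \<le> energy E p f" by (rule edge_energy_le_energy[OF Es])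
      also have "\<dots> \<le> ennreal (2 * X)" using f(3) by simp
      finally show ?thesis using X by simp
    qed
    also have "\<dots> \<le> 2 * (C_cap * (C_AR * R powr df) / R powr \<beta>)"
      unfolding X_def using Cc R ball_card_upper[OF x R(1,3)]
      by (intro mult_left_mono divide_right_mono) auto
    also have "\<dots> = C_cut * R powr (df - \<beta>)" by (simp add: C_cut_def powr_diff)
    finally show ?thesis .
  qed
  then show ?thesis
    using f(1,2) x R by (intro exI[of _ \<psi>]) (auto simp: \<psi>_def gball_def)
qed

lemma walk_crosses:
  assumes "walk_betw E a xs b" "a \<in> V" "gdist E x a \<le> n" "2 * n \<le> gdist E x b"
  shows "crosses x n xs"
proof -
  have "a \<in> set xs" "b \<in> set xs" "successively (adjacent E) xs" using assms(1) by (auto simp: walk_betw_def)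
  then show ?thesis using walk_subset[OF assms(1,2)] assms(3,4) by (auto simp: crosses_def)
qed

text \<open>
  The logarithmic argument on a ball that misses \<open>A0\<close>. Both plates only enter through walks that lead from
  the small ball to points far away from \<open>x\<close>: first to a plate, by the maximum principle, and then inside the
  plate to one of its distant points.
\<close>

lemma oscillation_one_sided:
  assumes u: "equilibrium p Es A0 F u" and Es: "finite Es" "Es \<subseteq> E"
    and fin: "finite (V - (A0 \<union> F))" and Es': "touching (V - (A0 \<union> F)) \<subseteq> Es"
    and A0: "A0 \<subseteq> V" "A0 \<noteq> {}" and F: "F \<subseteq> V" "F \<noteq> {}"
    and x: "x \<in> V"
    and farA: "\<And>a. a \<in> A0 \<Longrightarrow> \<exists>ws b. walk_betw E a ws b \<and> set ws \<subseteq> A0 \<and> 2 * r k \<le> gdist E x b"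
    and farF: "\<And>a. a \<in> F \<Longrightarrow> \<exists>ws b. walk_betw E a ws b \<and> set ws \<subseteq> F \<and> 2 * r k \<le> gdist E x b"
    and EsB: "touching (gball V E x (3 * H * r k)) \<subseteq> Es"
    and rad: "small_radius (r k)" "ennreal (2 * T * r k) < gdiam E V + 1"
      "cap_radius ((H + 1) * r k)" "ennreal ((H + 1) * r k) < gdiam E V + 1"
    and disj: "gball V E x (3 * H * r k) \<inter> A0 = {}"
    and lU: "\<And>y. y \<in> gball V E x (3 * H * r k) \<Longrightarrow> l \<le> u y \<and> u y \<le> U" "0 \<le> l"
    and a: "a \<in> gball V E x (r k)" and b: "b \<in> gball V E x (r k)"
  shows "u a - u b \<le> (1 - 1 / Q ^ N) * (U - l)"
proof (rule ccontr)
  assume neg: "\<not> ?thesis"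
  let ?n = "real (r k)"
  let ?Bs = "gball V E x (3 * H * r k)" and ?Bi = "gball V E x (H * r k)"
  have n1: "1 \<le> ?n" using r_ge[of k] by simp
  have Hn: "9 * ?n \<le> H * ?n" using H_ge by (intro mult_right_mono) auto
  have fu: "feasible A0 F u" using u by (simp add: equilibrium_def)
  have aV: "a \<in> V" "b \<in> V" using a b by (auto simp: gball_def)
  have sub: "gball V E x (r k) \<subseteq> ?Bs" using Hn n1 by (intro gball_mono) linarith
  define \<mu> where "\<mu> = U - l"
  define \<epsilon> where "\<epsilon> = \<mu> / Q ^ N"
  have neg': "\<mu> - \<epsilon> < u a - u b" using neg by (simp add: \<mu>_def \<epsilon>_def algebra_simps)
  have ua: "l \<le> u b" "u a \<le> U" "u a \<le> U" using lU(1) a b sub by blast+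
  have "\<mu> - \<epsilon> < \<mu>" using neg' ua by (simp add: \<mu>_def)
  then have \<epsilon>: "0 < \<epsilon>" by simp
  then have \<mu>: "0 < \<mu>" using Q_ge by (simp add: \<epsilon>_def zero_less_divide_iff)
  have "Q ^ 1 \<le> Q ^ N" using Q_ge N by (intro power_increasing) auto
  then have \<epsilon>2: "\<epsilon> \<le> \<mu> / 2" unfolding \<epsilon>_def using Q_ge \<mu> by (intro divide_left_mono) auto
  (* W is constant on the walk from a, and larger by (N - 1) * ln Q on the walk from b; the loss of
     one level comes from using only that U - u is at least \<mu> / Q there. *)
  define W where "W y = ln (max (U - u y) \<epsilon>)" for y
  obtain xs1 a1 where xs1: "walk_betw E a xs1 a1" "a1 \<in> A0" "\<forall>y\<in>set xs1. u a \<le> u y"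
    using equilibrium_reach[OF u Es(2,1) _ fin Es' A0(2,1) aV(1)] p by auto
  obtain xs2 a2 where xs2: "walk_betw E a1 xs2 a2" "set xs2 \<subseteq> A0" "2 * r k \<le> gdist E x a2" using farA[OF xs1(2)] by blast
  have comp: "equilibrium p Es F A0 (\<lambda>x. 1 - u x)" by (rule equilibrium_complement[OF u Es(2)])
  have "\<exists>xs b1. walk_betw E b xs b1 \<and> b1 \<in> F \<and> (\<forall>y\<in>set xs. 1 - u b \<le> 1 - u y)"
    using fin Es' p by (intro equilibrium_reach[OF comp Es(2,1) _ _ _ F(2,1) aV(2)]) (auto simp: Un_commute)
  then obtain ys1 b1 where ys1: "walk_betw E b ys1 b1" "b1 \<in> F" "\<forall>y\<in>set ys1. u y \<le> u b" by auto
  obtain ys2 b2 where ys2: "walk_betw E b1 ys2 b2" "set ys2 \<subseteq> F" "2 * r k \<le> gdist E x b2" using farF[OF ys1(2)] by blast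
  let ?xs = "xs1 @ tl xs2" and ?ys = "ys1 @ tl ys2"
  have xs: "crosses x (r k) ?xs"
    using walk_crosses[OF walk_append[OF xs1(1) xs2(1)] aV(1)] xs2(3) a by (simp add: gball_def)
  have ys: "crosses x (r k) ?ys"
    using walk_crosses[OF walk_append[OF ys1(1) ys2(1)] aV(2)] ys2(3) b by (simp add: gball_def)
  have lnQ: "0 < ln Q" using Q_ge by simp
  have Wx: "W y \<le> ln \<epsilon>" if y: "y \<in> set ?xs" for y
  proof -
    have "u a \<le> u y"
    proof (cases "y \<in> set xs1")
      case False
      then have "y \<in> A0" using y set_walk_append[OF xs1(1) xs2(1)] xs2(2) by auto
      then have "u y = 1" using fu by (simp add: feasible_def)
      then show ?thesis using fu by (simp add: feasible_def)
    qed (use xs1 in auto)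
    then have "U - u y \<le> \<epsilon>" using neg' ua by (simp add: \<mu>_def)
    then show ?thesis by (simp add: W_def max_def)
  qed
  have Wy: "ln \<epsilon> + (real N - 1) * ln Q \<le> W y" if y: "y \<in> set ?ys" for y
  proof -
    have "u y \<le> u b"
    proof (cases "y \<in> set ys1")
      case False
      then have "y \<in> F" using y set_walk_append[OF ys1(1) ys2(1)] ys2(2) by auto
      then have "u y = 0" using fu by (simp add: feasible_def)
      then show ?thesis using fu by (simp add: feasible_def)
    qed (use ys1 in auto)
    then have "\<mu> / 2 \<le> U - u y" using neg' ua \<epsilon>2 by (simp add: \<mu>_def)
    moreover have "\<mu> / Q \<le> \<mu> / 2" using Q_ge \<mu> by (intro divide_left_mono) auto
    ultimately have "\<mu> / Q \<le> max (U - u y) \<epsilon>" by linarith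
    then have "ln (\<mu> / Q) \<le> W y" unfolding W_def using \<mu> Q_ge by (intro ln_mono) auto
    moreover have "ln (\<mu> / Q) = ln \<epsilon> + (real N - 1) * ln Q"
      using \<mu> Q_ge by (simp add: \<epsilon>_def ln_div ln_realpow algebra_simps)
    ultimately show ?thesis by simp
  qed
  have h: "0 < (real N - 1) * ln Q" using N lnQ by simp
  have lower: "c_gap * ((real N - 1) * ln Q) powr p * ?n powr (df - \<beta>) \<le> region_energy p W ?Bi"
    by (rule crossing_gap_energy[OF x xs Wx ys Wy h rad(1,2)])
  have Hn': "(H + 1) * ?n = H * ?n + ?n" "3 * H * ?n = 3 * (H * ?n)" by (auto simp: algebra_simps)
  have R1: "1 \<le> (H + 1) * ?n" using Hn Hn' n1 by linarith
  obtain \<psi> where \<psi>0: "(\<forall>y. 0 \<le> \<psi> y \<and> \<psi> y \<le> (1::real)) \<and> (\<forall>y\<in>gball V E x ((H + 1) * ?n). \<psi> y = 1) \<and>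
    (\<forall>y. y \<notin> gball V E x (2 * ((H + 1) * ?n)) \<longrightarrow> \<psi> y = 0) \<and>
    (\<forall>Es. finite Es \<and> Es \<subseteq> E \<longrightarrow> edge_energy p Es \<psi> \<le> C_cut * ((H + 1) * ?n) powr (df - \<beta>))"
    using ex_cutoff[OF x R1 rad(3,4)] by (rule exE)
  have \<psi>: "\<And>y. 0 \<le> \<psi> y \<and> \<psi> y \<le> (1::real)" "\<And>y. y \<in> gball V E x ((H + 1) * ?n) \<Longrightarrow> \<psi> y = 1"
    "\<And>y. y \<notin> gball V E x (2 * ((H + 1) * ?n)) \<Longrightarrow> \<psi> y = 0"
    "\<And>S. finite S \<Longrightarrow> S \<subseteq> E \<Longrightarrow> edge_energy p S \<psi> \<le> C_cut * ((H + 1) * ?n) powr (df - \<beta>)"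
    using \<psi>0 by blast+
  (* G j is the truncation of U - u at the level \<mu> / Q ^ j wherever the cutoff \<psi> equals 1,
     in particular on all edges that touch the ball of radius H * r k. *)
  define g where "g j y = \<mu> / Q ^ j * \<psi> y" for j y
  define G where "G j y = (if y \<in> ?Bs then min (U - u y) (g j y) else 0)" for j y
  have cacc: "edge_energy p Es (G j) \<le> (\<mu> / Q ^ j) powr p * (C_cut * ((H + 1) * ?n) powr (df - \<beta>))" for j
  proof -
    let ?B = "gball V E x (2 * ((H + 1) * ?n))"
    have le: "2 * ((H + 1) * ?n) + 1 \<le> 3 * H * ?n" using Hn Hn' n1 by linarith
    have BB: "?B \<subseteq> ?Bs" using le by (intro gball_mono) linarith
    have edge: "e \<subseteq> ?Bs" if "e \<in> Es" "e \<inter> ?B \<noteq> {}" for e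
    proof -
      have "e \<in> touching ?B" using that Es by (auto simp: touching_def)
      then show ?thesis using touching_gball_subset[OF x] gball_mono[OF le] by blast
    qed
    have lev: "0 \<le> \<mu> / Q ^ j" "\<mu> / Q ^ j \<le> \<mu>" using \<mu> Q_ge by (auto simp: field_simps)
    have g: "0 \<le> g j y \<and> g j y \<le> U - l" for y
    proof
      show "0 \<le> g j y" unfolding g_def using lev(1) \<psi>(1)[of y] by (intro mult_nonneg_nonneg) auto
      have "g j y \<le> \<mu> / Q ^ j * 1" unfolding g_def using lev(1) \<psi>(1)[of y] by (intro mult_left_mono) auto
      then show "g j y \<le> U - l" using lev(2) unfolding \<mu>_def by linarith
    qed
    have "edge_energy p Es (G j) \<le> edge_energy p Es (g j)"
      unfolding G_def
      by (rule caccioppoli[OF u Es(2) _ BB edge _ lU g]) (use p disj BB \<psi>(3) in \<open>auto simp: g_def\<close>)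
    also have "\<dots> = (\<mu> / Q ^ j) powr p * edge_energy p Es \<psi>"
      unfolding g_def by (rule edge_energy_scale[OF Es(2) lev(1)])
    also have "\<dots> \<le> (\<mu> / Q ^ j) powr p * (C_cut * ((H + 1) * ?n) powr (df - \<beta>))"
      using \<psi>(4)[OF Es] by (intro mult_left_mono) auto
    finally show ?thesis .
  qed
  have Bi_Bs: "?Bi \<subseteq> ?Bs" using Hn n1 by (intro gball_mono) linarith
  have tBi: "touching ?Bi \<subseteq> Es" "finite (touching ?Bi)"
  proof -
    show "touching ?Bi \<subseteq> Es" using EsB Bi_Bs by (auto simp: touching_def)
    then show "finite (touching ?Bi)" using Es finite_subset by blast
  qed
  have edge_log: "edge_diff W e powr p \<le> (\<Sum>j\<le>N. (Q\<^sup>2 * (Q ^ j / \<mu>)) powr p * edge_diff (G j) e powr p)"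
    if e: "e \<in> touching ?Bi" for e
  proof -
    have eE: "e \<in> E" using e by (simp add: touching_def)
    have eB: "e \<subseteq> gball V E x ((H + 1) * ?n)"
      using touching_gball_subset[OF x e] gball_mono[of "H * ?n + 1" "(H + 1) * ?n" x] n1
      by (simp add: algebra_simps)
    have main: "\<exists>j\<le>N. \<bar>W y - W z\<bar> \<le> Q\<^sup>2 * (Q ^ j / \<mu>) * \<bar>G j y - G j z\<bar>"
      if yz: "e = {y, z}" "U - u y \<le> U - u z" for y z
    proof -
      have yB: "y \<in> gball V E x ((H + 1) * ?n)" "z \<in> gball V E x ((H + 1) * ?n)" using eB yz by auto
      have le: "(H + 1) * ?n + 1 \<le> 3 * H * ?n" "(H + 1) * ?n \<le> 3 * H * ?n" using Hn Hn' n1 by linarith+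
      have yBs: "y \<in> ?Bs" "z \<in> ?Bs" using yB gball_mono[OF le(2)] by blast+
      have "\<Union>(star y) \<subseteq> ?Bs"
        using touching_gball_subset[OF x, of _ "(H + 1) * ?n"] yB gball_mono[OF le(1)]
        by (fastforce simp: touching_def star_def)
      moreover have "star y \<subseteq> Es" using EsB yBs by (auto simp: touching_def star_def)
      moreover have "adjacent E y z" using eE yz by (simp add: adjacent_def)
      moreover have "y \<notin> A0" using yBs disj by blast
      moreover have "card (star y) \<le> D" using card_star deg yB by (meson gball_subset order_trans subsetD)
      ultimately have har: "U - u z \<le> Q * (U - u y)"
        unfolding Q_def using p by (intro equilibrium_neighbour[OF u Es(2,1) _ _ _ _ _ lU _ \<delta>]) auto
      obtain j where j: "j \<le> N" "U - u z \<le> \<mu> / Q ^ j"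
        "ln (max (U - u z) \<epsilon>) - ln (max (U - u y) \<epsilon>) \<le> Q\<^sup>2 * (Q ^ j / \<mu>) * ((U - u z) - (U - u y))"
        using log_level[OF _ \<mu> _ yz(2) _ har, of N] Q_ge lU(1)[OF yBs(1)] lU(1)[OF yBs(2)] unfolding \<epsilon>_def \<mu>_def by auto
      have "G j y = U - u y" "G j z = U - u z" using j(2) yz(2) yBs \<psi>(2)[OF yB(1)] \<psi>(2)[OF yB(2)] by (auto simp: G_def g_def)
      moreover have "W y \<le> W z" unfolding W_def using \<epsilon> yz(2) by (intro ln_mono) auto
      ultimately have "\<bar>W y - W z\<bar> \<le> Q\<^sup>2 * (Q ^ j / \<mu>) * \<bar>G j y - G j z\<bar>"
        using j(3) yz(2) by (simp add: W_def)
      then show ?thesis using j(1) by blast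
    qed
    obtain y z where yz: "e = {y, z}" using edge_pairE[OF eE] by metis
    have "\<exists>j\<le>N. edge_diff W e \<le> Q\<^sup>2 * (Q ^ j / \<mu>) * edge_diff (G j) e"
    proof (cases "U - u y \<le> U - u z")
      case True then show ?thesis using main[OF yz] yz by simp
    next
      case False
      then show ?thesis using main[of z y] yz by (auto simp: insert_commute abs_minus_commute)
    qed
    then obtain j where j: "j \<le> N" "edge_diff W e \<le> Q\<^sup>2 * (Q ^ j / \<mu>) * edge_diff (G j) e" by blast
    have "edge_diff W e powr p \<le> (Q\<^sup>2 * (Q ^ j / \<mu>) * edge_diff (G j) e) powr p"
      using j(2) p edge_diff_nonneg[OF eE] by (intro powr_mono2) auto
    also have "\<dots> = (Q\<^sup>2 * (Q ^ j / \<mu>)) powr p * edge_diff (G j) e powr p"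
      by (rule powr_mult)
    also have "\<dots> \<le> (\<Sum>j\<le>N. (Q\<^sup>2 * (Q ^ j / \<mu>)) powr p * edge_diff (G j) e powr p)"
      by (rule member_le_sum[of j "{..N}" "\<lambda>j. (Q\<^sup>2 * (Q ^ j / \<mu>)) powr p * edge_diff (G j) e powr p"]) (use j(1) in auto)
    finally show ?thesis .
  qed
  have "edge_energy p (touching ?Bi) W \<le> (\<Sum>e\<in>touching ?Bi. \<Sum>j\<le>N. (Q\<^sup>2 * (Q ^ j / \<mu>)) powr p * edge_diff (G j) e powr p)"
    unfolding edge_energy_def by (rule sum_mono[OF edge_log])
  also have "\<dots> = (\<Sum>j\<le>N. (Q\<^sup>2 * (Q ^ j / \<mu>)) powr p * edge_energy p (touching ?Bi) (G j))"
    unfolding edge_energy_def sum_distrib_left by (rule sum.swap)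
  also have "\<dots> \<le> (\<Sum>j\<le>N. Q powr (2 * p) * (C_cut * ((H + 1) * ?n) powr (df - \<beta>)))"
  proof (rule sum_mono)
    fix j
    have "edge_energy p (touching ?Bi) (G j) \<le> (\<mu> / Q ^ j) powr p * (C_cut * ((H + 1) * ?n) powr (df - \<beta>))"
      using edge_energy_mono[OF tBi(1) Es(1)] cacc order_trans by blast
    then have "(Q\<^sup>2 * (Q ^ j / \<mu>)) powr p * edge_energy p (touching ?Bi) (G j)
        \<le> (Q\<^sup>2 * (Q ^ j / \<mu>)) powr p * ((\<mu> / Q ^ j) powr p * (C_cut * ((H + 1) * ?n) powr (df - \<beta>)))"
      by (intro mult_left_mono) auto
    also have "\<dots> = (Q\<^sup>2 * (Q ^ j / \<mu>) * (\<mu> / Q ^ j)) powr p * (C_cut * ((H + 1) * ?n) powr (df - \<beta>))"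
      using Q_ge \<mu> by (subst powr_mult) auto
    also have "Q\<^sup>2 * (Q ^ j / \<mu>) * (\<mu> / Q ^ j) = Q powr 2" using Q_ge \<mu> by simp
    also have "(Q powr 2) powr p = Q powr (2 * p)" by (simp add: powr_powr)
    finally show "(Q\<^sup>2 * (Q ^ j / \<mu>)) powr p * edge_energy p (touching ?Bi) (G j)
        \<le> Q powr (2 * p) * (C_cut * ((H + 1) * ?n) powr (df - \<beta>))" .
  qed
  also have "\<dots> = (real N + 1) * Q powr (2 * p) * C_cut * (H + 1) powr (df - \<beta>) * ?n powr (df - \<beta>)"
    using H_ge by (simp add: powr_mult)
  finally have "2 * edge_energy p (touching ?Bi) W
      \<le> 2 * ((real N + 1) * Q powr (2 * p) * C_cut * (H + 1) powr (df - \<beta>) * ?n powr (df - \<beta>))"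
    by (rule mult_left_mono) simp
  also have "\<dots> = 2 * (real N + 1) * Q powr (2 * p) * C_cut * (H + 1) powr (df - \<beta>) * ?n powr (df - \<beta>)"
    by (simp only: mult.assoc)
  also have "\<dots> < c_gap * ((real N - 1) * ln Q) powr p * ?n powr (df - \<beta>)"
    using N(2) n1 unfolding Q_def[symmetric] C_cut_def[symmetric] by (intro mult_strict_right_mono) auto
  finally have "2 * edge_energy p (touching ?Bi) W < region_energy p W ?Bi" using lower by linarith
  then show False using region_energy_le_edge_energy[OF finite_gball[OF x] gball_subset, of p W] by (meson not_less)
qed

text \<open>
  A ball that misses \<open>F\<close> is handled by the complementary potential \<open>1 - u\<close>, with the plates exchanged.
\<close>

lemma oscillation_decay:
  assumes u: "equilibrium p Es A0 F u" and Es: "finite Es" "Es \<subseteq> E"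
    and fin: "finite (V - (A0 \<union> F))" and Es': "touching (V - (A0 \<union> F)) \<subseteq> Es"
    and A0: "A0 \<subseteq> V" "A0 \<noteq> {}" and F: "F \<subseteq> V" "F \<noteq> {}"
    and x: "x \<in> V"
    and farA: "\<And>a. a \<in> A0 \<Longrightarrow> \<exists>ws b. walk_betw E a ws b \<and> set ws \<subseteq> A0 \<and> 2 * r k \<le> gdist E x b"
    and farF: "\<And>a. a \<in> F \<Longrightarrow> \<exists>ws b. walk_betw E a ws b \<and> set ws \<subseteq> F \<and> 2 * r k \<le> gdist E x b"
    and EsB: "touching (gball V E x (3 * H * r k)) \<subseteq> Es"
    and rad: "small_radius (r k)" "ennreal (2 * T * r k) < gdiam E V + 1"
      "cap_radius ((H + 1) * r k)" "ennreal ((H + 1) * r k) < gdiam E V + 1"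
    and disj: "gball V E x (3 * H * r k) \<inter> A0 = {} \<or> gball V E x (3 * H * r k) \<inter> F = {}"
    and lU: "\<And>y. y \<in> gball V E x (3 * H * r k) \<Longrightarrow> l \<le> u y \<and> u y \<le> U" "0 \<le> l" "U \<le> 1"
    and a: "a \<in> gball V E x (r k)" and b: "b \<in> gball V E x (r k)"
  shows "u a - u b \<le> (1 - 1 / Q ^ N) * (U - l)"
  using disj
proof
  assume d: "gball V E x (3 * H * r k) \<inter> A0 = {}"
  show ?thesis
    by (rule oscillation_one_sided[OF u Es fin Es' A0 F x farA farF EsB rad d lU(1,2) a b])
next
  assume d: "gball V E x (3 * H * r k) \<inter> F = {}"
  have comm: "F \<union> A0 = A0 \<union> F" by blast
  have "(1 - u b) - (1 - u a) \<le> (1 - 1 / Q ^ N) * ((1 - l) - (1 - U))"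
    by (rule oscillation_one_sided[OF equilibrium_complement[OF u Es(2)] Es _ _ F A0 x farF farA EsB rad d _ _ b a])
      (use fin Es' lU in \<open>auto simp: comm\<close>)
  then show ?thesis by simp
qed

end

section \<open>Geometry of the two plates\<close>

context lf_graph
begin

lemma geodesic_segment:
  assumes z: "z \<in> V" and q: "q \<in> V" and n: "n \<le> gdist E z q"
  shows "\<exists>w ws. walk_betw E q ws w \<and> gdist E z w = n \<and> (\<forall>v\<in>set ws. n \<le> gdist E z v \<and> gdist E z v \<le> gdist E z q)"
proof -
  obtain xs where xs: "walk_betw E z xs q" "length xs = Suc (gdist E z q)" using geodesic[OF z q] by metis
  have dist: "gdist E z (xs ! i) = i" if i: "i \<le> gdist E z q" for i
  proof -
    have il: "i < length xs" using i xs by simp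
    have succ: "successively (adjacent E) (take n xs)" "successively (adjacent E) (drop n xs)" for n
      using xs(1) append_take_drop_id[of n xs] unfolding walk_betw_def by (metis successively_append_iff)+
    have "last (take (Suc i) xs) = xs ! i" using il by (simp add: take_Suc_conv_app_nth)
    then have "walk_betw E z (take (Suc i) xs) (xs ! i)"
      using succ(1) xs(1) il by (auto simp: walk_betw_def hd_take)
    from gdist_le[OF this] have 1: "gdist E z (xs ! i) \<le> i" using il by simp
    have "walk_betw E (xs ! i) (drop i xs) q"
      using succ(2) xs(1) il by (auto simp: walk_betw_def hd_drop_conv_nth)
    from gdist_le[OF this] have 2: "gdist E (xs ! i) q \<le> gdist E z q - i" using xs(2) by simp
    have "xs ! i \<in> V" using walk_subset[OF xs(1) z] il by auto
    then show ?thesis using 1 2 gdist_triangle[of z "xs ! i" q] z q i by simp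
  qed
  let ?ws = "drop n xs"
  have nl: "n < length xs" using n xs by simp
  have "xs = take n xs @ ?ws" by simp
  then have "successively (adjacent E) ?ws" using xs(1) by (metis successively_append_iff walk_betw_def)
  then have "walk_betw E (xs ! n) ?ws q" using xs(1) nl by (auto simp: walk_betw_def hd_drop_conv_nth)
  then have "walk_betw E q (rev ?ws) (xs ! n)" by (rule walk_rev)
  moreover have "n \<le> gdist E z v \<and> gdist E z v \<le> gdist E z q" if "v \<in> set (rev ?ws)" for v
  proof -
    have "v \<in> set ?ws" using that by simp
    then obtain i where "i < length xs - n" "v = xs ! (n + i)" using nl by (auto simp: in_set_conv_nth)
    then show ?thesis using dist[of "n + i"] xs(2) by simp
  qed
  ultimately show ?thesis using dist[OF n] by blast
qed

text \<open>
  The union of those components of the complement of the open ball of radius \<open>a\<close> that reach distance \<open>b\<close>.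
\<close>
definition far_part :: "'a \<Rightarrow> real \<Rightarrow> real \<Rightarrow> 'a set" where
  "far_part z a b = {y \<in> V. \<exists>q xs. walk_betw E y xs q \<and> (\<forall>w\<in>set xs. a \<le> real (gdist E z w)) \<and> b \<le> real (gdist E z q)}"

lemma walk_in_far_part:
  assumes "walk_betw E y xs q" "y \<in> V" "\<And>w. w \<in> set xs \<Longrightarrow> a \<le> real (gdist E z w)" "b \<le> real (gdist E z q)"
  shows "set xs \<subseteq> far_part z a b"
proof
  fix w assume w: "w \<in> set xs"
  then obtain us vs where xs: "xs = us @ w # vs" by (meson split_list)
  have "walk_betw E w (w # vs) q" using assms(1) by (auto simp: walk_betw_def xs successively_append_iff)
  moreover have "w \<in> V" using walk_subset[OF assms(1,2)] w by blast
  ultimately show "w \<in> far_part z a b" using assms(3,4) unfolding far_part_def xs by (fastforce simp: xs)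
qed

lemma far_part_dist: "y \<in> far_part z a b \<Longrightarrow> a \<le> real (gdist E z y)"
  by (auto simp: far_part_def walk_betw_def)

lemma far_part_subset: "far_part z a b \<subseteq> V"
  by (auto simp: far_part_def)

lemma in_far_part: "y \<in> V \<Longrightarrow> b \<le> real (gdist E z y) \<Longrightarrow> a \<le> b \<Longrightarrow> y \<in> far_part z a b"
  by (auto simp: far_part_def walk_betw_def intro!: exI[of _ "[y]"])

text \<open>
  A connected set with two points at mutual distance \<open>4 * n\<close> reaches distance \<open>2 * n\<close> from any given
  vertex; this is how the plates supply long walks.
\<close>

lemma half_far:
  assumes "x \<in> V" "y \<in> V" "w \<in> V" "4 * n \<le> gdist E y w"
  shows "2 * n \<le> gdist E x y \<or> 2 * n \<le> gdist E x w"
  using gdist_triangle[of y x w] gdist_sym[of x y] assms by linarith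

text \<open>
  Geodesics to \<open>z\<close> stay in the ball, so any of its points can be joined inside it to \<open>z\<close> and from there to a
  point at distance \<open>4 * n\<close> from \<open>z\<close>.
\<close>

lemma ball_reaches_far:
  assumes z: "z \<in> V" and x: "x \<in> V" and q: "q \<in> V" "R \<le> real (gdist E z q)" and R: "4 * real n + 1 \<le> R"
    and a: "a \<in> gball V E z R"
  shows "\<exists>ws b. walk_betw E a ws b \<and> set ws \<subseteq> gball V E z R \<and> 2 * n \<le> gdist E x b"
proof -
  have "4 * n \<le> gdist E z q" using q R by linarith
  then obtain w ws where w: "walk_betw E q ws w" "gdist E z w = 4 * n"
    using geodesic_segment[OF z q(1)] by blast
  have wV: "w \<in> V" using walk_subset[OF w(1) q(1)] w(1) by (auto simp: walk_betw_def)
  have aV: "a \<in> V" "real (gdist E z a) < R" using a by (auto simp: gball_def)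
  have to_z: "\<exists>us. walk_betw E y us z \<and> set us \<subseteq> gball V E z R" if y: "y \<in> V" "real (gdist E z y) < R" for y
  proof -
    obtain v us where us: "walk_betw E y us v" "gdist E z v = 0" "\<forall>u\<in>set us. gdist E z u \<le> gdist E z y"
      using geodesic_segment[OF z y(1), of 0] by blast
    have sub: "set us \<subseteq> V" by (rule walk_subset[OF us(1) y(1)])
    then have "v \<in> V" using us(1) by (auto simp: walk_betw_def)
    then have "v = z" using us(2) gdist_eq_0 z by metis
    moreover have "set us \<subseteq> gball V E z R" using us(3) y(2) sub by (force simp: gball_def)
    ultimately show ?thesis using us(1) by blast
  qed
  obtain us where us: "walk_betw E a us z" "set us \<subseteq> gball V E z R" using to_z[OF aV] by blast
  have "real (gdist E z w) < R" using w(2) R by simp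
  then obtain vs where vs: "walk_betw E w vs z" "set vs \<subseteq> gball V E z R" using to_z[OF wV] by blast
  have "walk_betw E a (us @ tl (rev vs)) w" by (rule walk_append[OF us(1) walk_rev[OF vs(1)]])
  moreover have "set (us @ tl (rev vs)) \<subseteq> gball V E z R" using us(2) vs(2) set_walk_append[OF us(1) walk_rev[OF vs(1)]] by simp
  ultimately show ?thesis using half_far[OF x z wV, of n] w(2) us by fastforce
qed

text \<open>
  Every component contains a point \<open>q\<close> at distance at least \<open>t\<close>, and with it the part of a geodesic from \<open>q\<close> to
  \<open>z\<close> that lies at distance at least \<open>s\<close>.
\<close>

lemma far_part_reaches_far:
  assumes z: "z \<in> V" and x: "x \<in> V" and ab: "0 \<le> s" "s + 4 * real n + 1 \<le> t"
    and a: "a \<in> far_part z s t"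
  shows "\<exists>ws b. walk_betw E a ws b \<and> set ws \<subseteq> far_part z s t \<and> 2 * n \<le> gdist E x b"
proof -
  obtain q xs where q: "walk_betw E a xs q" "\<forall>w\<in>set xs. s \<le> real (gdist E z w)" "t \<le> real (gdist E z q)"
    and aV: "a \<in> V" using a by (auto simp: far_part_def)
  have xs: "set xs \<subseteq> far_part z s t" using walk_in_far_part[OF q(1) aV _ q(3)] q(2) by blast
  have qV: "q \<in> V" using walk_subset[OF q(1) aV] q(1) by (auto simp: walk_betw_def)
  let ?n = "nat \<lceil>s\<rceil>"
  have "?n \<le> gdist E z q" using ab q(3) by linarith
  then obtain w ws where w: "walk_betw E q ws w" "gdist E z w = ?n" "\<forall>v\<in>set ws. ?n \<le> gdist E z v"
    using geodesic_segment[OF z qV] by blast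
  have wV: "w \<in> V" using walk_subset[OF w(1) qV] w(1) by (auto simp: walk_betw_def)
  have "set (rev ws) \<subseteq> far_part z s t"
  proof (rule walk_in_far_part[OF walk_rev[OF w(1)] wV _ q(3)])
    fix v assume "v \<in> set (rev ws)"
    then have "?n \<le> gdist E z v" using w(3) by simp
    then show "s \<le> real (gdist E z v)" by linarith
  qed
  then have ws: "set ws \<subseteq> far_part z s t" by simp
  have "gdist E z q \<le> gdist E z w + gdist E q w" using gdist_triangle[OF z wV qV] gdist_sym[OF wV qV] by simp
  then have "4 * n \<le> gdist E q w" using w(2) q(3) ab by linarith
  then have or: "2 * n \<le> gdist E x q \<or> 2 * n \<le> gdist E x w" by (rule half_far[OF x qV wV])
  have "walk_betw E a (xs @ tl ws) w" by (rule walk_append[OF q(1) w(1)])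
  moreover have "set (xs @ tl ws) \<subseteq> far_part z s t" using xs ws set_walk_append[OF q(1) w(1)] by simp
  ultimately show ?thesis using or q(1) xs by blast
qed

lemma radius_less:
  assumes "ennreal X \<le> gdiam E V" "0 < a" "0 \<le> s" "s * a < X"
  shows "ennreal s < gdiam E V / ennreal a"
proof -
  have "s < X / a" using assms by (simp add: field_simps)
  then have "ennreal s < ennreal (X / a)" using assms by (intro ennreal_lessI) auto
  also have "\<dots> = ennreal X / ennreal a" using assms by (subst divide_ennreal) (auto intro: order_trans[of 0 "s * a"])
  also have "\<dots> \<le> gdiam E V / ennreal a" by (rule divide_right_mono_ennreal[OF assms(1)])
  finally show ?thesis .
qed

lemma less_gdiam_plus_1:
  assumes "ennreal X \<le> gdiam E V" "s \<le> X" "0 \<le> X"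
  shows "ennreal s < gdiam E V + 1"
proof -
  have "ennreal s \<le> ennreal X" using assms by (intro ennreal_leI)
  also have "ennreal X < ennreal X + 1" by (metis ennreal_1 ennreal_less_top ennreal_add_left_cancel_less add.right_neutral zero_less_one infinity_ennreal_def order_less_irrefl)
  also have "\<dots> \<le> gdiam E V + 1" using assms by (intro add_right_mono)
  finally show ?thesis .
qed

end

section \<open>Hoelder continuity and the cutoff functions\<close>

lemma power_bracket:
  fixes B t :: real
  assumes "1 < B" "1 \<le> t"
  shows "\<exists>n::nat. B ^ n \<le> t \<and> t < B ^ Suc n"
proof -
  define n where "n = nat \<lfloor>log B t\<rfloor>"
  have "0 \<le> log B t" using assms by simp
  then have n: "real n \<le> log B t" "log B t < real (Suc n)" unfolding n_def by linarith+
  have e: "B powr log B t = t" using assms by simp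
  have "B powr real n \<le> B powr log B t" "B powr log B t < B powr real (Suc n)"
    using assms(1) n by (auto intro: powr_mono simp del: powr_log_cancel)
  then have "B powr real n \<le> t" "t < B powr real (Suc n)" unfolding e .
  then show ?thesis using assms(1) powr_realpow[of B n] powr_realpow[of B "Suc n"] by (intro exI[of _ n]) simp
qed

context loewner_capacity_graph
begin

text \<open>The factor by which the oscillation drops.\<close>
definition "\<sigma> = 1 - 1 / Q ^ N"
text \<open>
  A power of \<open>\<Lambda>\<close> that is at least \<open>3 * H\<close>, so that one application of \<open>oscillation_decay\<close> leads
  from one scale to another scale; \<open>\<theta>\<close> is determined by \<open>\<sigma> = B powr (- \<theta>)\<close>.
\<close>
definition "B = real \<Lambda> ^ nat \<lceil>3 * H\<rceil>"
definition "\<theta> = - ln \<sigma> / ln B"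
text \<open>
  Up to the radius \<open>c0 K * R\<close> there is room for the Loewner and capacity conditions, and a ball of
  \<open>3 * H\<close> times this radius meets at most one of the plates. From \<open>R0 K\<close> on this radius is at least 4;
  for smaller \<open>R\<close>, indicator functions serve as cutoffs.
\<close>
definition "c0 K = min 1 ((K - 1) / 2) / (16 * H * A * A_cap)"
definition "R0 K = 4 / c0 K"
text \<open>The first two terms of \<open>C_total\<close> come from \<open>R \<ge> R0 K\<close>, the next two from \<open>R < R0 K\<close>.\<close>
definition "C_osc K = (B * \<Lambda> / c0 K) powr \<theta>"
definition "C_energy K = C_AR\<^sup>2 * (2 * K / c0 K) powr df * (C_cut * c0 K powr (df - \<beta>))"
definition "C_total K = C_osc K + C_energy K + real D * C_AR * R0 K powr \<beta> + R0 K powr \<theta> + 1"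

lemma A_cap_ge: "1 \<le> A_cap" using cap by (simp add: capacity_upper_bound_def)

lemma \<sigma>: "0 < \<sigma>" "\<sigma> < 1"
proof -
  have "Q ^ 1 \<le> Q ^ N" using Q_ge N by (intro power_increasing) auto
  then have "2 \<le> Q ^ N" using Q_ge by simp
  then show "0 < \<sigma>" "\<sigma> < 1" by (auto simp: \<sigma>_def field_simps)
qed

lemma B_ge: "3 * H \<le> B" "1 < B"
proof -
  let ?j = "nat \<lceil>3 * H\<rceil>"
  have "real ?j < 2 ^ ?j" by (rule of_nat_less_two_power)
  also have "\<dots> \<le> B" unfolding B_def using \<Lambda>_ge by (intro power_mono) auto
  finally show "3 * H \<le> B" using H_ge by linarith
  then show "1 < B" using H_ge by linarith
qed

lemma \<theta>_pos: "0 < \<theta>"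
  using divide_neg_pos[OF ln_less_zero[OF \<sigma>] ln_gt_zero[OF B_ge(2)]] by (simp add: \<theta>_def)

lemma \<sigma>_eq: "\<sigma> = B powr (- \<theta>)"
  using \<sigma> B_ge by (simp add: \<theta>_def powr_def)

lemma base_scale:
  assumes K: "1 < K" and R: "R0 K \<le> R" and s: "s = c0 K * R"
  shows "4 \<le> s" "0 < R" "9 * s \<le> H * s" "16 * (H * s) \<le> R" "16 * (H * s) \<le> (K - 1) / 2 * R"
    "16 * (A * s) \<le> R" "16 * (H * (A_cap * s)) \<le> R"
proof -
  let ?\<tau> = "min 1 ((K - 1) / 2)"
  have \<tau>: "0 < ?\<tau>" "?\<tau> \<le> 1" using K by auto
  have g: "9 \<le> H" "1 \<le> A" "1 \<le> A_cap" using H_ge A_ge A_cap_ge by auto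
  have pos: "0 < c0 K" unfolding c0_def using \<tau> g by (intro divide_pos_pos mult_pos_pos) auto
  show s4: "4 \<le> s" using R pos unfolding R0_def s by (simp add: field_simps)
  have "0 < R0 K" using pos by (simp add: R0_def)
  then show R0: "0 < R" using R by linarith
  show "9 * s \<le> H * s" using s4 g by (intro mult_right_mono) auto
  have "c0 K * (16 * H * A * A_cap) = ?\<tau>" using g by (simp add: c0_def)
  then have eq: "16 * (H * s * A * A_cap) = ?\<tau> * R" unfolding s by (simp add: mult_ac)
  have le: "x \<le> x * y" if "0 \<le> x" "1 \<le> y" for x y :: real using mult_left_mono[of 1 y x] that by simp
  have Hs: "0 \<le> H * s" using s4 g by simp
  have "H * s \<le> H * s * A" by (rule le[OF Hs g(2)])
  moreover have "H * s * A \<le> H * s * A * A_cap" using g s4 by (intro le mult_nonneg_nonneg) auto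
  ultimately have 1: "16 * (H * s) \<le> ?\<tau> * R" using eq by linarith
  have "A * s \<le> A * s * (H * A_cap)" using s4 g mult_mono[of 1 H 1 A_cap] by (intro le) auto
  moreover have "A * s * (H * A_cap) = H * s * A * A_cap" by (simp add: mult_ac)
  ultimately have 2: "16 * (A * s) \<le> ?\<tau> * R" using eq by linarith
  have "H * (A_cap * s) \<le> H * (A_cap * s) * A" using s4 g by (intro le) auto
  moreover have "H * (A_cap * s) * A = H * s * A * A_cap" by (simp add: mult_ac)
  ultimately have 3: "16 * (H * (A_cap * s)) \<le> ?\<tau> * R" using eq by linarith
  have "?\<tau> * R \<le> 1 * R" "?\<tau> * R \<le> (K - 1) / 2 * R"
    using R0 by (intro mult_right_mono min.cobounded1 min.cobounded2, simp)+
  then show "16 * (H * s) \<le> R" "16 * (H * s) \<le> (K - 1) / 2 * R" "16 * (A * s) \<le> R"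
    "16 * (H * (A_cap * s)) \<le> R" using 1 2 3 by linarith+
qed

text \<open>
  Start with the smallest scale \<open>r k\<close> exceeding the distance, and apply the decay \<open>n\<close> times while the radius grows
  by the factor \<open>B\<close>, as long as it is admissible. Distances comparable to \<open>\<rho>\<close> leave no room for a single step,
  but there the bound is at least 1.
\<close>

lemma hoelder_from_decay:
  assumes dec: "\<And>k \<omega> x. x \<in> X \<Longrightarrow> real (r k) \<le> \<rho> \<Longrightarrow> 0 \<le> \<omega> \<Longrightarrow>
      (\<And>a b. a \<in> gball V E x (3 * H * r k) \<Longrightarrow> b \<in> gball V E x (3 * H * r k) \<Longrightarrow> u a - u b \<le> \<omega>) \<Longrightarrow>
      (\<And>a b. a \<in> gball V E x (r k) \<Longrightarrow> b \<in> gball V E x (r k) \<Longrightarrow> u a - u b \<le> \<sigma> * \<omega>)"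
    and u: "\<And>x. 0 \<le> u x \<and> u x \<le> 1" and \<rho>: "0 < \<rho>"
    and x: "x \<in> X" "x \<in> V" and y: "y \<in> V"
  shows "\<bar>u x - u y\<bar> \<le> (B * \<Lambda> * real (gdist E x y) / \<rho>) powr \<theta>"
proof (cases "gdist E x y = 0")
  case True
  then show ?thesis using gdist_eq_0 x y by auto
next
  case False
  let ?d = "real (gdist E x y)"
  let ?j = "nat \<lceil>3 * H\<rceil>"
  have d1: "1 \<le> ?d" using False by simp
  have \<Lambda>1: "1 < real \<Lambda>" using \<Lambda>_ge by simp
  have iter: "u a - u b \<le> \<sigma> ^ n" if "real (r (k + ?j * n)) \<le> B * \<rho>" "a \<in> gball V E x (r k)" "b \<in> gball V E x (r k)" for n k a b
    using that
  proof (induction n arbitrary: k a b)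
    case 0
    show ?case using u[of a] u[of b] unfolding power_0 by linarith
  next
    case (Suc n)
    have rj: "real (r (k + ?j)) = B * real (r k)" by (simp add: r_def B_def power_add)
    have rN: "r (k + ?j + ?j * n) = r (k + ?j * Suc n)" by (simp add: algebra_simps)
    have "3 * H * real (r k) \<le> real (r (k + ?j))" unfolding rj using B_ge by (intro mult_right_mono) auto
    then have sub: "gball V E x (3 * H * r k) \<subseteq> gball V E x (r (k + ?j))" by (rule gball_mono)
    have IH: "u a - u b \<le> \<sigma> ^ n" if "a \<in> gball V E x (3 * H * r k)" "b \<in> gball V E x (3 * H * r k)" for a b
    proof (rule Suc.IH[of "k + ?j"])
      show "real (r (k + ?j + ?j * n)) \<le> B * \<rho>" unfolding rN by (rule Suc.prems(1))
    qed (use that sub in blast)+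
    have "B * real (r k) \<le> real (r (k + ?j * Suc n))"
      unfolding rj[symmetric] using r_mono[of "k + ?j" "k + ?j * Suc n"] by simp
    then have "B * real (r k) \<le> B * \<rho>" using Suc.prems(1) by linarith
    then have "real (r k) \<le> \<rho>" using B_ge by simp
    then have "u a - u b \<le> \<sigma> * \<sigma> ^ n"
      using dec[OF x(1), of k "\<sigma> ^ n" a b] IH Suc.prems \<sigma> by simp
    then show ?case by simp
  qed
  define t where "t = \<rho> / (\<Lambda> * ?d)"
  have t: "0 < t" using \<rho> \<Lambda>1 d1 by (simp add: t_def)
  have rhs: "(B * \<Lambda> * ?d / \<rho>) powr \<theta> = (t / B) powr (- \<theta>)"
  proof -
    have e: "B * \<Lambda> * ?d / \<rho> = inverse (t / B)" using \<rho> \<Lambda>1 d1 B_ge by (simp add: t_def field_simps)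
    show ?thesis unfolding e powr_minus by (rule inverse_powr)
  qed
  show ?thesis
  proof (cases "1 \<le> B * t")
    case False
    have "t / B \<le> 1" using False B_ge t by (smt (verit, ccfv_SIG) divide_le_eq_1 mult_less_cancel_right1)
    then have "1 powr (- \<theta>) \<le> (t / B) powr (- \<theta>)" using t B_ge \<theta>_pos by (intro powr_mono2') auto
    then show ?thesis using u[of x] u[of y] rhs by auto
  next
    case True
    obtain n where n: "B ^ n \<le> B * t" "B * t < B ^ Suc n" using power_bracket[OF B_ge(2) True] by blast
    obtain k where k: "real \<Lambda> ^ k \<le> ?d" "?d < real \<Lambda> ^ Suc k" using power_bracket[OF \<Lambda>1 d1] by blast
    have rk: "real (r (Suc k)) \<le> \<Lambda> * ?d" "?d < real (r (Suc k))" using k \<Lambda>1 by (auto simp: r_def)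
    have "real (r (Suc k + ?j * n)) = real (r (Suc k)) * B ^ n" by (simp add: r_def B_def power_add power_mult)
    also have "\<dots> \<le> (\<Lambda> * ?d) * (B * t)" using rk n B_ge \<Lambda>1 by (intro mult_mono) auto
    also have "\<dots> = B * \<rho>" using \<Lambda>1 d1 by (simp add: t_def)
    finally have le: "real (r (Suc k + ?j * n)) \<le> B * \<rho>" .
    have "x \<in> gball V E x (r (Suc k))" "y \<in> gball V E x (r (Suc k))" using x y rk(2) d1 by (auto simp: gball_def)
    then have "\<bar>u x - u y\<bar> \<le> \<sigma> ^ n" using iter[OF le, of x y] iter[OF le, of y x] by auto
    also have "\<sigma> ^ n = (B ^ n) powr (- \<theta>)"
      using B_ge \<sigma> by (simp add: \<sigma>_eq powr_powr flip: powr_realpow) (simp add: mult.commute)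
    also have "\<dots> \<le> (t / B) powr (- \<theta>)"
    proof (rule powr_mono2')
      have "t / B \<le> t / 1" using B_ge t by (intro divide_left_mono) auto
      moreover have "t < B ^ n" using n(2) B_ge by simp
      ultimately show "t / B \<le> B ^ n" by simp
    qed (use t B_ge \<theta>_pos in auto)
    finally show ?thesis using rhs by simp
  qed
qed

end

context lf_graph
begin

lemma far_point: "gball V E z s \<noteq> V \<Longrightarrow> \<exists>q\<in>V. s \<le> real (gdist E z q)"
  by (force simp: gball_def not_less)

lemma gdiam_ge_real:
  assumes "z \<in> V" "q \<in> V" "s \<le> real (gdist E z q)"
  shows "ennreal s \<le> gdiam E V"
proof -
  have "ennreal s \<le> ennreal (real (gdist E z q))" using assms by (intro ennreal_leI)
  also have "\<dots> \<le> gdiam E V" using gdiam_ge[OF assms(1,2)] by (simp add: ennreal_of_nat_eq_real_of_nat)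
  finally show ?thesis .
qed

end

context loewner_capacity_graph
begin

lemma C_total_ge:
  assumes "1 < K"
  shows "C_osc K \<le> C_total K" "C_energy K \<le> C_total K" "real D * C_AR * R0 K powr \<beta> \<le> C_total K"
    "R0 K powr \<theta> \<le> C_total K" "0 < C_total K"
proof -
  have "0 \<le> C_osc K" by (simp add: C_osc_def)
  moreover have "0 \<le> C_energy K" using C_cut_pos by (simp add: C_energy_def)
  moreover have "0 \<le> real D * C_AR * R0 K powr \<beta>" using C_AR_ge by simp
  moreover have "0 \<le> R0 K powr \<theta>" by simp
  ultimately show "C_osc K \<le> C_total K" "C_energy K \<le> C_total K" "real D * C_AR * R0 K powr \<beta> \<le> C_total K"
    "R0 K powr \<theta> \<le> C_total K" "0 < C_total K" unfolding C_total_def by linarith+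
qed

definition good_cutoff :: "real \<Rightarrow> 'a \<Rightarrow> real \<Rightarrow> ('a \<Rightarrow> real) \<Rightarrow> bool" where
  "good_cutoff K z R \<phi> \<longleftrightarrow>
     (\<forall>x\<in>V. 0 \<le> \<phi> x \<and> \<phi> x \<le> 1) \<and>
     (\<forall>x\<in>gball V E z R. \<phi> x = 1) \<and>
     {x \<in> V. \<phi> x \<noteq> 0} \<subseteq> gball V E z (K * R) \<and>
     energy E p \<phi> \<le> ennreal (C_total K * R powr (df - \<beta>)) \<and>
     (\<forall>x\<in>V. \<forall>y\<in>V. \<bar>\<phi> x - \<phi> y\<bar> \<le> C_total K * (real (gdist E x y) / R) powr \<theta>)"

text \<open>
  The indicator function of the ball: nonzero distances are at least 1, hence comparable to \<open>R\<close> or larger, and the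
  number of edges at the ball is at most a multiple of its volume.
\<close>

lemma small_scale_cutoff:
  assumes K: "1 < K" and \<beta>: "0 < \<beta>" and z: "z \<in> V" and R: "1 \<le> R" "R < R0 K" and far: "gball V E z (K * R) \<noteq> V"
  shows "\<exists>\<phi>. good_cutoff K z R \<phi>"
proof -
  let ?A = "gball V E z R"
  define \<phi> where "\<phi> x = (if x \<in> ?A then 1 else 0 :: real)" for x
  have RKR: "R \<le> K * R" using K R by simp
  obtain q where q: "q \<in> V" "K * R \<le> real (gdist E z q)" using far_point[OF far] by blast
  have diam: "ennreal R < gdiam E V + 1"
    using gdiam_ge_real[OF z q] RKR R by (intro less_gdiam_plus_1[of "K * R"]) auto
  have fin: "finite (touching ?A)" by (intro finite_touching finite_gball z gball_subset)
  have tE: "touching ?A \<subseteq> E" by (auto simp: touching_def)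
  have "energy E p \<phi> = ennreal (edge_energy p (touching ?A) \<phi>)"
  proof (rule energy_eq_edge_energy[OF fin tE])
    fix e assume e: "e \<in> E - touching ?A"
    then obtain a b where ab: "e = {a, b}" using edge_pairE by blast
    then have "a \<notin> ?A" "b \<notin> ?A" using e by (auto simp: touching_def)
    then show "edge_diff \<phi> e = 0" using ab by (simp add: \<phi>_def)
  qed
  also have "\<dots> \<le> ennreal (C_total K * R powr (df - \<beta>))"
  proof (rule ennreal_leI)
    have "edge_energy p (touching ?A) \<phi> \<le> (\<Sum>e\<in>touching ?A. 1)"
      unfolding edge_energy_def
    proof (rule sum_mono)
      fix e assume "e \<in> touching ?A"
      then obtain a b where ab: "e = {a, b}" using edge_pairE tE by blast
      then have "edge_diff \<phi> e = 0 \<or> edge_diff \<phi> e = 1" by (simp add: \<phi>_def)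
      then show "edge_diff \<phi> e powr p \<le> 1" by auto
    qed
    also have "\<dots> = real (card (touching ?A))" by simp
    also have "\<dots> \<le> real D * real (card ?A)"
    proof -
      have "card (touching ?A) \<le> (\<Sum>x\<in>?A. card (star x))"
        unfolding touching_eq by (rule card_UN_le[OF finite_gball[OF z]])
      also have "\<dots> \<le> (\<Sum>x\<in>?A. D)"
        using card_star deg gball_subset by (intro sum_mono) (meson order_trans subsetD)
      finally have "card (touching ?A) \<le> card ?A * D" by simp
      then have "real (card (touching ?A)) \<le> real (card ?A * D)" by (rule of_nat_mono)
      then show ?thesis by (simp add: mult.commute)
    qed
    also have "\<dots> \<le> real D * (C_AR * R powr df)"
      using ball_card_upper[OF z R(1) diam] by (intro mult_left_mono) auto
    also have "R powr df = R powr \<beta> * R powr (df - \<beta>)" by (simp flip: powr_add)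
    also have "real D * (C_AR * (R powr \<beta> * R powr (df - \<beta>)))
        \<le> real D * (C_AR * (R0 K powr \<beta> * R powr (df - \<beta>)))"
      using R \<beta> C_AR_ge by (intro mult_left_mono mult_right_mono powr_mono2) auto
    also have "\<dots> = (real D * C_AR * R0 K powr \<beta>) * R powr (df - \<beta>)" by simp
    also have "\<dots> \<le> C_total K * R powr (df - \<beta>)" using C_total_ge[OF K] by (intro mult_right_mono) auto
    finally show "edge_energy p (touching ?A) \<phi> \<le> C_total K * R powr (df - \<beta>)" .
  qed
  finally have en: "energy E p \<phi> \<le> ennreal (C_total K * R powr (df - \<beta>))" .
  have hold: "\<bar>\<phi> x - \<phi> y\<bar> \<le> C_total K * (real (gdist E x y) / R) powr \<theta>" if xy: "x \<in> V" "y \<in> V" for x y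
  proof (cases "x = y")
    case False
    then have "gdist E x y \<noteq> 0" using gdist_eq_0 xy by blast
    then have "1 / R0 K \<le> real (gdist E x y) / R" using R by (intro frac_le) auto
    then have "(1 / R0 K) powr \<theta> \<le> (real (gdist E x y) / R) powr \<theta>"
      using R \<theta>_pos by (intro powr_mono2) auto
    then have "R0 K powr \<theta> * (1 / R0 K) powr \<theta> \<le> C_total K * (real (gdist E x y) / R) powr \<theta>"
      using C_total_ge[OF K] by (intro mult_mono) auto
    moreover have "R0 K powr \<theta> * (1 / R0 K) powr \<theta> = 1" using R by (simp flip: powr_mult)
    moreover have "\<bar>\<phi> x - \<phi> y\<bar> \<le> 1" by (simp add: \<phi>_def)
    ultimately show ?thesis by linarith
  qed (use C_total_ge[OF K] in auto)
  have sub: "?A \<subseteq> gball V E z (K * R)" by (rule gball_mono[OF RKR])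
  show ?thesis unfolding good_cutoff_def
    using en hold sub by (intro exI[of _ \<phi>]) (auto simp: \<phi>_def)
qed

text \<open>
  The competitor is the maximum of capacity cutoffs of radius \<open>s\<close> about the points of a maximal \<open>s\<close>-separated
  subset of the inner plate. The number of these points is bounded by comparing volumes: the balls of radius \<open>s / 2\<close> are
  disjoint and lie in the ball of radius \<open>K * R\<close>, whose radius is at most the diameter of the graph.
\<close>

lemma equilibrium_energy_bound:
  assumes K: "1 < K" and z: "z \<in> V" and R: "R0 K \<le> R" and far: "gball V E z (K * R) \<noteq> V"
    and u: "equilibrium p Es (gball V E z R) F u" and Es: "finite Es" "Es \<subseteq> E"
    and F: "\<And>y. y \<in> F \<Longrightarrow> y \<in> V \<and> (1 + K) / 2 * R \<le> real (gdist E z y)"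
  shows "edge_energy p Es u \<le> C_energy K * R powr (df - \<beta>)"
proof -
  let ?A = "gball V E z R"
  define s where "s = c0 K * R"
  note base = base_scale[OF K R s_def]
  note s4 = base(1) and R0 = base(2) and Hs = base(3) and tau = base(4,5) and As = base(6,7)
  have KR: "K * R = R + 2 * ((K - 1) / 2 * R)" "(1 + K) / 2 * R = R + (K - 1) / 2 * R" by (auto simp: field_simps)
  obtain q where q: "q \<in> V" "K * R \<le> real (gdist E z q)" using far_point[OF far] by blast
  note diam = gdiam_ge_real[OF z q]
  have sA: "s * A_cap < K * R"
  proof -
    have "1 * (A_cap * s) \<le> H * (A_cap * s)" using H_ge A_cap_ge s4 by (intro mult_right_mono) auto
    moreover have "1 * (A_cap * s) = s * A_cap" by simp
    moreover have "R < K * R" using K R0 by simp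
    ultimately show ?thesis using As(2) R0 by linarith
  qed
  have caps: "cap_radius s" using sA s4 A_cap_ge by (intro radius_less[OF diam]) auto
  have KRs: "R + 2 * s \<le> K * R" by (subst KR(1)) (use tau Hs s4 in linarith)
  have s_KR: "s \<le> K * R" "s / 2 \<le> K * R" "K * R \<le> K * R" "0 \<le> K * R"
  proof -
    show "s \<le> K * R" using KRs R0 s4 by linarith
    then show "s / 2 \<le> K * R" "0 \<le> K * R" using s4 by linarith+
  qed simp
  have s_diam: "ennreal s < gdiam E V + 1" "ennreal (s / 2) < gdiam E V + 1" "ennreal (K * R) < gdiam E V + 1"
    using less_gdiam_plus_1[OF diam, of s] less_gdiam_plus_1[OF diam, of "s / 2"]
      less_gdiam_plus_1[OF diam, of "K * R"] s_KR by blast+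
  have s1: "1 \<le> s" "1 \<le> s / 2" "0 < s" using s4 by auto
  obtain I where I: "I \<subseteq> ?A" "\<forall>i\<in>I. \<forall>j\<in>I. i \<noteq> j \<longrightarrow> s \<le> real (gdist E i j)" "?A \<subseteq> (\<Union>i\<in>I. gball V E i s)"
    using ex_separated_cover[OF finite_gball[OF z] gball_subset s1(3)] by metis
  have finI: "finite I" using I(1) finite_gball[OF z] finite_subset by blast
  have IV: "i \<in> V" "real (gdist E z i) < R" if "i \<in> I" for i using I(1) that by (auto simp: gball_def)
  have "\<forall>i\<in>I. \<exists>\<psi>. (\<forall>y. 0 \<le> \<psi> y \<and> \<psi> y \<le> (1::real)) \<and> (\<forall>y\<in>gball V E i s. \<psi> y = 1) \<and>
    (\<forall>y. y \<notin> gball V E i (2 * s) \<longrightarrow> \<psi> y = 0) \<and>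
    (\<forall>Es. finite Es \<and> Es \<subseteq> E \<longrightarrow> edge_energy p Es \<psi> \<le> C_cut * s powr (df - \<beta>))"
    using ex_cutoff[OF IV(1) s1(1) caps s_diam(1)] by blast
  from bchoice[OF this] obtain \<psi> where \<psi>: "\<forall>i\<in>I. (\<forall>y. 0 \<le> \<psi> i y \<and> \<psi> i y \<le> (1::real)) \<and> (\<forall>y\<in>gball V E i s. \<psi> i y = 1) \<and>
    (\<forall>y. y \<notin> gball V E i (2 * s) \<longrightarrow> \<psi> i y = 0) \<and>
    (\<forall>Es. finite Es \<and> Es \<subseteq> E \<longrightarrow> edge_energy p Es (\<psi> i) \<le> C_cut * s powr (df - \<beta>))" by (rule exE)
  have "\<exists>g. (\<forall>x. 0 \<le> g x \<and> g x \<le> 1) \<and> (\<forall>i\<in>I. \<forall>x. \<psi> i x \<le> g x) \<and>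
    (\<forall>x. (\<forall>i\<in>I. \<psi> i x = 0) \<longrightarrow> g x = 0) \<and> edge_energy p Es g \<le> real (card I) * (C_cut * s powr (df - \<beta>))"
    using \<psi> Es p by (intro ex_maximum_of_family finI) auto
  then obtain g where g0: "(\<forall>x. 0 \<le> g x \<and> g x \<le> 1) \<and> (\<forall>i\<in>I. \<forall>x. \<psi> i x \<le> g x) \<and>
    (\<forall>x. (\<forall>i\<in>I. \<psi> i x = 0) \<longrightarrow> g x = 0) \<and> edge_energy p Es g \<le> real (card I) * (C_cut * s powr (df - \<beta>))" by (rule exE)
  have "feasible ?A F g"
    unfolding feasible_def
  proof (intro conjI ballI)
    show "\<forall>x. 0 \<le> g x \<and> g x \<le> 1" using g0 by blast
  next
    fix x assume "x \<in> ?A"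
    then obtain i where i: "i \<in> I" "x \<in> gball V E i s" using I(3) by blast
    then have "\<psi> i x = 1" using \<psi> by blast
    then have "1 \<le> g x" using g0 i(1) by metis
    moreover have "g x \<le> 1" using g0 by blast
    ultimately show "g x = 1" by linarith
  next
    fix y assume y: "y \<in> F"
    have "\<psi> i y = 0" if i: "i \<in> I" for i
    proof -
      have yV: "y \<in> V" "(1 + K) / 2 * R \<le> real (gdist E z y)" using F[OF y] by auto
      have "gdist E z y \<le> gdist E z i + gdist E i y" using gdist_triangle[OF z IV(1)[OF i] yV(1)] .
      then have "real (gdist E z y) \<le> real (gdist E z i) + real (gdist E i y)" by linarith
      then have "2 * s \<le> real (gdist E i y)" using yV(2)[unfolded KR(2)] IV(2)[OF i] tau Hs s4 by linarith
      then have "y \<notin> gball V E i (2 * s)" by (simp add: gball_def)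
      then show ?thesis using \<psi> i by blast
    qed
    then show "g y = 0" using g0 by blast
  qed
  then have "edge_energy p Es u \<le> edge_energy p Es g" using u by (simp add: equilibrium_def)
  also have "\<dots> \<le> real (card I) * (C_cut * s powr (df - \<beta>))" using g0 by blast
  also have "\<dots> \<le> (C_AR\<^sup>2 * (2 * K / c0 K) powr df) * (C_cut * s powr (df - \<beta>))"
  proof (rule mult_right_mono)
    show "0 \<le> C_cut * s powr (df - \<beta>)" using C_cut_pos by simp
    have disj: "gball V E i (s / 2) \<inter> gball V E j (s / 2) = {}" if ij: "i \<in> I" "j \<in> I" "i \<noteq> j" for i j
    proof -
      have far: "s \<le> real (gdist E i j)" using I(2) ij by blast
      {
        fix w assume w: "w \<in> V" "real (gdist E i w) < s / 2" "real (gdist E j w) < s / 2"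
        then have "gdist E i j \<le> gdist E i w + gdist E j w"
          using gdist_triangle[of i w j] gdist_sym[of w j] IV ij by simp
        then have False using w far by linarith
      }
      then show ?thesis by (auto simp: gball_def)
    qed
    have "real (card I) * (s / 2) powr df = (\<Sum>i\<in>I. (s / 2) powr df)" by simp
    also have "\<dots> \<le> (\<Sum>i\<in>I. C_AR * real (card (gball V E i (s / 2))))"
      using ball_card_lower[OF IV(1) s1(2) s_diam(2)] by (intro sum_mono) auto
    also have "\<dots> = C_AR * real (card (\<Union>i\<in>I. gball V E i (s / 2)))"
      using disj finI finite_gball IV(1) by (subst card_UN_disjoint) (auto simp: sum_distrib_left)
    also have "\<dots> \<le> C_AR * real (card (gball V E z (K * R)))"
    proof -
      have "(\<Union>i\<in>I. gball V E i (s / 2)) \<subseteq> gball V E z (K * R)"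
      proof (rule UN_least)
        fix i assume i: "i \<in> I"
        show "gball V E i (s / 2) \<subseteq> gball V E z (K * R)"
          using IV(2)[OF i] KRs s4 by (intro gball_triangle[OF z IV(1)[OF i]]) linarith
      qed
      then show ?thesis using C_AR_ge finite_gball[OF z] by (intro mult_left_mono) (auto intro: card_mono)
    qed
    also have "\<dots> \<le> C_AR * (C_AR * (K * R) powr df)"
      using C_AR_ge ball_card_upper[OF z _ s_diam(3)] s_KR s1 by (intro mult_left_mono) auto
    finally have "real (card I) * (s / 2) powr df \<le> C_AR\<^sup>2 * (K * R) powr df" by (simp add: power2_eq_square)
    also have "K * R = (2 * K / c0 K) * (s / 2)" using s4 by (auto simp: s_def)
    also have "((2 * K / c0 K) * (s / 2)) powr df = (2 * K / c0 K) powr df * (s / 2) powr df"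
      by (rule powr_mult)
    finally have "real (card I) * (s / 2) powr df \<le> (C_AR\<^sup>2 * (2 * K / c0 K) powr df) * (s / 2) powr df"
      by (simp only: mult.assoc)
    then show "real (card I) \<le> C_AR\<^sup>2 * (2 * K / c0 K) powr df"
      by (rule mult_right_le_imp_le) (use s4 in simp)
  qed
  also have "\<dots> = C_energy K * R powr (df - \<beta>)" by (simp add: C_energy_def s_def powr_mult)
  finally show ?thesis .
qed

lemma large_scale_cutoff:
  assumes K: "1 < K" and z: "z \<in> V" and R: "R0 K \<le> R" and far: "gball V E z (K * R) \<noteq> V"
  shows "\<exists>\<phi>. good_cutoff K z R \<phi>"
proof -
  let ?A = "gball V E z R"
  define K' where "K' = (1 + K) / 2"
  define F where "F = far_part z (K' * R) (K * R)"
  (* V1 contains all neighbours of vertices where u may be nonzero, and all balls on which the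
     oscillation decay is used. *)
  define V1 where "V1 = gball V E z (K * R + R)"
  define Es where "Es = touching V1"
  define s where "s = c0 K * R"
  note base = base_scale[OF K R s_def]
  note s4 = base(1) and R0 = base(2) and Hs = base(3) and tau = base(4,5) and As = base(6,7)
  have KR: "R + 16 * (H * s) \<le> K' * R" "K' * R + 16 * (H * s) \<le> K * R"
  proof -
    have "K' * R = R + (K - 1) / 2 * R" "K * R = K' * R + (K - 1) / 2 * R" by (auto simp: field_simps K'_def)
    then show "R + 16 * (H * s) \<le> K' * R" "K' * R + 16 * (H * s) \<le> K * R" using tau(2) by linarith+
  qed
  obtain q where q: "q \<in> V" "K * R \<le> real (gdist E z q)" using far_point[OF far] by blast
  note diam = gdiam_ge_real[OF z q]
  have AV: "?A \<subseteq> V" by (rule gball_subset)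
  have FV: "F \<subseteq> V" unfolding F_def by (rule far_part_subset)
  have Fdist: "K' * R \<le> real (gdist E z y)" if "y \<in> F" for y using that unfolding F_def by (rule far_part_dist)
  have le: "K' * R \<le> K * R" "0 \<le> K * R" using KR tau(1) Hs s4 by linarith+
  have FI: "y \<in> F" if "y \<in> V" "K * R \<le> real (gdist E z y)" for y
    unfolding F_def by (rule in_far_part[OF that le(1)])
  have "z \<in> ?A" using z R0 by (simp add: gball_def)
  then have Ane: "?A \<noteq> {}" by blast
  have Fne: "F \<noteq> {}" using FI[OF q] by blast
  have disj: "?A \<inter> F = {}"
  proof -
    have "R < K' * R" using KR(1) Hs s4 by linarith
    then show ?thesis using Fdist by (fastforce simp: gball_def)
  qed
  have free: "V - (?A \<union> F) \<subseteq> gball V E z (K * R)" using FI by (auto simp: gball_def)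
  have sub1: "gball V E z (K * R) \<subseteq> V1" unfolding V1_def using KR R0 by (intro gball_mono) linarith
  have finV1: "finite V1" unfolding V1_def by (rule finite_gball[OF z])
  have Es: "finite Es" "Es \<subseteq> E"
  proof -
    show "finite Es" unfolding Es_def by (rule finite_touching[OF finV1]) (simp add: V1_def gball_subset)
    show "Es \<subseteq> E" by (auto simp: Es_def touching_def)
  qed
  have fin: "finite (V - (?A \<union> F))" by (rule finite_subset[OF order_trans[OF free sub1] finV1])
  have Es': "touching (V - (?A \<union> F)) \<subseteq> Es" unfolding Es_def by (rule touching_mono[OF order_trans[OF free sub1]])
  obtain u where u: "equilibrium p Es ?A F u" using ex_equilibrium[OF Es(2) less_imp_le[OF p] disj] by (rule exE)
  have fu: "feasible ?A F u" using u by (simp add: equilibrium_def)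
  have u0: "u y = 0" if "y \<in> V" "y \<notin> gball V E z (K * R)" for y
    using FI[of y] that fu by (auto simp: feasible_def gball_def)
  have "energy E p u = ennreal (edge_energy p Es u)"
  proof (rule energy_eq_edge_energy[OF Es])
    fix e assume e: "e \<in> E - Es"
    then obtain a b where ab: "e = {a, b}" "a \<in> V" "b \<in> V" using edge_pairE by (metis DiffD1)
    then have "a \<notin> V1" "b \<notin> V1" using e by (auto simp: Es_def touching_def)
    then have "u a = 0" "u b = 0" using u0 ab sub1 by blast+
    then show "edge_diff u e = 0" using ab by simp
  qed
  also have "\<dots> \<le> ennreal (C_total K * R powr (df - \<beta>))"
  proof (rule ennreal_leI)
    have "edge_energy p Es u \<le> C_energy K * R powr (df - \<beta>)"
      using Fdist FV by (intro equilibrium_energy_bound[OF K z R far u Es]) (auto simp: K'_def)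
    also have "\<dots> \<le> C_total K * R powr (df - \<beta>)" using C_total_ge[OF K] by (intro mult_right_mono) auto
    finally show "edge_energy p Es u \<le> C_total K * R powr (df - \<beta>)" .
  qed
  finally have en: "energy E p u \<le> ennreal (C_total K * R powr (df - \<beta>))" .
  have dec: "u a - u b \<le> \<sigma> * \<omega>"
    if x: "x \<in> gball V E z (K * R)" and k: "real (r k) \<le> s" and \<omega>: "0 \<le> \<omega>"
      and osc: "\<And>a b. a \<in> gball V E x (3 * H * r k) \<Longrightarrow> b \<in> gball V E x (3 * H * r k) \<Longrightarrow> u a - u b \<le> \<omega>"
      and ab: "a \<in> gball V E x (r k)" "b \<in> gball V E x (r k)" for k \<omega> x a b
  proof -
    let ?n = "real (r k)" and ?B = "gball V E x (3 * H * r k)"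
    have xV: "x \<in> V" "real (gdist E z x) < K * R" using x by (auto simp: gball_def)
    have n1: "1 \<le> ?n" using r_ge[of k] by simp
    have Hn: "9 * ?n \<le> H * ?n" "H * ?n \<le> H * s" using H_ge k by (auto intro!: mult_right_mono mult_left_mono)
    have eqs: "3 * H * ?n = 3 * (H * ?n)" "(H + 1) * ?n = H * ?n + ?n" "2 * T * ?n = H * ?n - 3 * ?n"
      by (auto simp: H_def algebra_simps)
    have xB: "x \<in> ?B" using xV n1 Hn eqs by (auto simp: gball_def)
    have finB: "finite (u ` ?B)" "u ` ?B \<noteq> {}" using finite_gball[OF xV(1)] xB by auto
    define l where "l = Min (u ` ?B)"
    define U where "U = Max (u ` ?B)"
    have lU: "l \<le> u y \<and> u y \<le> U" if "y \<in> ?B" for y using that finB by (simp add: l_def U_def)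
    have lin: "l \<in> u ` ?B" "U \<in> u ` ?B" unfolding l_def U_def using finB by auto
    then have "U - l \<le> \<omega>" using osc by auto
    moreover have "0 \<le> l" "U \<le> 1" using lin fu by (auto simp: feasible_def)
    moreover have "u a - u b \<le> (1 - 1 / Q ^ N) * (U - l)"
    proof (rule oscillation_decay[OF u Es fin Es' AV Ane FV Fne xV(1) _ _ _ _ _ _ _ _ lU _ _ ab])
      fix a assume a: "a \<in> ?A"
      have "4 * real (r k) + 1 \<le> R" using k tau Hs s4 by linarith
      moreover have "R \<le> real (gdist E z q)" using q KR tau(1) Hs s4 by linarith
      ultimately show "\<exists>ws b. walk_betw E a ws b \<and> set ws \<subseteq> ?A \<and> 2 * r k \<le> gdist E x b"
        using ball_reaches_far[OF z xV(1) q(1) _ _ a] by blast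
    next
      fix a assume a: "a \<in> F"
      have "0 \<le> K' * R" "K' * R + 4 * real (r k) + 1 \<le> K * R" using k KR tau(1) Hs s4 R0 by linarith+
      then show "\<exists>ws b. walk_betw E a ws b \<and> set ws \<subseteq> F \<and> 2 * r k \<le> gdist E x b"
        using far_part_reaches_far[OF z xV(1)] a unfolding F_def by blast
    next
      have "?B \<subseteq> V1" unfolding V1_def
        using xV KR tau(1) Hs Hn eqs by (intro gball_triangle[OF z xV(1)]) linarith
      then show "touching ?B \<subseteq> Es" unfolding Es_def by (rule touching_mono)
    next
      have "?n * A \<le> s * A" using k A_ge by (intro mult_right_mono) auto
      moreover have "s * A = A * s" by simp
      ultimately have "?n * A < K * R" using As(1) KR Hs s4 R0 by linarith
      then show "small_radius (r k)" using A_ge n1 by (intro radius_less[OF diam]) auto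
    next
      have "0 \<le> K * R" by (rule le(2))
      have le: "2 * T * ?n \<le> K * R" "(H + 1) * ?n \<le> K * R" using k KR tau(1) Hs Hn eqs s4 R0 by linarith+
      show "ennreal (2 * T * r k) < gdiam E V + 1" "ennreal ((H + 1) * r k) < gdiam E V + 1"
        using less_gdiam_plus_1[OF diam] le \<open>0 \<le> K * R\<close> by blast+
    next
      have "(H + 1) * ?n \<le> 2 * (H * s)" using k Hs Hn eqs s4 by linarith
      then have "(H + 1) * ?n * A_cap \<le> 2 * (H * s) * A_cap" using A_cap_ge by (intro mult_right_mono) auto
      also have "\<dots> = 2 * (H * (A_cap * s))" by simp
      also have "\<dots> < K * R" using As KR tau(1) Hs s4 R0 by linarith
      finally have "(H + 1) * ?n * A_cap < K * R" .
      then show "cap_radius ((H + 1) * r k)" using A_cap_ge H_ge by (intro radius_less[OF diam]) auto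
    next
      show "?B \<inter> ?A = {} \<or> ?B \<inter> F = {}"
      proof (rule ccontr)
        assume "\<not> ?thesis"
        then obtain v w where v: "v \<in> ?B" "v \<in> ?A" and w: "w \<in> ?B" "w \<in> F" by blast
        have V: "v \<in> V" "w \<in> V" using v w by (auto simp: gball_def)
        have "gdist E z w \<le> gdist E z v + gdist E v w" using gdist_triangle z V by blast
        moreover have "gdist E v w \<le> gdist E x v + gdist E x w"
          using gdist_triangle[of v x w] gdist_sym[of v x] V xV(1) by simp
        ultimately have "real (gdist E z w) \<le> real (gdist E z v) + real (gdist E x v) + real (gdist E x w)" by linarith
        moreover have "real (gdist E x v) < 3 * H * ?n" "real (gdist E x w) < 3 * H * ?n" "real (gdist E z v) < R"
          using v w by (auto simp: gball_def)
        ultimately show False using Fdist[OF w(2)] KR tau(1) Hn eqs Hs s4 by linarith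
      qed
    qed (use \<open>0 \<le> l\<close> \<open>U \<le> 1\<close> in auto)
    ultimately show ?thesis
      using \<sigma> mult_left_mono[of "U - l" \<omega> \<sigma>] unfolding \<sigma>_def[symmetric] by linarith
  qed
  have hold1: "\<bar>u x - u y\<bar> \<le> C_total K * (real (gdist E x y) / R) powr \<theta>"
    if xy: "x \<in> gball V E z (K * R)" "y \<in> V" for x y
  proof -
    have "\<bar>u x - u y\<bar> \<le> (B * \<Lambda> * real (gdist E x y) / s) powr \<theta>"
    proof (rule hoelder_from_decay[where X = "gball V E z (K * R)" and u = u and \<rho> = s])
      show "x \<in> gball V E z (K * R)" "x \<in> V" "y \<in> V" using xy by (auto simp: gball_def)
      show "0 \<le> u x \<and> u x \<le> 1" for x using fu by (simp add: feasible_def)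
      show "0 < s" using s4 by simp
    qed (rule dec)
    also have "B * \<Lambda> * real (gdist E x y) / s = (B * \<Lambda> / c0 K) * (real (gdist E x y) / R)" by (simp add: s_def)
    also have "\<dots> powr \<theta> = C_osc K * (real (gdist E x y) / R) powr \<theta>" unfolding C_osc_def by (rule powr_mult)
    also have "\<dots> \<le> C_total K * (real (gdist E x y) / R) powr \<theta>" using C_total_ge[OF K] by (intro mult_right_mono) auto
    finally show ?thesis .
  qed
  have hold: "\<bar>u x - u y\<bar> \<le> C_total K * (real (gdist E x y) / R) powr \<theta>" if xy: "x \<in> V" "y \<in> V" for x y
  proof -
    consider "x \<in> gball V E z (K * R)" | "y \<in> gball V E z (K * R)"
      | "x \<notin> gball V E z (K * R)" "y \<notin> gball V E z (K * R)" by blast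
    then show ?thesis
    proof cases
      case 1 then show ?thesis using hold1 xy by blast
    next
      case 2 then show ?thesis using hold1[of y x] xy gdist_sym[of x y] by (simp add: abs_minus_commute)
    next
      case 3 then show ?thesis using u0 xy C_total_ge[OF K] by simp
    qed
  qed
  show ?thesis unfolding good_cutoff_def
    using en hold fu u0 by (intro exI[of _ u]) (auto simp: feasible_def)
qed

lemma ex_good_cutoff:
  assumes "1 < K" "0 < \<beta>" "z \<in> V" "1 \<le> R" "gball V E z (K * R) \<noteq> V"
  shows "\<exists>\<phi>. good_cutoff K z R \<phi>"
  using assms small_scale_cutoff large_scale_cutoff by (cases "R < R0 K") auto

end

section \<open>Choice of the constants\<close>

lemma ex_branching_number:
  fixes p \<zeta> :: real
  assumes "\<zeta> < 1"
  shows "\<exists>m::nat. 1 \<le> m \<and> 2 * 4 powr p * (12 * real m) powr \<zeta> \<le> real m"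
proof -
  define b where "b = 2 * 4 powr p * 12 powr \<zeta>"
  define m where "m = nat \<lceil>max 1 (b powr (1 / (1 - \<zeta>)))\<rceil>"
  have b: "0 < b" by (simp add: b_def)
  have m: "1 \<le> real m" "b powr (1 / (1 - \<zeta>)) \<le> real m" unfolding m_def by linarith+
  have "b = (b powr (1 / (1 - \<zeta>))) powr (1 - \<zeta>)" using b assms by (simp add: powr_powr)
  also have "\<dots> \<le> real m powr (1 - \<zeta>)" using m assms by (intro powr_mono2) auto
  finally have "b * real m powr \<zeta> \<le> real m powr (1 - \<zeta>) * real m powr \<zeta>" by (intro mult_right_mono) auto
  also have "\<dots> = real m" using m by (simp flip: powr_add)
  finally show ?thesis using m by (intro exI[of _ m]) (simp add: b_def powr_mult)
qed

lemma ex_harnack_step: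
  fixes p :: real and D :: nat
  assumes "1 < p"
  shows "\<exists>\<delta>. 0 < \<delta> \<and> \<delta> \<le> 1 \<and> real D * (2 * \<delta>) powr p < \<delta>"
proof -
  define b where "b = 1 / ((real D + 1) * 2 powr p)"
  define \<delta> where "\<delta> = min 1 (b powr (1 / (p - 1)))"
  have b: "0 < b" by (simp add: b_def)
  then have \<delta>: "0 < \<delta>" "\<delta> \<le> 1" by (auto simp: \<delta>_def)
  have "\<delta> powr (p - 1) \<le> (b powr (1 / (p - 1))) powr (p - 1)" using \<delta> assms by (intro powr_mono2) (auto simp: \<delta>_def)
  also have "\<dots> = b" using b assms by (simp add: powr_powr)
  finally have "real D * 2 powr p * \<delta> powr (p - 1) \<le> real D * 2 powr p * b" by (intro mult_left_mono) auto
  also have "\<dots> < 1" by (simp add: b_def)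
  finally have "real D * 2 powr p * \<delta> powr (p - 1) * \<delta> < 1 * \<delta>" using \<delta> by (intro mult_strict_right_mono) auto
  moreover have "\<delta> powr p = \<delta> powr (p - 1) * \<delta>" using \<delta> by (simp flip: powr_mult_base add: powr_diff)
  ultimately have "real D * (2 * \<delta>) powr p < \<delta>" by (simp add: powr_mult)
  then show ?thesis using \<delta> by blast
qed

lemma ex_level_number:
  fixes p a b :: real
  assumes "1 < p" "0 < a" "0 < b" "0 < t"
  shows "\<exists>N::nat. 2 \<le> N \<and> b * (real N + 1) < a * ((real N - 1) * t) powr p"
proof -
  define c where "c = 3 * b / (a * t powr p)"
  define n where "n = Suc (nat \<lceil>c powr (1 / (p - 1))\<rceil>)"
  have c: "0 < c" using assms by (simp add: c_def)
  have n: "1 \<le> real n" "c powr (1 / (p - 1)) < real n" unfolding n_def by linarith+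
  have "c = (c powr (1 / (p - 1))) powr (p - 1)" using c assms by (simp add: powr_powr)
  also have "\<dots> < real n powr (p - 1)" using n assms by (intro powr_less_mono2) auto
  finally have "c * real n < real n powr (p - 1) * real n" using n by (intro mult_strict_right_mono) auto
  also have "\<dots> = real n powr p" using n by (simp add: powr_diff)
  finally have "a * t powr p * (c * real n) < a * t powr p * real n powr p" using assms by (intro mult_strict_left_mono) auto
  moreover have "a * t powr p * (c * real n) = 3 * b * real n" using assms by (simp add: c_def)
  moreover have "b * (real n + 2) \<le> b * (3 * real n)" using n assms by (intro mult_left_mono) auto
  ultimately have "b * (real n + 2) < a * t powr p * real n powr p" by simp
  then have "b * (real (Suc n) + 1) < a * ((real (Suc n) - 1) * t) powr p"
    by (simp add: powr_mult algebra_simps)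
  then show ?thesis using n by (intro exI[of _ "Suc n"]) auto
qed

theorem theorem5p9:
  fixes p df \<beta> K C_AR A C_cap A_cap :: real
    and c_BCL L_BCL :: "real \<Rightarrow> real"
    and D :: nat
  assumes "1 < p" and "1 \<le> df" and "0 < \<beta>" and "1 < K"
    and "1 - p \<le> df - \<beta>" and "df - \<beta> < 1"
  shows "\<exists>\<theta> C :: real. 0 < \<theta> \<and> 0 < C \<and>
    (\<forall>(V :: 'a set) (E :: 'a set set).
       connected_simple_graph V E \<longrightarrow>
       graph_deg V E = enat D \<longrightarrow>
       ahlfors_regular V E df C_AR \<longrightarrow>
       ball_loewner V E p (df - \<beta>) A c_BCL L_BCL \<longrightarrow>
       capacity_upper_bound V E p \<beta> C_cap A_cap \<longrightarrow>
       (\<forall>z\<in>V. \<forall>R\<ge>1. gball V E z (K * R) \<noteq> V \<longrightarrow>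
          (\<exists>\<phi> :: 'a \<Rightarrow> real.
             (\<forall>x\<in>V. 0 \<le> \<phi> x \<and> \<phi> x \<le> 1) \<and>
             (\<forall>x\<in>gball V E z R. \<phi> x = 1) \<and>
             {x \<in> V. \<phi> x \<noteq> 0} \<subseteq> gball V E z (K * R) \<and>
             energy E p \<phi> \<le> ennreal (C * R powr (df - \<beta>)) \<and>
             (\<forall>x\<in>V. \<forall>y\<in>V.
                \<bar>\<phi> x - \<phi> y\<bar> \<le> C * (real (gdist E x y) / R) powr \<theta>))))"
proof (cases "\<exists>(V :: 'a set) E. connected_simple_graph V E \<and> graph_deg V E = enat D \<and> ahlfors_regular V E df C_AR \<and>
       ball_loewner V E p (df - \<beta>) A c_BCL L_BCL \<and> capacity_upper_bound V E p \<beta> C_cap A_cap")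
  (* The positivity of the constants is derived from the assumptions on the graph, so the case without
     any graph of this kind is split off. *)
  case False
  then show ?thesis by (intro exI[of _ 1]) auto
next
  case True
  then obtain V0 :: "'a set" and E0 where G0: "connected_simple_graph V0 E0" "ahlfors_regular V0 E0 df C_AR"
    "ball_loewner V0 E0 p (df - \<beta>) A c_BCL L_BCL" "capacity_upper_bound V0 E0 p \<beta> C_cap A_cap" by blast
  obtain m :: nat where m: "1 \<le> m" "2 * 4 powr p * (12 * real m) powr (df - \<beta>) \<le> real m"
    using ex_branching_number[OF assms(6)] by blast
  obtain \<delta> where \<delta>: "0 < \<delta>" "\<delta> \<le> 1" "real D * (2 * \<delta>) powr p < \<delta>" using ex_harnack_step[OF assms(1)] by blast
  interpret g0: loewner_graph V0 E0 p df "df - \<beta>" C_AR A c_BCL L_BCL m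
    by unfold_locales (use G0 m assms in auto)
  define b where "b = 2 * (1 + 1 / \<delta>) powr (2 * p) * (2 * C_cap * C_AR) * (g0.H + 1) powr (df - \<beta>)"
  have "0 < 1 + 1 / \<delta>" "0 < C_cap" "0 < C_AR" "0 < g0.H + 1"
    using \<delta> G0(4) g0.C_AR_ge g0.T_ge by (auto simp: capacity_upper_bound_def g0.H_def add_pos_pos)
  then have b: "0 < b" unfolding b_def by (intro mult_pos_pos) auto
  have "0 < ln (1 + 1 / \<delta>)" using \<delta> by (intro ln_gt_zero) auto
  from ex_level_number[OF assms(1) g0.c_gap_pos b this] obtain N :: nat where N: "2 \<le> N"
    "b * (real N + 1) < g0.c_gap * ((real N - 1) * ln (1 + 1 / \<delta>)) powr p" by blast
  have N': "2 * (real N + 1) * (1 + 1 / \<delta>) powr (2 * p) * (2 * C_cap * C_AR) * (g0.H + 1) powr (df - \<beta>)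
        < g0.c_gap * ((real N - 1) * ln (1 + 1 / \<delta>)) powr p"
    using N(2) unfolding b_def by (simp only: mult_ac)
  have inst: "loewner_capacity_graph V E p df \<beta> C_AR A c_BCL L_BCL m C_cap A_cap D \<delta> N"
    if "connected_simple_graph V E" "graph_deg V E = enat D" "ahlfors_regular V E df C_AR"
       "ball_loewner V E p (df - \<beta>) A c_BCL L_BCL" "capacity_upper_bound V E p \<beta> C_cap A_cap"
    for V :: "'a set" and E
  proof -
    interpret g: loewner_graph V E p df "df - \<beta>" C_AR A c_BCL L_BCL m
      by unfold_locales (use that m assms in auto)
    have deg: "card (neighbours E x) \<le> D" if "x \<in> V" for x
    proof -
      have "enat (card (neighbours E x)) \<le> graph_deg V E" unfolding graph_deg_def using that by (rule SUP_upper)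
      then show ?thesis using \<open>graph_deg V E = enat D\<close> by simp
    qed
    show ?thesis by unfold_locales (use that deg \<delta> N(1) N' in auto)
  qed
  (* The constants of the locale are functions of its parameters other than V and E, so they can be
     read off from any admissible graph. *)
  obtain E1 V1 where G1: "loewner_capacity_graph (V1 :: 'a set) E1 p df \<beta> C_AR A c_BCL L_BCL m C_cap A_cap D \<delta> N"
    using True inst by blast
  interpret g1: loewner_capacity_graph V1 E1 p df \<beta> C_AR A c_BCL L_BCL m C_cap A_cap D \<delta> N by (rule G1)
  show ?thesis
  proof (rule exI[of _ g1.\<theta>], rule exI[of _ "g1.C_total K"], intro conjI allI impI ballI)
    show "0 < g1.\<theta>" by (rule g1.\<theta>_pos)
    show "0 < g1.C_total K" using g1.C_total_ge assms by blast
  next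
    fix V :: "'a set" and E z R
    assume H: "connected_simple_graph V E" "graph_deg V E = enat D" "ahlfors_regular V E df C_AR"
       "ball_loewner V E p (df - \<beta>) A c_BCL L_BCL" "capacity_upper_bound V E p \<beta> C_cap A_cap"
      and z: "z \<in> V" "1 \<le> R" "gball V E z (K * R) \<noteq> V"
    interpret g: loewner_capacity_graph V E p df \<beta> C_AR A c_BCL L_BCL m C_cap A_cap D \<delta> N
      by (rule inst[OF H])
    obtain \<phi> where \<phi>: "g.good_cutoff K z R \<phi>" using g.ex_good_cutoff[OF assms(4,3) z] by (rule exE)
    show "\<exists>\<phi> :: 'a \<Rightarrow> real.
             (\<forall>x\<in>V. 0 \<le> \<phi> x \<and> \<phi> x \<le> 1) \<and>
             (\<forall>x\<in>gball V E z R. \<phi> x = 1) \<and>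
             {x \<in> V. \<phi> x \<noteq> 0} \<subseteq> gball V E z (K * R) \<and>
             energy E p \<phi> \<le> ennreal (g1.C_total K * R powr (df - \<beta>)) \<and>
             (\<forall>x\<in>V. \<forall>y\<in>V.
                \<bar>\<phi> x - \<phi> y\<bar> \<le> g1.C_total K * (real (gdist E x y) / R) powr g1.\<theta>)"
      by (rule exI[of _ \<phi>]) (rule \<phi>[unfolded g.good_cutoff_def])
  qed
qed

end
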